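(* Let $n\ge 2$ and let $J\subseteq C(n,2)$ be a realizable $2$-set. Define recursively $L^2=\emptyset$, $M^2=J$, and for $i\ge 3$ \[L^i=(M^{i-1})_s,\qquad M^i=(M^{i-1})_s\cup\big(M^{i-1}\setminus L^{i-1}\big)_F ,\] so that $L^i\subseteq M^i\subseteq C(n,i)$. Let $B_i(J)$ be the set of $\sim$-classes of admissible $M^i$-orders in which every element of $L^i$ precedes every element of $M^i\setminus L^i$, regarded as a subposet of the set of all $\sim$-classes of admissible $M^i$-orders equipped with $\le_{\mathrm{MS}}$. Then: (1) $B_i(J)$ is a ranked poset under $\le_{\mathrm{MS}}$, with rank function given by $|\mathrm{Inv}(\cdot)|$. (2) $B_i(J)$ has a unique minimal element $r_{\min}$ and a unique maximal element $r_{\max}$, and $\mathrm{Inv}(r_{\min})=L^{i+1}$, $\mathrm{Inv}(r_{\max})=M^{i+1}$. (3) For a maximal chain $r_{\min}=r_0,r_1,\dots,r_m=r_{\max}$ in $B_i(J)$ with $r_j=p_{X_j}(r_{j-1})$ and $X_j\notin\mathrm{Inv}(r_{j-1})$, the sets $X_1,\dots,X_m$ enumerate $M^{i+1}\setminus L^{i+1}$, so maximal chains correspond to a subset of the total orders on $M^{i+1}\setminus L^{i+1}$; prepending any admissible $L^{i+1}$-order to the order $X_1<\dots<X_m$ gives an admissible $M^{i+1}$-order placing $L^{i+1}$ first; up to $\sim$, every admissible $M^{i+1}$-order placing $L^{i+1}$ first arises this way; this gives a surjection from the set of maximal chains in $B_i(J)$ onto $B_{i+1}(J)$. (4) Each element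 of $B_i(J)$ is uniquely determined by its inversion set.
   Context: $I_n=\{1,\dots,n\}$; $C(n,k)$ is the set of $k$-element subsets of $I_n$. The lexicographic order on $C(n,k)$ compares subsets written as increasing sequences lexicographically; the antilexicographic order is its reverse. For $X\in C(n,k+1)$ the packet of $X$ is $P_X=\{Y\in C(n,k):Y\subset X\}$ (a "$k$-packet"); writing $X=\{x_1<\dots<x_{k+1}\}$ its lexicographic order is $X\setminus\{x_{k+1}\}<\dots<X\setminus\{x_1\}$. A prefix (suffix) of a finite totally ordered set $t_1<\dots<t_m$ is a set $\{t_1,\dots,t_j\}$ ($\{t_j,\dots,t_m\}$), possibly empty or everything. For any $A\subseteq C(n,k)$ define subsets of $C(n,k+1)$: $A_p$ (resp. $A_s$) = the $X$ such that $P_X\cap A$ is a nonempty prefix (resp. suffix) of $P_X$ different from $P_X$; $A_F=\{X:P_X\subseteq A\}$; $A_\emptyset=\{X:P_X\cap A=\emptyset\}$. $A$ is a realizable $k$-set if $P_X\cap A$ is a prefix or a suffix of $P_X$ for every $X\in C(n,k+1)$. For $A\subseteq C(n,k)$, an admissible $A$-order is a total order $\rho$ on $A$ that induces the antilexicographic order on $P_X\cap A$ for $X\in A_s$, the lexicographic order on $P_X\cap A$ for $X\in A_p$, and either the lexicographic or antilexicographic order on $P_X$ for $X\in A_F$. Its inversion set is $\mathrm{Inv}(\rho)=A_s\cup\{X\in A_F:\rho|_{P_X}\text{ is antilexicographic}\}\subseteq C(n,k+1)$. Two admissible $A$-orders are elementarily equivalent if they differ by swapping two adjacent elements not lying in a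 common $k$-packet; $\sim$ is the generated equivalence relation (inversion sets are $\sim$-invariant). For $X\in A_F$ such that $P_X$ is a contiguous block in some representative $\rho$ of a class $r$, the packet flip $p_X(r)$ is the class of the order obtained by reversing that block. $r\le_{\mathrm{MS}}r'$ iff there is a sequence $r=r_1,\dots,r_{l+1}=r'$ with $r_{j+1}=p_{X_j}(r_j)$, $X_j\in A_F$, $X_j\notin\mathrm{Inv}(r_j)$. A maximal chain in $B_i(J)$ is such a sequence of single flips from $r_{\min}$ to $r_{\max}$. *)

theory Defs
  imports "HOL-Combinatorics.Multiset_Permutations"
begin

section \<open>Packets and the lexicographic order\<close>

definition ksubsets :: "nat \<Rightarrow> nat \<Rightarrow> nat set set" where
  "ksubsets n k = {Y. Y \<subseteq> {1..n} \<and> card Y = k}"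

definition lex_less :: "nat set \<Rightarrow> nat set \<Rightarrow> bool" where
  "lex_less Y Z \<longleftrightarrow> (sorted_list_of_set Y, sorted_list_of_set Z) \<in> lexord {(a, b). a < b}"

definition antilex_less :: "nat set \<Rightarrow> nat set \<Rightarrow> bool" where
  "antilex_less Y Z \<longleftrightarrow> lex_less Z Y"

definition packet :: "nat \<Rightarrow> nat \<Rightarrow> nat set \<Rightarrow> nat set set" where
  "packet n k X = {Y \<in> ksubsets n k. Y \<subset> X}"

text \<open>Removing the larger element gives the lexicographically smaller member of the packet, so
  the lexicographic order on the packet of \<open>{x\<^sub>1 < \<dots> < x\<^sub>m}\<close> is
  \<open>X - {x\<^sub>m} < \<dots> < X - {x\<^sub>1}\<close>.\<close>

lemma lex_less_remove:
  assumes "finite X" "x \<in> X" "y \<in> X" "x < y"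
  shows "lex_less (X - {y}) (X - {x})"
proof -
  define xs where "xs = sorted_list_of_set X"
  have xs: "set xs = X" "sorted xs" "distinct xs"
    using assms(1) by (auto simp: xs_def)
  obtain us vs where split: "xs = us @ x # vs"
    using assms(2) xs(1) by (metis split_list)
  have us: "\<forall>u\<in>set us. u < x" and vs: "\<forall>v\<in>set vs. x < v"
    using xs(2,3) unfolding split by (auto simp: sorted_append less_le)
  have y: "y \<in> set vs" "y \<notin> set us" "x \<notin> set us"
    using assms(3,4) us xs(1) unfolding split by (auto dest: less_asym)
  have "sorted_list_of_set (X - {y}) = us @ x # remove1 y vs"
    using assms(1,4) y by (simp add: sorted_list_of_set_remove flip: xs_def)
      (simp add: split remove1_append)
  moreover have "sorted_list_of_set (X - {x}) = us @ vs"
    using assms(1) y by (simp add: sorted_list_of_set_remove flip: xs_def)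
      (simp add: split remove1_append)
  moreover have "(x # remove1 y vs, vs) \<in> lexord {(a, b). a < b}"
    using y(1) vs by (cases vs) auto
  ultimately show ?thesis
    by (simp add: lex_less_def lexord_append_leftI)
qed

text \<open>Prefixes and suffixes of the finite set \<open>T\<close> with respect to the lexicographic order;
  \<open>us @ vs\<close> is the increasing enumeration of \<open>T\<close>.\<close>

definition lex_prefix :: "nat set set \<Rightarrow> nat set set \<Rightarrow> bool" where
  "lex_prefix T S \<longleftrightarrow> (\<exists>us vs. sorted_wrt lex_less (us @ vs) \<and> set (us @ vs) = T \<and> S = set us)"

definition lex_suffix :: "nat set set \<Rightarrow> nat set set \<Rightarrow> bool" where
  "lex_suffix T S \<longleftrightarrow> (\<exists>us vs. sorted_wrt lex_less (us @ vs) \<and> set (us @ vs) = T \<and> S = set vs)"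

definition prefix_part :: "nat \<Rightarrow> nat \<Rightarrow> nat set set \<Rightarrow> nat set set" where
  "prefix_part n k A = {X \<in> ksubsets n (Suc k). lex_prefix (packet n k X) (packet n k X \<inter> A)
     \<and> packet n k X \<inter> A \<noteq> {} \<and> packet n k X \<inter> A \<noteq> packet n k X}"

definition suffix_part :: "nat \<Rightarrow> nat \<Rightarrow> nat set set \<Rightarrow> nat set set" where
  "suffix_part n k A = {X \<in> ksubsets n (Suc k). lex_suffix (packet n k X) (packet n k X \<inter> A)
     \<and> packet n k X \<inter> A \<noteq> {} \<and> packet n k X \<inter> A \<noteq> packet n k X}"

definition full_part :: "nat \<Rightarrow> nat \<Rightarrow> nat set set \<Rightarrow> nat set set" where
  "full_part n k A = {X \<in> ksubsets n (Suc k). packet n k X \<subseteq> A}"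

definition realizable :: "nat \<Rightarrow> nat \<Rightarrow> nat set set \<Rightarrow> bool" where
  "realizable n k A \<longleftrightarrow> A \<subseteq> ksubsets n k \<and>
     (\<forall>X\<in>ksubsets n (Suc k). lex_prefix (packet n k X) (packet n k X \<inter> A)
                           \<or> lex_suffix (packet n k X) (packet n k X \<inter> A))"

section \<open>Admissible orders\<close>

text \<open>A total order on a finite set is encoded as the list of its elements in increasing order,
  i.e. as an element of \<^const>\<open>permutations_of_set\<close>; the order induced on a packet
  is then given by filtering the list.\<close>

definition restr_order :: "nat \<Rightarrow> nat \<Rightarrow> nat set \<Rightarrow> nat set list \<Rightarrow> nat set list" where
  "restr_order n k X \<rho> = filter (\<lambda>Y. Y \<in> packet n k X) \<rho>"

definition admissible_orders :: "nat \<Rightarrow> nat \<Rightarrow> nat set set \<Rightarrow> nat set list set" where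
  "admissible_orders n k A = {\<rho> \<in> permutations_of_set A.
     (\<forall>X\<in>suffix_part n k A. sorted_wrt antilex_less (restr_order n k X \<rho>)) \<and>
     (\<forall>X\<in>prefix_part n k A. sorted_wrt lex_less (restr_order n k X \<rho>)) \<and>
     (\<forall>X\<in>full_part n k A. sorted_wrt lex_less (restr_order n k X \<rho>)
                         \<or> sorted_wrt antilex_less (restr_order n k X \<rho>))}"

definition inv_set :: "nat \<Rightarrow> nat \<Rightarrow> nat set set \<Rightarrow> nat set list \<Rightarrow> nat set set" where
  "inv_set n k A \<rho> = suffix_part n k A \<union>
     {X \<in> full_part n k A. sorted_wrt antilex_less (restr_order n k X \<rho>)}"

definition elem_equiv :: "nat \<Rightarrow> nat \<Rightarrow> nat set set \<Rightarrow> nat set list \<Rightarrow> nat set list \<Rightarrow> bool" where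
  "elem_equiv n k A \<rho> \<rho>' \<longleftrightarrow> \<rho> \<in> admissible_orders n k A \<and> \<rho>' \<in> admissible_orders n k A \<and>
     (\<exists>us Y Z vs. \<rho> = us @ Y # Z # vs \<and> \<rho>' = us @ Z # Y # vs \<and>
        \<not> (\<exists>X\<in>ksubsets n (Suc k). Y \<in> packet n k X \<and> Z \<in> packet n k X))"

definition order_equiv :: "nat \<Rightarrow> nat \<Rightarrow> nat set set \<Rightarrow> (nat set list \<times> nat set list) set" where
  "order_equiv n k A = {(\<rho>, \<rho>'). \<rho> \<in> admissible_orders n k A \<and> \<rho>' \<in> admissible_orders n k A \<and>
     equivclp (elem_equiv n k A) \<rho> \<rho>'}"

section \<open>Equivalence classes and the Manin--Schechtman order\<close>

definition order_classes :: "nat \<Rightarrow> nat \<Rightarrow> nat set set \<Rightarrow> nat set list set set" where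
  "order_classes n k A = admissible_orders n k A // order_equiv n k A"

text \<open>Inversion sets do not change under elementary equivalence, so the image below is a
  singleton for every class \<open>r\<close>.\<close>

definition inv_class :: "nat \<Rightarrow> nat \<Rightarrow> nat set set \<Rightarrow> nat set list set \<Rightarrow> nat set set" where
  "inv_class n k A r = the_elem (inv_set n k A ` r)"

text \<open>\<open>packet_flip n k A X r r'\<close> is the graph of the partially defined map \<open>p\<^sub>X\<close>:
  it says that \<open>p\<^sub>X(r)\<close> is defined and equal to \<open>r'\<close>.\<close>

definition packet_flip ::
    "nat \<Rightarrow> nat \<Rightarrow> nat set set \<Rightarrow> nat set \<Rightarrow> nat set list set \<Rightarrow> nat set list set \<Rightarrow> bool" where
  "packet_flip n k A X r r' \<longleftrightarrow> X \<in> full_part n k A \<and>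
     r \<in> order_classes n k A \<and> r' \<in> order_classes n k A \<and>
     (\<exists>us ps vs. us @ ps @ vs \<in> r \<and> set ps = packet n k X \<and> us @ rev ps @ vs \<in> r')"

text \<open>\<open>flip_seq n k A rs Xs\<close>: with \<open>rs = [r\<^sub>0, \<dots>, r\<^sub>m]\<close> and \<open>Xs = [X\<^sub>1, \<dots>, X\<^sub>m]\<close>,
  each \<open>r\<^sub>j\<close> is the upward flip of \<open>r\<^sub>j\<^sub>-\<^sub>1\<close> at \<open>X\<^sub>j\<close>.\<close>

definition flip_seq ::
    "nat \<Rightarrow> nat \<Rightarrow> nat set set \<Rightarrow> nat set list set list \<Rightarrow> nat set list \<Rightarrow> bool" where
  "flip_seq n k A rs Xs \<longleftrightarrow> set rs \<subseteq> order_classes n k A \<and> length rs = Suc (length Xs) \<and>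
     (\<forall>j<length Xs. packet_flip n k A (Xs ! j) (rs ! j) (rs ! Suc j)
                  \<and> Xs ! j \<notin> inv_class n k A (rs ! j))"

definition ms_order ::
    "nat \<Rightarrow> nat \<Rightarrow> nat set set \<Rightarrow> (nat set list set \<times> nat set list set) set" where
  "ms_order n k A = {(r, r'). \<exists>rs Xs. flip_seq n k A rs Xs \<and> hd rs = r \<and> last rs = r'}"

section \<open>The posets associated with a realizable 2-set\<close>

text \<open>Only the values for \<open>i \<ge> 2\<close> are meaningful; those for \<open>i < 2\<close> are junk.\<close>

fun level_L :: "nat \<Rightarrow> nat set set \<Rightarrow> nat \<Rightarrow> nat set set"
  and level_M :: "nat \<Rightarrow> nat set set \<Rightarrow> nat \<Rightarrow> nat set set" where
  "level_L n J i = (if i \<le> 2 then {} else suffix_part n (i - 1) (level_M n J (i - 1)))"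
| "level_M n J i = (if i \<le> 2 then J else suffix_part n (i - 1) (level_M n J (i - 1)) \<union>
     full_part n (i - 1) (level_M n J (i - 1) - level_L n J (i - 1)))"

declare level_L.simps [simp del] level_M.simps [simp del]

definition L_first_orders :: "nat \<Rightarrow> nat set set \<Rightarrow> nat \<Rightarrow> nat set list set" where
  "L_first_orders n J i = {\<rho> \<in> admissible_orders n i (level_M n J i).
     \<forall>a<length \<rho>. \<forall>b<length \<rho>.
       \<rho> ! a \<in> level_L n J i \<and> \<rho> ! b \<in> level_M n J i - level_L n J i \<longrightarrow> a < b}"

text \<open>A class belongs to the poset if \<^emph>\<open>some\<close> representative places \<open>L\<close> first; this
  property of orders is not invariant under equivalence.\<close>

definition B_set :: "nat \<Rightarrow> nat set set \<Rightarrow> nat \<Rightarrow> nat set list set set" where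
  "B_set n J i = {r \<in> order_classes n i (level_M n J i). r \<inter> L_first_orders n J i \<noteq> {}}"

definition B_order ::
    "nat \<Rightarrow> nat set set \<Rightarrow> nat \<Rightarrow> (nat set list set \<times> nat set list set) set" where
  "B_order n J i = Restr (ms_order n i (level_M n J i)) (B_set n J i)"

definition B_inv :: "nat \<Rightarrow> nat set set \<Rightarrow> nat \<Rightarrow> nat set list set \<Rightarrow> nat set set" where
  "B_inv n J i r = inv_class n i (level_M n J i) r"

definition B_max_chains ::
    "nat \<Rightarrow> nat set set \<Rightarrow> nat \<Rightarrow> nat set list set \<Rightarrow> nat set list set \<Rightarrow>
     (nat set list set list \<times> nat set list) set" where
  "B_max_chains n J i rmin rmax = {(rs, Xs). flip_seq n i (level_M n J i) rs Xs \<and>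
     set rs \<subseteq> B_set n J i \<and> hd rs = rmin \<and> last rs = rmax}"

section \<open>Ranked posets\<close>

definition covers :: "'a set \<Rightarrow> ('a \<times> 'a) set \<Rightarrow> 'a \<Rightarrow> 'a \<Rightarrow> bool" where
  "covers P R y x \<longleftrightarrow> x \<in> P \<and> y \<in> P \<and> (x, y) \<in> R \<and> x \<noteq> y \<and>
     (\<forall>z\<in>P. (x, z) \<in> R \<and> (z, y) \<in> R \<longrightarrow> z = x \<or> z = y)"

definition ranked_poset :: "'a set \<Rightarrow> ('a \<times> 'a) set \<Rightarrow> ('a \<Rightarrow> nat) \<Rightarrow> bool" where
  "ranked_poset P R rk \<longleftrightarrow> partial_order_on P R \<and>
     (\<forall>x\<in>P. \<forall>y\<in>P. (x, y) \<in> R \<and> x \<noteq> y \<longrightarrow> rk x < rk y) \<and>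
     (\<forall>x y. covers P R y x \<longrightarrow> rk y = Suc (rk x))"

definition minimal_in :: "'a set \<Rightarrow> ('a \<times> 'a) set \<Rightarrow> 'a \<Rightarrow> bool" where
  "minimal_in P R x \<longleftrightarrow> x \<in> P \<and> (\<forall>y\<in>P. (y, x) \<in> R \<longrightarrow> y = x)"

definition maximal_in :: "'a set \<Rightarrow> ('a \<times> 'a) set \<Rightarrow> 'a \<Rightarrow> bool" where
  "maximal_in P R x \<longleftrightarrow> x \<in> P \<and> (\<forall>y\<in>P. (x, y) \<in> R \<longrightarrow> y = x)"

end

theory Submission
  imports Defs
begin

text \<open>A realizable \<open>2\<close>-set \<open>J\<close> is the inversion set of a permutation. Call a set a clique if all its
  pairs lie in \<open>J\<close>, and let \<open>t(X)\<close> be the length of the longest final segment of \<open>X\<close> that is a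
  clique. Then \<open>M\<^sup>i - L\<^sup>i\<close> consists of the cliques and \<open>L\<^sup>i\<close> of the non-cliques with even \<open>t\<close>, and both
  \<open>L\<^sup>i\<close> and \<open>M\<^sup>i\<close> are realizable.

  Every realizable \<open>U \<subseteq> C(n,k+1)\<close> is the inversion set of a total order of \<open>C(n,k)\<close>. Recursively,
  with \<open>V = {Y. Y \<union> {n} \<in> U}\<close>, such an order lists first the sets without \<open>n\<close> outside \<open>V\<close>, then the sets
  containing \<open>n\<close> (ordered by \<open>V\<close>), then \<open>V\<close>. The same recursion makes the packet of \<open>X\<close> contiguous
  whenever \<open>U \<union> {X}\<close> is realizable as well. Hence \<open>r \<mapsto> Inv(r)\<close> identifies \<open>B\<^sub>i(J)\<close> with the realizable
  sets between \<open>L\<^bsup>i+1\<^esup>\<close> and \<open>M\<^bsup>i+1\<^esup>\<close>, and a flip adds one element. Orders with the same inversion set are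
  equivalent by bubble sort.

  It remains to see that such a set other than \<open>L\<^bsup>i+1\<^esup>\<close> (other than \<open>M\<^bsup>i+1\<^esup>\<close>) admits the removal
  (addition) of some clique. A suitable clique is found among those with a fixed maximum \<open>p\<close>, by
  means of a total order for the restriction of \<open>U\<close> to \<open>{1..p-1}\<close>. Finally, a total order of
  \<open>M\<^bsup>i+1\<^esup>\<close> is admissible if and only if all its initial segments are realizable, which turns maximal
  chains of \<open>B\<^sub>i(J)\<close> into elements of \<open>B\<^bsub>i+1\<^esub>(J)\<close>.\<close>

section \<open>Precedence in lists\<close>

text \<open>Realizability is a consistency condition: three packets inside a common larger set meet
  pairwise, and a non-monotone pattern of orientations would order the three common elements
  cyclically. This criterion concerns orders of all of C(n,k), whereas the poset consists of orders
  of M^i. Both directions therefore pass through orders of the whole of C(n,i): such an order is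
  restricted to M^i, and an order of M^i with L^i first is prolonged by the remaining sets, taken in
  an order with inversion set L^(i+1).

  The obstacle is that placing L^i first is not invariant under equivalence. It is traded for the
  condition that the inversion set lies in M^(i+1). A packet inside M^i whose set is not a clique
  contains a clique that the antilexicographic order puts before a member of L^i, so having L^i
  first forbids inverting it. Conversely, if among the packets inside M^i only those of cliques are
  inverted, then L^i can be moved to the front.\<close>

fun precedes :: "'a list \<Rightarrow> 'a \<Rightarrow> 'a \<Rightarrow> bool" where
  "precedes [] a b \<longleftrightarrow> False"
| "precedes (x # xs) a b \<longleftrightarrow> a = x \<and> b \<in> set xs \<or> precedes xs a b"

lemma precedes_in_set: "precedes xs a b \<Longrightarrow> a \<in> set xs \<and> b \<in> set xs"
  by (induction xs) auto

lemma precedes_append: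
  "precedes (xs @ ys) a b \<longleftrightarrow>
     precedes xs a b \<or> precedes ys a b \<or> a \<in> set xs \<and> b \<in> set ys"
  by (induction xs) auto

lemma precedes_filter: "precedes (filter P xs) a b \<longleftrightarrow> P a \<and> P b \<and> precedes xs a b"
  by (induction xs) (auto dest: precedes_in_set)

lemma precedes_map: "precedes xs a b \<Longrightarrow> precedes (map f xs) (f a) (f b)"
  by (induction xs) auto

lemma precedes_rev: "precedes (rev xs) a b \<longleftrightarrow> precedes xs b a"
  by (induction xs) (auto simp: precedes_append)

lemma precedes_asym: "distinct xs \<Longrightarrow> precedes xs a b \<Longrightarrow> \<not> precedes xs b a"
  by (induction xs) (auto dest: precedes_in_set)

lemma precedes_irrefl: "distinct xs \<Longrightarrow> \<not> precedes xs a a"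
  using precedes_asym by metis

lemma precedes_trans: "distinct xs \<Longrightarrow> precedes xs a b \<Longrightarrow> precedes xs b c \<Longrightarrow> precedes xs a c"
  by (induction xs) (auto dest: precedes_in_set)

lemma precedes_total:
  "a \<in> set xs \<Longrightarrow> b \<in> set xs \<Longrightarrow> a \<noteq> b \<Longrightarrow> precedes xs a b \<or> precedes xs b a"
  by (induction xs) auto

lemma sorted_wrt_iff_precedes: "sorted_wrt R xs \<longleftrightarrow> (\<forall>a b. precedes xs a b \<longrightarrow> R a b)"
  by (induction xs) auto

lemma precedes_iff_nth:
  "precedes xs a b \<longleftrightarrow> (\<exists>p q. p < q \<and> q < length xs \<and> xs ! p = a \<and> xs ! q = b)"
  using sorted_wrt_iff_precedes[of "\<lambda>x y. \<not> (x = a \<and> y = b)" xs]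
  by (auto simp: sorted_wrt_iff_nth_less)

lemma ex_precedes_first:
  assumes "D \<subseteq> set xs" "D \<noteq> {}"
  obtains d where "d \<in> D" "\<And>e. e \<in> D \<Longrightarrow> e \<noteq> d \<Longrightarrow> precedes xs d e"
  using assms
proof (induction xs arbitrary: thesis)
  case (Cons x xs)
  show ?case
  proof (cases "x \<in> D")
    case True
    then show ?thesis
      using Cons.prems by auto
  next
    case False
    then have "D \<subseteq> set xs"
      using Cons.prems by auto
    then show ?thesis
      using Cons.IH[of thesis] Cons.prems by auto
  qed
qed auto

lemma ex_precedes_last:
  assumes "D \<subseteq> set xs" "D \<noteq> {}"
  obtains d where "d \<in> D" "\<And>e. e \<in> D \<Longrightarrow> e \<noteq> d \<Longrightarrow> precedes xs e d"
  using ex_precedes_first[of D "rev xs"] assms by (auto simp: precedes_rev)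

section \<open>Sorting by swaps of independent neighbours\<close>

definition swap_step :: "('a \<Rightarrow> 'a \<Rightarrow> bool) \<Rightarrow> 'a list \<Rightarrow> 'a list \<Rightarrow> bool" where
  "swap_step D xs ys \<longleftrightarrow>
     (\<exists>us a b vs. xs = us @ a # b # vs \<and> ys = us @ b # a # vs \<and> \<not> D a b)"

lemma swap_step_Cons: "swap_step D xs ys \<Longrightarrow> swap_step D (x # xs) (x # ys)"
  unfolding swap_step_def by (metis append_Cons)

lemma swap_steps_Cons: "(swap_step D)\<^sup>*\<^sup>* xs ys \<Longrightarrow> (swap_step D)\<^sup>*\<^sup>* (x # xs) (x # ys)"
  by (induction rule: rtranclp_induct) (auto dest: swap_step_Cons intro: rtranclp.rtrancl_into_rtrancl)

lemma swap_steps_to_front: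
  "\<forall>u\<in>set us. \<not> D u y \<Longrightarrow> (swap_step D)\<^sup>*\<^sup>* (us @ y # vs) (y # us @ vs)"
proof (induction us)
  case (Cons u us)
  then have "(swap_step D)\<^sup>*\<^sup>* (u # us @ y # vs) (u # y # us @ vs)"
    by (auto intro: swap_steps_Cons)
  moreover have "swap_step D (u # y # us @ vs) (y # u # us @ vs)"
    unfolding swap_step_def using Cons.prems by (metis append_Nil list.set_intros(1))
  ultimately show ?case
    by simp
qed auto

text \<open>Bubble sort in a partially commutative setting, with \<open>D\<close> as the dependence
  relation. The head \<open>y\<close> of the target can be moved to the front, since an element
  before it in \<open>xs\<close> that depends on it would precede it in \<open>ys\<close> as
  well.\<close>

lemma swap_steps_if_precedes:
  assumes "distinct xs" "distinct ys" "set xs = set ys"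
    and "\<And>a b. D a b \<Longrightarrow> precedes xs a b \<Longrightarrow> precedes ys a b"
  shows "(swap_step D)\<^sup>*\<^sup>* xs ys"
  using assms
proof (induction ys arbitrary: xs)
  case (Cons y ys)
  then obtain us vs where xs: "xs = us @ y # vs"
    by (metis list.set_intros(1) split_list)
  have "\<not> D u y" if "u \<in> set us" for u
    using Cons.prems(1,2) Cons.prems(4)[of u y] that precedes_in_set[of ys u y]
    by (auto simp: xs precedes_append)
  then have "(swap_step D)\<^sup>*\<^sup>* xs (y # us @ vs)"
    unfolding xs by (intro swap_steps_to_front) auto
  moreover have "(swap_step D)\<^sup>*\<^sup>* (us @ vs) ys"
  proof (rule Cons.IH)
    have "insert y (set (us @ vs)) = insert y (set ys)"
      using Cons.prems(3) by (simp add: xs)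
    then show "set (us @ vs) = set ys"
      using Cons.prems(1,2) by (simp add: xs insert_ident)
    show "precedes ys a b" if "D a b" "precedes (us @ vs) a b" for a b
      using that Cons.prems(1,2) Cons.prems(4)[of a b] precedes_in_set[OF that(2)]
      by (auto simp: xs precedes_append)
  qed (use Cons.prems(1,2) in \<open>auto simp: xs\<close>)
  then have "(swap_step D)\<^sup>*\<^sup>* (y # us @ vs) (y # ys)"
    by (rule swap_steps_Cons)
  ultimately show ?case
    by (rule rtranclp_trans)
qed auto

section \<open>Packets and realizable sets\<close>

lemma ksubsetsD:
  "X \<in> ksubsets n k \<Longrightarrow> finite X" "X \<in> ksubsets n k \<Longrightarrow> card X = k"
  "X \<in> ksubsets n k \<Longrightarrow> X \<subseteq> {1..n}"
  by (auto simp: ksubsets_def intro: finite_subset)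

lemma finite_ksubsets: "finite (ksubsets n k)"
  by (rule finite_subset[of _ "Pow {1..n}"]) (auto simp: ksubsets_def)

lemma ksubsets_remove: "X \<in> ksubsets n (Suc k) \<Longrightarrow> x \<in> X \<Longrightarrow> X - {x} \<in> ksubsets n k"
  by (auto simp: ksubsets_def)

lemma ksubsets_mono: "m \<le> n \<Longrightarrow> ksubsets m k \<subseteq> ksubsets n k"
  by (auto simp: ksubsets_def)

lemma ksubsets_insert:
  "Y \<in> ksubsets n k \<Longrightarrow> x \<notin> Y \<Longrightarrow> x \<in> {1..n} \<Longrightarrow> insert x Y \<in> ksubsets n (Suc k)"
  by (auto simp: ksubsets_def finite_subset[of Y "{1..n}"])

lemma ksubsets_superset:
  assumes "X \<in> ksubsets n (Suc k)" "Y \<in> ksubsets n k" "Y \<subseteq> X"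
  obtains x where "x \<notin> Y" "X = insert x Y"
proof -
  have "card (X - Y) = 1"
    using assms by (simp add: card_Diff_subset ksubsetsD)
  then obtain x where "X - Y = {x}"
    using card_1_singletonE by blast
  then have "x \<notin> Y" "X = insert x Y"
    using assms(3) by blast+
  then show thesis
    by (rule that)
qed

lemma packet_eq: "X \<in> ksubsets n (Suc k) \<Longrightarrow> packet n k X = (\<lambda>x. X - {x}) ` X"
  using ksubsets_remove[of X n k] by (auto simp: packet_def image_iff elim!: ksubsets_superset)

lemma lex_less_asym: "lex_less Y Z \<Longrightarrow> \<not> lex_less Z Y"
  unfolding lex_less_def by (rule asymD[OF lexord_asym]) (auto intro: asymI)

lemma lex_less_remove_iff:
  "finite X \<Longrightarrow> x \<in> X \<Longrightarrow> y \<in> X \<Longrightarrow> lex_less (X - {y}) (X - {x}) \<longleftrightarrow> x < y"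
  by (metis lex_less_remove lex_less_asym linorder_neqE_nat)

lemma lex_enumeration:
  assumes "X \<in> ksubsets n (Suc k)"
  obtains ps where "set ps = packet n k X" "sorted_wrt lex_less ps"
proof
  let ?ps = "map (\<lambda>x. X - {x}) (rev (sorted_list_of_set X))"
  show "set ?ps = packet n k X"
    using assms by (simp add: packet_eq ksubsetsD)
  have "sorted_wrt (<) (sorted_list_of_set X)"
    by simp
  then have "sorted_wrt (\<lambda>x y. lex_less (X - {y}) (X - {x})) (sorted_list_of_set X)"
    by (rule sorted_wrt_mono_rel[rotated]) (use assms in \<open>simp add: lex_less_remove ksubsetsD\<close>)
  then show "sorted_wrt lex_less ?ps"
    by (simp add: sorted_wrt_map sorted_wrt_rev)
qed

text \<open>Members of a packet are indexed by the removed element, and this reverses the order: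
  removing a larger element gives a smaller set. A prefix is thus an upward closed set of removed
  elements.\<close>

lemma lex_prefix_iff:
  assumes X: "X \<in> ksubsets n (Suc k)"
  shows "lex_prefix (packet n k X) (packet n k X \<inter> A) \<longleftrightarrow>
    (\<forall>x\<in>X. \<forall>y\<in>X. x < y \<longrightarrow> X - {x} \<in> A \<longrightarrow> X - {y} \<in> A)"
proof
  assume "lex_prefix (packet n k X) (packet n k X \<inter> A)"
  then obtain us vs where uv: "sorted_wrt lex_less (us @ vs)" "set (us @ vs) = packet n k X"
    "packet n k X \<inter> A = set us"
    unfolding lex_prefix_def by blast
  show "\<forall>x\<in>X. \<forall>y\<in>X. x < y \<longrightarrow> X - {x} \<in> A \<longrightarrow> X - {y} \<in> A"
  proof (intro ballI impI, rule ccontr)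
    fix x y assume xy: "x \<in> X" "y \<in> X" "x < y" "X - {x} \<in> A" "X - {y} \<notin> A"
    then have "X - {x} \<in> set us" "X - {y} \<in> set vs"
      using uv(2,3) by (auto simp: packet_eq[OF X])
    then have "lex_less (X - {x}) (X - {y})"
      using uv(1) by (auto simp: sorted_wrt_append)
    then show False
      using xy X by (simp add: lex_less_remove_iff ksubsetsD)
  qed
next
  assume *: "\<forall>x\<in>X. \<forall>y\<in>X. x < y \<longrightarrow> X - {x} \<in> A \<longrightarrow> X - {y} \<in> A"
  obtain ps where ps: "set ps = packet n k X" "sorted_wrt lex_less ps"
    using lex_enumeration[OF X] .
  show "lex_prefix (packet n k X) (packet n k X \<inter> A)"
    unfolding lex_prefix_def
  proof (intro exI conjI)
    show "sorted_wrt lex_less (filter (\<lambda>Y. Y \<in> A) ps @ filter (\<lambda>Y. Y \<notin> A) ps)"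
    proof -
      have "lex_less Y Z" if YZ: "Y \<in> set ps" "Z \<in> set ps" "Y \<in> A" "Z \<notin> A" for Y Z
      proof -
        obtain x y where xy: "x \<in> X" "y \<in> X" "Y = X - {x}" "Z = X - {y}"
          using YZ(1,2) by (auto simp: ps packet_eq[OF X])
        then have "y < x"
          using * YZ(3,4) by (metis linorder_neqE_nat)
        then show ?thesis
          using xy X by (simp add: lex_less_remove ksubsetsD)
      qed
      then show ?thesis
        using ps(2) by (auto simp: sorted_wrt_append sorted_wrt_filter)
    qed
  qed (use ps in auto)
qed

lemma lex_suffix_iff_compl:
  "lex_suffix T (T \<inter> A) \<longleftrightarrow> lex_prefix T (T \<inter> - A)"
proof -
  have *: "T \<inter> A = set vs \<longleftrightarrow> T \<inter> - A = set us"
    if "sorted_wrt lex_less (us @ vs)" "set (us @ vs) = T" for us vs :: "nat set list"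
  proof -
    have "set us \<inter> set vs = {}"
      using that(1) lex_less_asym by (fastforce simp: sorted_wrt_append)
    then show ?thesis
      using that(2) by auto
  qed
  then show ?thesis
    unfolding lex_suffix_def lex_prefix_def by blast
qed

lemma lex_suffix_iff:
  assumes X: "X \<in> ksubsets n (Suc k)"
  shows "lex_suffix (packet n k X) (packet n k X \<inter> A) \<longleftrightarrow>
    (\<forall>x\<in>X. \<forall>y\<in>X. x < y \<longrightarrow> X - {y} \<in> A \<longrightarrow> X - {x} \<in> A)"
  unfolding lex_suffix_iff_compl lex_prefix_iff[OF X] by auto

text \<open>A predicate on a chain is monotone or antitone unless three points alternate: an
  increase and a decrease together involve at most four points, three of which alternate.
  Realizability is mostly used in this three-point form.\<close>

lemma realizable_iff:
  "realizable n k A \<longleftrightarrow> A \<subseteq> ksubsets n k \<and>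
     (\<forall>X\<in>ksubsets n (Suc k). \<forall>a\<in>X. \<forall>b\<in>X. \<forall>c\<in>X. a < b \<longrightarrow> b < c \<longrightarrow>
        (X - {a} \<in> A \<longleftrightarrow> X - {c} \<in> A) \<longrightarrow> (X - {b} \<in> A \<longleftrightarrow> X - {a} \<in> A))"
proof -
  have "(\<forall>x\<in>X. \<forall>y\<in>X. x < y \<longrightarrow> P x \<longrightarrow> P y) \<or> (\<forall>x\<in>X. \<forall>y\<in>X. x < y \<longrightarrow> P y \<longrightarrow> P x) \<longleftrightarrow>
      (\<forall>a\<in>X. \<forall>b\<in>X. \<forall>c\<in>X. a < b \<longrightarrow> b < c \<longrightarrow> (P a \<longleftrightarrow> P c) \<longrightarrow> (P b \<longleftrightarrow> P a))"
    (is "?up \<or> ?down \<longleftrightarrow> ?R")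
    for X :: "nat set" and P
  proof
    assume "?up \<or> ?down"
    then show ?R
      by metis
  next
    assume R: ?R
    show "?up \<or> ?down"
    proof (rule ccontr)
      assume "\<not> ?thesis"
      then obtain x y u v where "x \<in> X" "y \<in> X" "x < y" "P x" "\<not> P y"
        "u \<in> X" "v \<in> X" "u < v" "\<not> P u" "P v"
        by blast
      then show False
        using R by (metis linorder_neqE_nat less_trans)
    qed
  qed
  then show ?thesis
    unfolding realizable_def by (simp add: lex_prefix_iff lex_suffix_iff cong: ball_cong)
qed

lemma realizable_subset: "realizable n k A \<Longrightarrow> A \<subseteq> ksubsets n k"
  by (simp add: realizable_def)

lemma realizable_between:
  assumes "realizable n k A" "X \<in> ksubsets n (Suc k)" "a \<in> X" "b \<in> X" "c \<in> X" "a < b" "b < c"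
    and "X - {a} \<in> A \<longleftrightarrow> X - {c} \<in> A"
  shows "X - {b} \<in> A \<longleftrightarrow> X - {a} \<in> A"
  using assms unfolding realizable_iff by blast

lemma realizableI:
  assumes "A \<subseteq> ksubsets n k"
    and "\<And>X a b c. X \<in> ksubsets n (Suc k) \<Longrightarrow> a \<in> X \<Longrightarrow> b \<in> X \<Longrightarrow> c \<in> X \<Longrightarrow> a < b \<Longrightarrow> b < c \<Longrightarrow>
      (X - {a} \<in> A \<longleftrightarrow> X - {c} \<in> A) \<Longrightarrow> (X - {b} \<in> A \<longleftrightarrow> X - {a} \<in> A)"
  shows "realizable n k A"
  using assms unfolding realizable_iff by blast

section \<open>Total orders with prescribed inversions\<close>

lemma Suc_notin_ksubsets: "X \<in> ksubsets n k \<Longrightarrow> Suc n \<notin> X"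
  by (auto simp: ksubsets_def)

lemma ksubsets_Suc:
  "ksubsets (Suc n) (Suc k) = ksubsets n (Suc k) \<union> insert (Suc n) ` ksubsets n k"
proof (intro equalityI subsetI)
  fix X assume X: "X \<in> ksubsets (Suc n) (Suc k)"
  show "X \<in> ksubsets n (Suc k) \<union> insert (Suc n) ` ksubsets n k"
  proof (cases "Suc n \<in> X")
    case True
    then have "X = insert (Suc n) (X - {Suc n})" "X - {Suc n} \<in> ksubsets n k"
      using X by (auto simp: ksubsets_def)
    then show ?thesis
      by blast
  next
    case False
    then show ?thesis
      using X by (auto simp: ksubsets_def atLeastAtMostSuc_conv)
  qed
next
  fix X assume "X \<in> ksubsets n (Suc k) \<union> insert (Suc n) ` ksubsets n k"
  then show "X \<in> ksubsets (Suc n) (Suc k)"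
    using ksubsets_mono[of n "Suc n"] ksubsets_insert[of _ "Suc n" k "Suc n"]
      Suc_notin_ksubsets[of _ n k] by auto
qed

lemma ksubsets_0: "ksubsets n 0 = {{}}"
  by (auto simp: ksubsets_def finite_subset[of _ "{1..n}"])

lemma ksubsets_0_Suc: "ksubsets 0 (Suc k) = {}"
  by (auto simp: ksubsets_def)

lemma realizable_delete:
  assumes "realizable n k U" "m \<le> n"
  shows "realizable m k (U \<inter> ksubsets m k)"
proof (rule realizableI)
  fix X a b c
  assume "X \<in> ksubsets m (Suc k)" "a \<in> X" "b \<in> X" "c \<in> X" "a < b" "b < c"
    "X - {a} \<in> U \<inter> ksubsets m k \<longleftrightarrow> X - {c} \<in> U \<inter> ksubsets m k"
  then show "X - {b} \<in> U \<inter> ksubsets m k \<longleftrightarrow> X - {a} \<in> U \<inter> ksubsets m k"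
    using realizable_between[OF assms(1), of X a b c] ksubsets_mono[OF assms(2)]
    by (auto simp: ksubsets_remove)
qed auto

definition contraction :: "nat \<Rightarrow> nat \<Rightarrow> nat set set \<Rightarrow> nat set set" where
  "contraction n k U = {Y \<in> ksubsets n k. insert (Suc n) Y \<in> U}"

lemma realizable_contraction:
  assumes U: "realizable (Suc n) (Suc k) U"
  shows "realizable n k (contraction n k U)"
proof (rule realizableI)
  fix X a b c
  assume X: "X \<in> ksubsets n (Suc k)" "a \<in> X" "b \<in> X" "c \<in> X" "a < b" "b < c"
    "X - {a} \<in> contraction n k U \<longleftrightarrow> X - {c} \<in> contraction n k U"
  then have "insert (Suc n) X \<in> ksubsets (Suc n) (Suc (Suc k))"
    by (auto simp: ksubsets_Suc)
  moreover have "insert (Suc n) X - {x} = insert (Suc n) (X - {x})" if "x \<in> X" for x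
    using Suc_notin_ksubsets[OF X(1)] that by auto
  ultimately show "X - {b} \<in> contraction n k U \<longleftrightarrow> X - {a} \<in> contraction n k U"
    using X realizable_between[OF U, of "insert (Suc n) X" a b c]
    by (auto simp: contraction_def ksubsets_remove)
qed (auto simp: contraction_def)

text \<open>Membership of \<open>X\<close> in \<open>U\<close> is the status of the largest element \<open>Suc n\<close> in the packet of
  \<open>X \<union> {Suc n}\<close>; monotonicity along that packet makes the contraction a final segment.\<close>

lemma contraction_upward:
  assumes U: "realizable (Suc n) (Suc k) U" and X: "X \<in> ksubsets n (Suc k)"
    and xy: "x \<in> X" "y \<in> X" "x < y"
  shows "X \<in> U \<Longrightarrow> X - {x} \<in> contraction n k U \<Longrightarrow> X - {y} \<in> contraction n k U"
    and "X \<notin> U \<Longrightarrow> X - {y} \<in> contraction n k U \<Longrightarrow> X - {x} \<in> contraction n k U"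
proof -
  have N: "Suc n \<notin> X" "insert (Suc n) X \<in> ksubsets (Suc n) (Suc (Suc k))" "y < Suc n"
    using X xy Suc_notin_ksubsets[OF X] ksubsetsD(3)[OF X] by (auto simp: ksubsets_Suc)
  have "insert (Suc n) X - {z} = insert (Suc n) (X - {z})" if "z \<in> X" for z
    using N(1) that by auto
  moreover have "insert (Suc n) X - {Suc n} = X"
    using N(1) by auto
  ultimately show "X \<in> U \<Longrightarrow> X - {x} \<in> contraction n k U \<Longrightarrow> X - {y} \<in> contraction n k U"
    "X \<notin> U \<Longrightarrow> X - {y} \<in> contraction n k U \<Longrightarrow> X - {x} \<in> contraction n k U"
    using realizable_between[OF U N(2), of x y "Suc n"] xy N(3) X
    by (auto simp: contraction_def ksubsets_remove)
qed

text \<open>For \<open>x < y\<close> the set \<open>X - {y}\<close> is lexicographically smaller than \<open>X - {x}\<close>, so \<open>U\<close> consists of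
  the packets that are ordered antilexicographically.\<close>

definition oriented ::
    "nat \<Rightarrow> nat \<Rightarrow> nat set set \<Rightarrow> nat set set \<Rightarrow> nat set list \<Rightarrow> bool" where
  "oriented n k A U \<rho> \<longleftrightarrow> (\<forall>X\<in>ksubsets n (Suc k). \<forall>x\<in>X. \<forall>y\<in>X.
     x < y \<longrightarrow> X - {x} \<in> A \<longrightarrow> X - {y} \<in> A \<longrightarrow>
       (if X \<in> U then precedes \<rho> (X - {x}) (X - {y}) else precedes \<rho> (X - {y}) (X - {x})))"

lemma orientedI:
  assumes "\<And>X x y. X \<in> ksubsets n (Suc k) \<Longrightarrow> x \<in> X \<Longrightarrow> y \<in> X \<Longrightarrow> x < y \<Longrightarrow>
      X - {x} \<in> A \<Longrightarrow> X - {y} \<in> A \<Longrightarrow> X \<in> U \<Longrightarrow> precedes \<rho> (X - {x}) (X - {y})"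
    and "\<And>X x y. X \<in> ksubsets n (Suc k) \<Longrightarrow> x \<in> X \<Longrightarrow> y \<in> X \<Longrightarrow> x < y \<Longrightarrow>
      X - {x} \<in> A \<Longrightarrow> X - {y} \<in> A \<Longrightarrow> X \<notin> U \<Longrightarrow> precedes \<rho> (X - {y}) (X - {x})"
  shows "oriented n k A U \<rho>"
  using assms unfolding oriented_def by auto

lemma orientedD:
  assumes "oriented n k A U \<rho>" "X \<in> ksubsets n (Suc k)" "x \<in> X" "y \<in> X" "x < y"
    "X - {x} \<in> A" "X - {y} \<in> A"
  shows "X \<in> U \<Longrightarrow> precedes \<rho> (X - {x}) (X - {y})"
    and "X \<notin> U \<Longrightarrow> precedes \<rho> (X - {y}) (X - {x})"
  using assms unfolding oriented_def by (metis (full_types))+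

text \<open>On each packet the prescribed order already lists the members outside \<open>V\<close>
  first, by \<open>contraction_upward\<close>. Moving \<open>V\<close> to the end as one block
  therefore reverses no pair of a packet.\<close>

lemma oriented_partition:
  assumes U: "realizable (Suc n) (Suc (Suc k)) U"
    and \<rho>: "oriented n (Suc k) (ksubsets n (Suc k)) U \<rho>"
  defines "V \<equiv> contraction n (Suc k) U"
  shows "oriented n (Suc k) (ksubsets n (Suc k)) U
    (filter (\<lambda>Y. Y \<notin> V) \<rho> @ filter (\<lambda>Y. Y \<in> V) \<rho>)"
proof (rule orientedI)
  fix X x y
  assume X: "X \<in> ksubsets n (Suc (Suc k))" "x \<in> X" "y \<in> X" "x < y"
    "X - {x} \<in> ksubsets n (Suc k)" "X - {y} \<in> ksubsets n (Suc k)"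
  note up = contraction_upward[OF U X(1-4), folded V_def]
  show "precedes (filter (\<lambda>Y. Y \<notin> V) \<rho> @ filter (\<lambda>Y. Y \<in> V) \<rho>) (X - {x}) (X - {y})"
    if "X \<in> U"
    using orientedD(1)[OF \<rho> X that] up(1)[OF that] precedes_in_set
    by (fastforce simp: precedes_append precedes_filter)
  show "precedes (filter (\<lambda>Y. Y \<notin> V) \<rho> @ filter (\<lambda>Y. Y \<in> V) \<rho>) (X - {y}) (X - {x})"
    if "X \<notin> U"
    using orientedD(2)[OF \<rho> X that] up(2)[OF that] precedes_in_set
    by (fastforce simp: precedes_append precedes_filter)
qed

text \<open>The packet of \<open>insert (Suc n) Y\<close> consists of \<open>Y\<close> and of the
  packet of \<open>Y\<close> with \<open>Suc n\<close> added. Lexicographically \<open>Y\<close> is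
  its first member. It has to come last if the packet is inverted, that is, if \<open>Y\<close> lies
  in the contraction; this explains \<open>before\<close> and \<open>after\<close>.\<close>

lemma oriented_extend:
  assumes U: "realizable (Suc n) (Suc (Suc k)) U"
    and \<rho>: "oriented n (Suc k) (ksubsets n (Suc k)) U \<rho>"
    and \<sigma>: "oriented n k (ksubsets n k) (contraction n (Suc k) U) \<sigma>"
    and old: "\<And>Y Z. precedes \<rho> Y Z \<Longrightarrow> precedes \<tau> Y Z"
    and new: "\<And>Y Z. precedes \<sigma> Y Z \<Longrightarrow> precedes \<tau> (insert (Suc n) Y) (insert (Suc n) Z)"
    and before: "\<And>Y y. Y \<in> ksubsets n (Suc k) \<Longrightarrow> y \<in> Y \<Longrightarrow> Y \<notin> contraction n (Suc k) U \<Longrightarrow>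
      precedes \<tau> Y (insert (Suc n) (Y - {y}))"
    and after: "\<And>Y y. Y \<in> contraction n (Suc k) U \<Longrightarrow> y \<in> Y \<Longrightarrow>
      precedes \<tau> (insert (Suc n) (Y - {y})) Y"
  shows "oriented (Suc n) (Suc k) (ksubsets (Suc n) (Suc k)) U \<tau>"
proof -
  let ?V = "contraction n (Suc k) U"
  have old_packet: "if X \<in> U then precedes \<tau> (X - {x}) (X - {y}) else precedes \<tau> (X - {y}) (X - {x})"
    if "X \<in> ksubsets n (Suc (Suc k))" "x \<in> X" "y \<in> X" "x < y" for X x y
    using orientedD[OF \<rho> that] that by (auto intro!: old simp: ksubsets_remove)
  have new_packet: "if insert (Suc n) Y \<in> U
      then precedes \<tau> (insert (Suc n) Y - {x}) (insert (Suc n) Y - {y})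
      else precedes \<tau> (insert (Suc n) Y - {y}) (insert (Suc n) Y - {x})"
    if Y: "Y \<in> ksubsets n (Suc k)" and xy: "x \<in> insert (Suc n) Y" "y \<in> insert (Suc n) Y" "x < y"
    for Y x y
  proof -
    have N: "Suc n \<notin> Y" "\<forall>z\<in>Y. z < Suc n"
      using Suc_notin_ksubsets[OF Y] ksubsetsD(3)[OF Y] by auto
    have V: "insert (Suc n) Y \<in> U \<longleftrightarrow> Y \<in> ?V"
      using Y by (simp add: contraction_def)
    have remove: "insert (Suc n) Y - {z} = insert (Suc n) (Y - {z})" if "z \<in> Y" for z
      using N that by auto
    have x: "x \<in> Y"
      using xy N by auto
    consider "y = Suc n" | "y \<in> Y"
      using xy by auto
    then show ?thesis
    proof cases
      case 1
      moreover have "insert (Suc n) Y - {Suc n} = Y"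
        using N by auto
      ultimately show ?thesis
        using x before[OF Y x] after[OF _ x] by (simp add: remove V del: insert_Diff_single)
    next
      case 2
      then show ?thesis
        using x orientedD[OF \<sigma> Y x 2 xy(3)] Y
        by (auto simp: remove V ksubsets_remove simp del: insert_Diff_single intro!: new)
    qed
  qed
  show ?thesis
  proof (rule orientedI)
    fix X x y assume "X \<in> ksubsets (Suc n) (Suc (Suc k))" "x \<in> X" "y \<in> X" "x < y" "X \<in> U"
    then show "precedes \<tau> (X - {x}) (X - {y})"
      using old_packet new_packet by (fastforce simp: ksubsets_Suc[of n "Suc k"])
  next
    fix X x y assume "X \<in> ksubsets (Suc n) (Suc (Suc k))" "x \<in> X" "y \<in> X" "x < y" "X \<notin> U"
    then show "precedes \<tau> (X - {y}) (X - {x})"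
      using old_packet new_packet by (fastforce simp: ksubsets_Suc[of n "Suc k"])
  qed
qed

section \<open>Existence of total orders with a given inversion set\<close>

definition full_orders :: "nat \<Rightarrow> nat \<Rightarrow> nat set set \<Rightarrow> nat set list set" where
  "full_orders n k U =
     {\<rho> \<in> permutations_of_set (ksubsets n k). oriented n k (ksubsets n k) U \<rho>}"

lemma full_orders_0: "[{}] \<in> full_orders n 0 U"
proof -
  have "x = y" if "X \<in> ksubsets n (Suc 0)" "x \<in> X" "y \<in> X" for X x y
    using that by (auto simp: ksubsets_def card_Suc_eq)
  then have "oriented n 0 (ksubsets n 0) U [{}]"
    unfolding oriented_def by (metis less_irrefl)
  then show ?thesis
    by (simp add: full_orders_def ksubsets_0 permutations_of_set_def)
qed

lemma full_orders_empty: "[] \<in> full_orders 0 (Suc k) U"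
  by (simp add: full_orders_def permutations_of_set_def oriented_def ksubsets_0_Suc)

lemma oriented_deletion:
  "oriented n k A (U \<inter> ksubsets n (Suc k)) \<rho> \<longleftrightarrow> oriented n k A U \<rho>"
  by (auto simp: oriented_def)

lemma distinct_insert_Suc:
  assumes "distinct \<sigma>" "set \<sigma> \<subseteq> ksubsets n k"
  shows "distinct (map (insert (Suc n)) \<sigma>)"
proof -
  have "inj_on (insert (Suc n)) (ksubsets n k)"
    by (rule inj_onI) (meson Suc_notin_ksubsets insert_ident)
  then show ?thesis
    using assms by (simp add: distinct_map inj_on_subset)
qed

lemma insert_Suc_notin_ksubsets: "insert (Suc n) Y \<notin> ksubsets n k"
  using Suc_notin_ksubsets by blast

lemma full_order_extend:
  assumes U: "realizable (Suc n) (Suc (Suc k)) U"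
    and \<rho>: "\<rho> \<in> full_orders n (Suc k) (U \<inter> ksubsets n (Suc (Suc k)))"
    and \<sigma>: "\<sigma> \<in> full_orders n k (contraction n (Suc k) U)"
  defines "V \<equiv> contraction n (Suc k) U"
  shows "filter (\<lambda>Y. Y \<notin> V) \<rho> @ map (insert (Suc n)) \<sigma> @ filter (\<lambda>Y. Y \<in> V) \<rho>
    \<in> full_orders (Suc n) (Suc k) U" (is "?\<tau> \<in> _")
proof -
  have sets: "set \<rho> = ksubsets n (Suc k)" "distinct \<rho>" "set \<sigma> = ksubsets n k" "distinct \<sigma>"
    and \<rho>': "oriented n (Suc k) (ksubsets n (Suc k)) U \<rho>"
    and \<sigma>': "oriented n k (ksubsets n k) V \<sigma>"
    using \<rho> \<sigma> by (auto simp: full_orders_def permutations_of_set_def oriented_deletion V_def)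
  \<comment> \<open>The order of the old sets kept by \<open>?\<tau>\<close> is the partitioned
    list, not \<open>\<rho>\<close> itself; the new sets are inserted at its seam.\<close>
  have "oriented (Suc n) (Suc k) (ksubsets (Suc n) (Suc k)) U ?\<tau>"
  proof (rule oriented_extend[OF U oriented_partition[OF U \<rho>'], folded V_def, OF \<sigma>'])
    show "precedes ?\<tau> (insert (Suc n) (Y - {y})) Y" if "Y \<in> V" "y \<in> Y" for Y y
      using that by (auto simp: precedes_append sets ksubsets_remove V_def contraction_def)
  qed (auto simp: precedes_append precedes_filter sets ksubsets_remove
    dest: precedes_in_set intro: precedes_map)
  moreover have "set ?\<tau> = ksubsets (Suc n) (Suc k)"
    by (auto simp: ksubsets_Suc sets)
  moreover have "distinct ?\<tau>"
    using distinct_insert_Suc[of \<sigma> n k] by (auto simp: sets insert_Suc_notin_ksubsets)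
  ultimately show ?thesis
    by (simp add: full_orders_def permutations_of_set_def)
qed

lemma ex_full_order:
  assumes "realizable n (Suc k) U"
  shows "full_orders n k U \<noteq> {}"
  using assms
proof (induction n arbitrary: k U)
  case 0
  then show ?case
    using full_orders_0 full_orders_empty by (cases k) blast+
next
  case (Suc n)
  show ?case
  proof (cases k)
    case 0
    then show ?thesis
      using full_orders_0 by blast
  next
    case (Suc l)
    note U = Suc.prems[unfolded Suc]
    show ?thesis
      using full_order_extend[OF U] Suc.IH[OF realizable_delete[OF U, of n]]
        Suc.IH[OF realizable_contraction[OF U]] by (auto simp: Suc)
  qed
qed

section \<open>Orders in which a flippable packet is a block\<close>

lemma packet_insert_Suc:
  assumes Y: "Y \<in> ksubsets n (Suc k)"
  shows "packet (Suc n) (Suc k) (insert (Suc n) Y) = insert Y (insert (Suc n) ` packet n k Y)"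
proof -
  have N: "Suc n \<notin> Y"
    by (rule Suc_notin_ksubsets[OF Y])
  have X: "insert (Suc n) Y \<in> ksubsets (Suc n) (Suc (Suc k))"
    using Y by (auto simp: ksubsets_Suc)
  have "insert (Suc n) Y - {z} = insert (Suc n) (Y - {z})" if "z \<in> Y" for z
    using N that by auto
  then show ?thesis
    using N unfolding packet_eq[OF X] packet_eq[OF Y] by (auto simp: image_iff)
qed

lemma packet_Suc: "X \<in> ksubsets n (Suc k) \<Longrightarrow> packet (Suc n) k X = packet n k X"
  using subsetD[OF ksubsets_mono[of n "Suc n" "Suc k"]] by (simp add: packet_eq)

lemma packet_0: "X \<in> ksubsets n (Suc 0) \<Longrightarrow> packet n 0 X = {{}}"
  by (auto simp: packet_eq ksubsets_def card_Suc_eq)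

lemma filter_eq_singleton: "distinct xs \<Longrightarrow> x \<in> set xs \<Longrightarrow> filter (\<lambda>y. y = x) xs = [x]"
  by (induction xs) (auto simp: filter_empty_conv)

text \<open>An order is constrained by packets alone, so neighbouring blocks commute if no packet
  meets both. This serves to carry a single set across those that separate it from the rest of its
  packet.\<close>

lemma full_order_move:
  assumes \<rho>: "us @ qs @ vs @ ws \<in> full_orders n k U"
    and far: "\<And>X. X \<in> ksubsets n (Suc k) \<Longrightarrow> packet n k X \<inter> set qs = {} \<or> packet n k X \<inter> set vs = {}"
  shows "us @ vs @ qs @ ws \<in> full_orders n k U"
proof -
  have "oriented n k (ksubsets n k) U (us @ vs @ qs @ ws)"
  proof (rule orientedI)
    fix X x y
    assume X: "X \<in> ksubsets n (Suc k)" "x \<in> X" "y \<in> X" "x < y"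
      and xy: "X - {x} \<in> ksubsets n k" "X - {y} \<in> ksubsets n k"
    have or: "oriented n k (ksubsets n k) U (us @ qs @ vs @ ws)"
      using \<rho> by (simp add: full_orders_def)
    have "X - {x} \<in> packet n k X" "X - {y} \<in> packet n k X"
      using X by (auto simp: packet_eq)
    then have move: "precedes (us @ vs @ qs @ ws) P Q"
      if "precedes (us @ qs @ vs @ ws) P Q" "{P, Q} = {X - {x}, X - {y}}" for P Q
      using that far[OF X(1)] unfolding precedes_append set_append doubleton_eq_iff by blast
    show "X \<in> U \<Longrightarrow> precedes (us @ vs @ qs @ ws) (X - {x}) (X - {y})"
      "X \<notin> U \<Longrightarrow> precedes (us @ vs @ qs @ ws) (X - {y}) (X - {x})"
      using orientedD[OF or X xy] by (auto intro!: move)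
  qed
  then show ?thesis
    using \<rho> by (auto simp: full_orders_def permutations_of_set_def)
qed

text \<open>The recursion behind \<open>ex_full_order\<close> also yields orders in which a packet
  that may be flipped without leaving the realizable sets is a contiguous block.\<close>

lemma ex_full_order_block:
  assumes "realizable n (Suc k) U" "X \<in> ksubsets n (Suc k)" "X \<notin> U"
    and "realizable n (Suc k) (insert X U)"
  shows "\<exists>us ps vs. us @ ps @ vs \<in> full_orders n k U \<and> set ps = packet n k X"
  using assms
proof (induction n arbitrary: k U X)
  case 0
  then show ?case
    by (simp add: ksubsets_0_Suc)
next
  case (Suc n)
  show ?case
  proof (cases k)
    case 0
    then have "[] @ [{}] @ [] \<in> full_orders (Suc n) k U" "set [{}] = packet (Suc n) k X"
      using full_orders_0 packet_0 Suc.prems by auto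
    then show ?thesis
      by blast
  next
    case (Suc l)
    let ?V = "contraction n (Suc l) U"
    note U = Suc.prems(1)[unfolded Suc]
    note XU = Suc.prems(4)[unfolded Suc]
    consider Y where "Y \<in> ksubsets n (Suc l)" "X = insert (Suc n) Y" | "X \<in> ksubsets n (Suc (Suc l))"
      using Suc.prems(2) by (auto simp: Suc ksubsets_Suc)
    then show ?thesis
    proof cases
      case 1
      note Y = 1
      have YV: "Y \<notin> ?V" "contraction n (Suc l) (insert X U) = insert Y ?V"
        using Suc.prems(3) Y insert_ident[OF Suc_notin_ksubsets Suc_notin_ksubsets[OF Y(1)]]
        by (auto simp: contraction_def)
      obtain \<rho> where \<rho>: "\<rho> \<in> full_orders n (Suc l) (U \<inter> ksubsets n (Suc (Suc l)))"
        using ex_full_order[OF realizable_delete[OF U, of n]] by auto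
      obtain us ps vs where \<sigma>: "us @ ps @ vs \<in> full_orders n l ?V" "set ps = packet n l Y"
        using Suc.IH[OF realizable_contraction[OF U] Y(1) YV(1)] realizable_contraction[OF XU] YV(2)
        by auto
      have "insert X U \<inter> ksubsets n (Suc (Suc l)) = U \<inter> ksubsets n (Suc (Suc l))"
        using insert_Suc_notin_ksubsets[of n Y] by (auto simp: Y(2))
      then have insert_iff: "oriented n (Suc l) A (insert X U) \<tau> \<longleftrightarrow> oriented n (Suc l) A U \<tau>" for A \<tau>
        by (metis oriented_deletion)
      \<comment> \<open>Partitioning by \<open>insert Y ?V\<close> first, which the realizability of
        \<open>insert X U\<close> permits, leaves \<open>Y\<close> as the last set outside
        \<open>?V\<close>, directly before the new sets.\<close>
      let ?\<rho>1 = "filter (\<lambda>Z. Z \<notin> insert Y ?V) \<rho> @ filter (\<lambda>Z. Z \<in> insert Y ?V) \<rho>"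
      have "oriented n (Suc l) (ksubsets n (Suc l)) (insert X U) \<rho>"
        using \<rho> by (simp add: full_orders_def oriented_deletion insert_iff)
      from oriented_partition[OF XU this] have "?\<rho>1 \<in> full_orders n (Suc l) (U \<inter> ksubsets n (Suc (Suc l)))"
        using \<rho> by (auto simp: full_orders_def permutations_of_set_def oriented_deletion insert_iff YV(2))
      from full_order_extend[OF U this \<sigma>(1)]
      have "(filter (\<lambda>Z. Z \<notin> ?V) ?\<rho>1) @ map (insert (Suc n)) (us @ ps @ vs) @ filter (\<lambda>Z. Z \<in> ?V) ?\<rho>1
          \<in> full_orders (Suc n) (Suc l) U" .
      moreover have "filter (\<lambda>Z. Z \<notin> ?V) ?\<rho>1 = filter (\<lambda>Z. Z \<notin> insert Y ?V) \<rho> @ [Y]"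
      proof -
        have "filter (\<lambda>Z. Z = Y) \<rho> = [Y]"
          using \<rho> Y(1) filter_eq_singleton[of \<rho> Y] by (simp add: full_orders_def permutations_of_set_def)
        then show ?thesis
          using YV(1) by (simp add: conj_commute conj_disj_distribL cong: conj_cong)
      qed
      ultimately have \<tau>: "filter (\<lambda>Z. Z \<notin> insert Y ?V) \<rho> @ [Y] @ map (insert (Suc n)) us @
          (map (insert (Suc n)) (ps @ vs) @ filter (\<lambda>Z. Z \<in> ?V) ?\<rho>1) \<in> full_orders (Suc n) (Suc l) U"
        by simp
      \<comment> \<open>It remains to carry \<open>Y\<close> past \<open>us\<close>: a packet
        containing \<open>Y\<close> and a new set is that of \<open>X\<close>, whose new members all
        come from \<open>ps\<close>.\<close>
      have "filter (\<lambda>Z. Z \<notin> insert Y ?V) \<rho> @ map (insert (Suc n)) us @ [Y] @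
          (map (insert (Suc n)) (ps @ vs) @ filter (\<lambda>Z. Z \<in> ?V) ?\<rho>1) \<in> full_orders (Suc n) (Suc l) U"
      proof (rule full_order_move[OF \<tau>])
        fix W assume W: "W \<in> ksubsets (Suc n) (Suc (Suc l))"
        show "packet (Suc n) (Suc l) W \<inter> set [Y] = {} \<or>
            packet (Suc n) (Suc l) W \<inter> set (map (insert (Suc n)) us) = {}"
        proof (rule ccontr)
          assume "\<not> ?thesis"
          then obtain Z where Z: "Z \<in> set us" "Y \<subset> W" "insert (Suc n) Z \<subset> W"
            by (auto simp: packet_def)
          then have "insert (Suc n) Y \<subseteq> W"
            by blast
          moreover have "card (insert (Suc n) Y) = card W"
            using W Y(1) Suc_notin_ksubsets[OF Y(1)] by (simp add: ksubsetsD)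
          ultimately have "W = insert (Suc n) Y"
            using card_subset_eq[OF ksubsetsD(1)[OF W]] by blast
          moreover have "Z \<in> ksubsets n l" "Z \<notin> set ps"
            using Z(1) \<sigma>(1) by (auto simp: full_orders_def permutations_of_set_def)
          ultimately show False
            using Z(3) Suc_notin_ksubsets[of Z n l] unfolding \<sigma>(2) packet_def by blast
        qed
      qed
      then have "(filter (\<lambda>Z. Z \<notin> insert Y ?V) \<rho> @ map (insert (Suc n)) us) @ (Y # map (insert (Suc n)) ps) @
          (map (insert (Suc n)) vs @ filter (\<lambda>Z. Z \<in> ?V) ?\<rho>1) \<in> full_orders (Suc n) k U"
        by (simp add: Suc)
      moreover have "set (Y # map (insert (Suc n)) ps) = packet (Suc n) k X"
        using Y \<sigma>(2) by (simp add: packet_insert_Suc Suc)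
      ultimately show ?thesis
        by blast
    next
      case 2
      note X = 2
      have V: "contraction n (Suc l) (insert X U) = ?V"
        using X insert_Suc_notin_ksubsets[of n _ "Suc (Suc l)"] by (auto simp: contraction_def)
      have "realizable n (Suc (Suc l)) (insert X (U \<inter> ksubsets n (Suc (Suc l))))"
        using realizable_delete[OF XU, of n] X by (simp add: Int_insert_left)
      then obtain us ps vs where
        \<rho>: "us @ ps @ vs \<in> full_orders n (Suc l) (U \<inter> ksubsets n (Suc (Suc l)))"
          "set ps = packet n (Suc l) X"
        using Suc.IH[OF realizable_delete[OF U, of n] X] Suc.prems(3) by auto
      obtain \<sigma> where \<sigma>: "\<sigma> \<in> full_orders n l ?V"
        using ex_full_order[OF realizable_contraction[OF U]] by auto
      let ?\<rho> = "us @ ps @ vs"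
      have \<tau>: "filter (\<lambda>Y. Y \<notin> ?V) ?\<rho> @ map (insert (Suc n)) \<sigma> @ filter (\<lambda>Y. Y \<in> ?V) ?\<rho>
          \<in> full_orders (Suc n) k U"
        using full_order_extend[OF U \<rho>(1) \<sigma>] by (simp only: Suc)
      have packet: "packet (Suc n) k X = set ps"
        using \<rho>(2) X by (simp add: packet_Suc Suc)
      \<comment> \<open>\<open>U\<close> and \<open>insert X U\<close> have the same contraction but
        disagree about \<open>X\<close>, so \<open>contraction_upward\<close> gives both
        monotonicities. Hence \<open>?V\<close> contains all or nothing of the packet and does not
        cut the block.\<close>
      have "X - {x} \<in> ?V \<longleftrightarrow> X - {y} \<in> ?V" if "x \<in> X" "y \<in> X" "x < y" for x y
        using contraction_upward(2)[OF U X that] contraction_upward(1)[OF XU X that] V Suc.prems(3)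
        by auto
      then have "X - {x} \<in> ?V \<longleftrightarrow> X - {y} \<in> ?V" if "x \<in> X" "y \<in> X" for x y
        using that by (metis linorder_neqE_nat)
      then consider "set ps \<subseteq> ?V" | "set ps \<inter> ?V = {}"
        unfolding \<rho>(2) packet_eq[OF X] by blast
      then show ?thesis
      proof cases
        case 1
        then have "filter (\<lambda>Y. Y \<in> ?V) ps = ps" "filter (\<lambda>Y. Y \<notin> ?V) ps = []"
          by (auto simp: filter_id_conv filter_empty_conv)
        then have "(filter (\<lambda>Y. Y \<notin> ?V) ?\<rho> @ map (insert (Suc n)) \<sigma> @ filter (\<lambda>Y. Y \<in> ?V) us) @
            ps @ filter (\<lambda>Y. Y \<in> ?V) vs \<in> full_orders (Suc n) k U"
          using \<tau> by simp
        then show ?thesis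
          unfolding packet by blast
      next
        case 2
        then have "filter (\<lambda>Y. Y \<notin> ?V) ps = ps" "filter (\<lambda>Y. Y \<in> ?V) ps = []"
          by (auto simp: filter_id_conv filter_empty_conv)
        then have "filter (\<lambda>Y. Y \<notin> ?V) us @ ps @ (filter (\<lambda>Y. Y \<notin> ?V) vs @
            map (insert (Suc n)) \<sigma> @ filter (\<lambda>Y. Y \<in> ?V) ?\<rho>) \<in> full_orders (Suc n) k U"
          using \<tau> by simp
        then show ?thesis
          unfolding packet by blast
      qed
    qed
  qed
qed

section \<open>Packets meeting a set in a prefix, in a suffix or completely\<close>

lemma suffix_part_iff:
  assumes X: "X \<in> ksubsets n (Suc k)"
  shows "X \<in> suffix_part n k A \<longleftrightarrow>
    (\<forall>x\<in>X. \<forall>y\<in>X. x < y \<longrightarrow> X - {y} \<in> A \<longrightarrow> X - {x} \<in> A) \<and>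
    (\<exists>x\<in>X. X - {x} \<in> A) \<and> (\<exists>x\<in>X. X - {x} \<notin> A)"
proof -
  have "packet n k X \<inter> A \<noteq> {} \<longleftrightarrow> (\<exists>x\<in>X. X - {x} \<in> A)"
    "packet n k X \<inter> A \<noteq> packet n k X \<longleftrightarrow> (\<exists>x\<in>X. X - {x} \<notin> A)"
    by (auto simp: packet_eq[OF X])
  then show ?thesis
    using X lex_suffix_iff[OF X] by (simp add: suffix_part_def)
qed

lemma prefix_part_iff:
  assumes X: "X \<in> ksubsets n (Suc k)"
  shows "X \<in> prefix_part n k A \<longleftrightarrow>
    (\<forall>x\<in>X. \<forall>y\<in>X. x < y \<longrightarrow> X - {x} \<in> A \<longrightarrow> X - {y} \<in> A) \<and>
    (\<exists>x\<in>X. X - {x} \<in> A) \<and> (\<exists>x\<in>X. X - {x} \<notin> A)"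
proof -
  have "packet n k X \<inter> A \<noteq> {} \<longleftrightarrow> (\<exists>x\<in>X. X - {x} \<in> A)"
    "packet n k X \<inter> A \<noteq> packet n k X \<longleftrightarrow> (\<exists>x\<in>X. X - {x} \<notin> A)"
    by (auto simp: packet_eq[OF X])
  then show ?thesis
    using X lex_prefix_iff[OF X] by (simp add: prefix_part_def)
qed

lemma full_part_iff:
  assumes X: "X \<in> ksubsets n (Suc k)"
  shows "X \<in> full_part n k A \<longleftrightarrow> (\<forall>x\<in>X. X - {x} \<in> A)"
  using X by (simp add: full_part_def packet_eq[OF X] image_subset_iff)

lemma parts_subset:
  "suffix_part n k A \<subseteq> ksubsets n (Suc k)" "prefix_part n k A \<subseteq> ksubsets n (Suc k)"
  "full_part n k A \<subseteq> ksubsets n (Suc k)"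
  by (auto simp: suffix_part_def prefix_part_def full_part_def)

section \<open>Cliques and the levels\<close>

lemma ex_least: "finite A \<Longrightarrow> A \<noteq> {} \<Longrightarrow> \<exists>m\<in>A. \<forall>x\<in>A. m \<le> (x :: nat)"
  by (meson Min_in Min_le)

lemma ex_greatest: "finite A \<Longrightarrow> A \<noteq> {} \<Longrightarrow> \<exists>m\<in>A. \<forall>x\<in>A. x \<le> (m :: nat)"
  by (meson Max_in Max_ge)

text \<open>\<open>cotrans\<close> is transitivity of the complement of \<open>J\<close>, read
  contrapositively.\<close>

locale pair_set =
  fixes J :: "nat set set"
  assumes trans: "a < b \<Longrightarrow> b < c \<Longrightarrow> {a, b} \<in> J \<Longrightarrow> {b, c} \<in> J \<Longrightarrow> {a, c} \<in> J"
    and cotrans: "a < b \<Longrightarrow> b < c \<Longrightarrow> {a, c} \<in> J \<Longrightarrow> {a, b} \<in> J \<or> {b, c} \<in> J"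
begin

definition clique :: "nat set \<Rightarrow> bool" where
  "clique S \<longleftrightarrow> (\<forall>a\<in>S. \<forall>b\<in>S. a < b \<longrightarrow> {a, b} \<in> J)"

text \<open>The elements from which on \<open>X\<close> is a clique form a final segment, so
  counting them measures it without naming its first element.\<close>

definition tail :: "nat set \<Rightarrow> nat" where
  "tail X = card {x \<in> X. clique {z \<in> X. x \<le> z}}"

text \<open>So \<open>u\<close> is the least element of the longest final segment of \<open>X\<close> that is a clique.\<close>

definition break_at :: "nat set \<Rightarrow> nat \<Rightarrow> nat \<Rightarrow> bool" where
  "break_at X y u \<longleftrightarrow> y \<in> X \<and> u \<in> X \<and> y < u \<and> (\<forall>z\<in>X. z \<le> y \<or> u \<le> z) \<and>
     {y, u} \<notin> J \<and> clique {z \<in> X. u \<le> z}"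

lemma clique_subset: "clique S \<Longrightarrow> T \<subseteq> S \<Longrightarrow> clique T"
  unfolding clique_def by blast

lemma cliqueD: "clique S \<Longrightarrow> a \<in> S \<Longrightarrow> b \<in> S \<Longrightarrow> a < b \<Longrightarrow> {a, b} \<in> J"
  unfolding clique_def by blast

text \<open>By transitivity through the extreme element \<open>u\<close>, the one pair
  \<open>{y, u}\<close> decides about all new pairs.\<close>

lemma clique_insert_below:
  assumes "clique T" "u \<in> T" "\<forall>t\<in>T. u \<le> t" "y < u" "{y, u} \<in> J"
  shows "clique (insert y T)"
proof -
  have "{y, t} \<in> J" if "t \<in> T" for t
    using assms that trans[of y u t] cliqueD[of T u t] by (cases "t = u") (auto simp: le_less)
  moreover have "\<not> t < y" if "t \<in> T" for t
    using assms that by (auto simp: not_less)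
  ultimately show ?thesis
    using assms(1) unfolding clique_def by (metis insertE less_irrefl)
qed

lemma clique_insert_above:
  assumes "clique T" "u \<in> T" "\<forall>t\<in>T. t \<le> u" "u < p" "{u, p} \<in> J"
  shows "clique (insert p T)"
proof -
  have "{t, p} \<in> J" if "t \<in> T" for t
    using assms that trans[of t u p] cliqueD[of T t u] by (cases "t = u") (auto simp: le_less)
  moreover have "\<not> p < t" if "t \<in> T" for t
    using assms that by (auto simp: not_less)
  ultimately show ?thesis
    using assms(1) unfolding clique_def by (metis insertE less_irrefl)
qed

lemma break_not_clique: "break_at X y u \<Longrightarrow> \<not> clique X"
  unfolding break_at_def clique_def by blast

lemma tail_break:
  assumes "break_at X y u"
  shows "tail X = card {z \<in> X. u \<le> z}"
proof -
  have "{x \<in> X. clique {z \<in> X. x \<le> z}} = {z \<in> X. u \<le> z}"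
  proof (intro equalityI subsetI)
    fix x assume x: "x \<in> {x \<in> X. clique {z \<in> X. x \<le> z}}"
    show "x \<in> {z \<in> X. u \<le> z}"
    proof (rule ccontr)
      assume "x \<notin> {z \<in> X. u \<le> z}"
      then have "x \<le> y"
        using assms x by (auto simp: break_at_def)
      then have "{y, u} \<in> J"
        using assms x cliqueD[of "{z \<in> X. x \<le> z}" y u] by (auto simp: break_at_def)
      then show False
        using assms by (simp add: break_at_def)
    qed
  next
    fix x assume "x \<in> {z \<in> X. u \<le> z}"
    then show "x \<in> {x \<in> X. clique {z \<in> X. x \<le> z}}"
      using assms by (auto simp: break_at_def intro: clique_subset)
  qed
  then show ?thesis
    by (simp add: tail_def)
qed

lemma break_remove:
  "break_at X y u \<Longrightarrow> x \<noteq> y \<Longrightarrow> x \<noteq> u \<Longrightarrow> break_at (X - {x}) y u"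
  unfolding break_at_def by (auto intro: clique_subset)

text \<open>The greatest element alone is a clique, so there is a least \<open>u\<close> from which
  on \<open>X\<close> is one. Since \<open>X\<close> is not a clique, \<open>u\<close> has a
  predecessor \<open>y\<close> in \<open>X\<close>, and a pair \<open>{y, u}\<close> in
  \<open>J\<close> would extend the final clique.\<close>

lemma ex_break:
  assumes "finite X" "\<not> clique X"
  obtains y u where "break_at X y u"
proof -
  let ?T = "{x \<in> X. clique {z \<in> X. x \<le> z}}"
  have "X \<noteq> {}"
    using assms(2) by (auto simp: clique_def)
  then have Max: "Max X \<in> X" "\<forall>z\<in>X. z \<le> Max X"
    using assms(1) by auto
  then have *: "{z \<in> X. Max X \<le> z} = {Max X}"
    by force
  have "clique {z \<in> X. Max X \<le> z}"
    unfolding * by (simp add: clique_def)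
  then have "Max X \<in> ?T"
    using Max(1) by simp
  moreover have "finite ?T"
    using assms(1) by simp
  ultimately obtain u where u: "u \<in> ?T" "\<forall>x\<in>?T. u \<le> x"
    using ex_least[of ?T] by blast
  let ?B = "{z \<in> X. z < u}"
  have "?B \<noteq> {}"
  proof
    assume "?B = {}"
    then have "{z \<in> X. u \<le> z} = X"
      by (auto simp: not_less)
    then show False
      using u(1) assms(2) by simp
  qed
  moreover have "finite ?B"
    using assms(1) by simp
  ultimately obtain y where y: "y \<in> ?B" "\<forall>z\<in>?B. z \<le> y"
    using ex_greatest[of ?B] by blast
  have "{y, u} \<notin> J"
  proof
    assume "{y, u} \<in> J"
    then have "clique (insert y {z \<in> X. u \<le> z})"
      using u(1) y(1) by (intro clique_insert_below[of _ u]) auto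
    moreover have "{z \<in> X. y \<le> z} = insert y {z \<in> X. u \<le> z}"
      using y by force
    ultimately have "y \<in> ?T"
      using y(1) by simp
    then show False
      using u(2) y(1) by auto
  qed
  then have "break_at X y u"
    using u(1) y by (auto simp: break_at_def not_le[symmetric])
  then show thesis
    by (rule that)
qed

text \<open>The break survives, so the final clique either loses the removed element or is left
  alone. This is why the parity of \<open>tail\<close> differs between the two ends of a
  packet.\<close>

lemma tail_break_remove:
  assumes "finite X" "break_at X y u" "x \<in> X"
  shows "u < x \<Longrightarrow> tail (X - {x}) = card {z \<in> X. u \<le> z} - 1"
    and "x < y \<Longrightarrow> tail (X - {x}) = card {z \<in> X. u \<le> z}"
proof -
  have yu: "y < u"
    using assms(2) by (simp add: break_at_def)
  show "tail (X - {x}) = card {z \<in> X. u \<le> z} - 1" if "u < x"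
  proof -
    have "{z \<in> X - {x}. u \<le> z} = {z \<in> X. u \<le> z} - {x}"
      by auto
    then show ?thesis
      using tail_break[OF break_remove[OF assms(2), of x]] that assms(1,3) yu
      by (simp add: card_Diff_singleton)
  qed
  show "tail (X - {x}) = card {z \<in> X. u \<le> z}" if "x < y"
  proof -
    have "{z \<in> X - {x}. u \<le> z} = {z \<in> X. u \<le> z}"
      using that yu by auto
    then show ?thesis
      using tail_break[OF break_remove[OF assms(2), of x]] that yu by simp
  qed
qed

text \<open>Removing \<open>y\<close> or \<open>u\<close> may lengthen the tail, but if both removals do,
  they have the same effect.\<close>

lemma tail_clique:
  assumes "clique X"
  shows "tail X = card X"
proof -
  have "{x \<in> X. clique {z \<in> X. x \<le> z}} = X"
    using clique_subset[OF assms] by auto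
  then show ?thesis
    by (simp add: tail_def)
qed

lemma break_swap:
  assumes X: "finite X" and br: "break_at X y u"
  obtains "tail (X - {u}) = card {z \<in> X. u \<le> z} - 1" "\<not> clique (X - {u})"
  | "tail (X - {y}) = card {z \<in> X. u \<le> z}" "\<not> clique (X - {y})"
  | "tail (X - {u}) = tail (X - {y})" "clique (X - {u}) = clique (X - {y})"
proof -
  let ?T = "{z \<in> X. u \<le> z}"
  let ?E = "\<lambda>w x. clique {z \<in> X - {w}. x \<le> z}"
  have br': "y \<in> X" "u \<in> X" "y < u" "{y, u} \<notin> J" "clique ?T"
    using br by (auto simp: break_at_def)
  have cons: "z \<le> y \<or> u \<le> z" if "z \<in> X" for z
    using br that by (auto simp: break_at_def)
  have E_T: "?E w x" if "x \<in> ?T" for w x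
    using that by (auto intro: clique_subset[OF br'(5)])
  have E_mono: "?E w x'" if "?E w x" "x \<le> x'" for w x x'
    using that(2) by (auto intro: clique_subset[OF that(1)])
  \<comment> \<open>In \<open>neither\<close> the removal of \<open>u\<close> does not let the final
    clique reach down to \<open>y\<close>; in \<open>upper\<close> the removal of \<open>y\<close>
    does not let it pass below \<open>y\<close>. Only in \<open>lower\<close> do the two longer
    final cliques have to be compared.\<close>
  consider (neither) "\<not> ?E u y" | (lower) v where "?E u y" "v \<in> X" "v < y" "?E y v"
    | (upper) "?E u y" "\<forall>v\<in>X. v < y \<longrightarrow> \<not> ?E y v"
    by blast
  then show thesis
  proof cases
    case neither
    have "{x \<in> X - {u}. ?E u x} = ?T - {u}"
    proof (intro equalityI subsetI)
      fix x assume "x \<in> {x \<in> X - {u}. ?E u x}"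
      then show "x \<in> ?T - {u}"
        using cons[of x] neither E_mono[of u x y] by auto
    qed (use E_T in auto)
    moreover have "u \<in> ?T"
      using br' by simp
    ultimately have "tail (X - {u}) = card ?T - 1"
      by (simp add: tail_def)
    moreover have "\<not> clique (X - {u})"
      using neither by (auto intro: clique_subset)
    ultimately show thesis
      by (rule that(1))
  next
    case lower
    have iff: "?E u x \<longleftrightarrow> ?E y x" if x: "x \<in> X" "x < y" for x
    proof
      assume E: "?E u x"
      show "?E y x"
        unfolding clique_def
      proof (intro ballI impI)
        fix a b assume ab: "a \<in> {z \<in> X - {y}. x \<le> z}" "b \<in> {z \<in> X - {y}. x \<le> z}" "a < b"
        consider "a \<noteq> u" "b \<noteq> u" | "u \<le> a" | "b = u" "a < y"
          using ab cons[of a] by force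
        then show "{a, b} \<in> J"
        proof cases
          case 1
          then show ?thesis
            using ab by (intro cliqueD[OF E]) auto
        next
          case 2
          then show ?thesis
            using ab by (intro cliqueD[OF br'(5)]) auto
        next
          case 3
          show ?thesis
          proof (cases "v \<le> a")
            case True
            then show ?thesis
              using ab 3 by (intro cliqueD[OF lower(4)]) auto
          next
            case False
            \<comment> \<open>The pair \<open>{a, u}\<close> is reached through \<open>v\<close>,
              which is adjacent to both.\<close>
            have "{a, v} \<in> J"
              using ab 3 lower br' False by (intro cliqueD[OF E]) auto
            moreover have "{v, u} \<in> J"
              using lower br' by (intro cliqueD[OF lower(4)]) auto
            ultimately show ?thesis
              using trans[of a v u] False 3 lower br' by auto
          qed
        qed
      qed
    next
      assume E: "?E y x"
      show "?E u x"
        unfolding clique_def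
      proof (intro ballI impI)
        fix a b assume ab: "a \<in> {z \<in> X - {u}. x \<le> z}" "b \<in> {z \<in> X - {u}. x \<le> z}" "a < b"
        consider "a \<noteq> y" "b \<noteq> y" | "y \<le> a" | "b = y" "a < y"
          using ab by force
        then show "{a, b} \<in> J"
        proof cases
          case 1
          then show ?thesis
            using ab by (intro cliqueD[OF E]) auto
        next
          case 2
          then show ?thesis
            using ab by (intro cliqueD[OF lower(1)]) auto
        next
          case 3
          \<comment> \<open>As \<open>{a, u}\<close> lies in \<open>J\<close> but
            \<open>{y, u}\<close> does not, cotransitivity leaves only
            \<open>{a, y}\<close>.\<close>
          then have "{a, u} \<in> J"
            using ab br' by (intro cliqueD[OF E]) auto
          then show ?thesis
            using cotrans[of a y u] 3 br' by auto
        qed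
      qed
    qed
    \<comment> \<open>The two sets counted by \<open>tail\<close> differ by exchanging
      \<open>y\<close> and \<open>u\<close>, hence have the same size.\<close>
    have "{x \<in> X - {u}. ?E u x} - {y} = {x \<in> X - {y}. ?E y x} - {u}"
      using iff cons E_T by fastforce
    moreover have "y \<in> {x \<in> X - {u}. ?E u x}" "u \<in> {x \<in> X - {y}. ?E y x}"
      using br' lower(1) E_T by auto
    ultimately have "tail (X - {u}) = tail (X - {y})"
      unfolding tail_def using X by (metis (no_types, lifting) card.remove finite_Diff finite_Collect_conjI finite_subset mem_Collect_eq subsetI)
    moreover have "clique (X - {u}) = clique (X - {y})"
    proof -
      obtain m where m: "m \<in> X" "\<forall>z\<in>X. m \<le> z"
        using ex_least[OF X] br'(1) by blast
      then have "m < y"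
        using lower by (meson le_less_trans)
      moreover have "{z \<in> X - {w}. m \<le> z} = X - {w}" for w
        using m(2) by auto
      ultimately show ?thesis
        using iff[of m] m(1) by simp
    qed
    ultimately show thesis
      by (rule that(3))
  next
    case upper
    have top: "{x \<in> X - {y}. ?E y x} = ?T"
      using upper(2) cons br' E_T by fastforce
    show thesis
    proof (cases "\<exists>x\<in>X. x < y")
      case True
      then obtain x where x: "x \<in> X" "x < y"
        by blast
      then have "\<not> clique (X - {y})"
        using upper(2) by (auto intro: clique_subset)
      then show thesis
        using top by (intro that(2)) (auto simp: tail_def)
    next
      case False
      \<comment> \<open>Here \<open>y\<close> is the least element of \<open>X\<close>, and both
        removals leave cliques of the same size.\<close>
      have *: "{z \<in> X - {u}. y \<le> z} = X - {u}"
        using False by (auto simp: not_less)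
      have "z \<in> ?T" if "z \<in> X" "z \<noteq> y" for z
        using cons[of z] False that by (auto simp: le_less)
      then have "X - {y} = ?T"
        using br'(3) by auto
      note * = * this
      then have "clique (X - {u})" "clique (X - {y})"
        using upper(1) br' by auto
      moreover have "card (X - {u}) = card (X - {y})"
        using br' by simp
      ultimately show thesis
        using tail_clique by (intro that(3)) auto
    qed
  qed
qed

text \<open>A clique with \<open>i\<close> elements has tail \<open>i\<close>, so for odd
  \<open>i\<close> parity alone would miss the cliques.\<close>

definition Mset :: "nat \<Rightarrow> nat \<Rightarrow> nat set set" where
  "Mset n i = {X \<in> ksubsets n i. even (tail X) \<or> clique X}"

definition Lset :: "nat \<Rightarrow> nat \<Rightarrow> nat set set" where
  "Lset n i = {X \<in> ksubsets n i. even (tail X) \<and> \<not> clique X}"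

definition cliques :: "nat \<Rightarrow> nat \<Rightarrow> nat set set" where
  "cliques n i = {X \<in> ksubsets n i. clique X}"

lemma Mset_Lset: "Lset n i \<subseteq> Mset n i" "Mset n i - Lset n i = cliques n i"
    "Mset n i = Lset n i \<union> cliques n i" "Lset n i \<inter> cliques n i = {}"
    "Mset n i \<subseteq> ksubsets n i"
  by (auto simp: Mset_def Lset_def cliques_def)

lemma tail_pos_break: "finite X \<Longrightarrow> break_at X y u \<Longrightarrow> 0 < card {z \<in> X. u \<le> z}"
  by (auto simp: card_gt_0_iff break_at_def)

text \<open>Along a packet of \<open>X\<close> the status is constant above \<open>u\<close>, has the opposite value below
  \<open>y\<close>, and can only change once in between.\<close>

lemma realizable_by_break:
  assumes A: "A \<subseteq> ksubsets n k"
    and clique: "\<And>X a b. X \<in> ksubsets n (Suc k) \<Longrightarrow> clique X \<Longrightarrow> a \<in> X \<Longrightarrow> b \<in> X \<Longrightarrow>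
      X - {a} \<in> A \<longleftrightarrow> X - {b} \<in> A"
    and break: "\<And>X. X \<in> ksubsets n k \<Longrightarrow> \<not> clique X \<Longrightarrow> X \<in> A \<longleftrightarrow> even (tail X)"
    and same: "\<And>X Y. X \<in> ksubsets n k \<Longrightarrow> Y \<in> ksubsets n k \<Longrightarrow> clique X = clique Y \<Longrightarrow>
      tail X = tail Y \<Longrightarrow> X \<in> A \<longleftrightarrow> Y \<in> A"
  shows "realizable n k A"
proof (rule realizableI[OF A])
  fix X p q r
  assume X: "X \<in> ksubsets n (Suc k)"
    and pqr: "p \<in> X" "q \<in> X" "r \<in> X" "p < q" "q < r" "X - {p} \<in> A \<longleftrightarrow> X - {r} \<in> A"
  show "X - {q} \<in> A \<longleftrightarrow> X - {p} \<in> A"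
  proof (cases "clique X")
    case True
    then show ?thesis
      using clique[OF X] pqr by blast
  next
    case False
    then obtain y u where br: "break_at X y u"
      using ex_break[OF ksubsetsD(1)[OF X]] by blast
    let ?t = "card {z \<in> X. u \<le> z}"
    have fin: "finite X"
      using X by (rule ksubsetsD)
    have yu: "y \<in> X" "u \<in> X" "y < u" and cons: "\<forall>z\<in>X. z \<le> y \<or> u \<le> z"
      using br by (auto simp: break_at_def)
    have t: "0 < ?t"
      using tail_pos_break[OF fin br] .
    have upper: "X - {x} \<in> A \<longleftrightarrow> odd ?t" if "x \<in> X" "u < x" for x
      using break[OF ksubsets_remove[OF X that(1)]] break_not_clique[OF break_remove[OF br]]
        tail_break_remove(1)[OF fin br that] that yu t by simp
    have lower: "X - {x} \<in> A \<longleftrightarrow> even ?t" if "x \<in> X" "x < y" for x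
      using break[OF ksubsets_remove[OF X that(1)]] break_not_clique[OF break_remove[OF br]]
        tail_break_remove(2)[OF fin br that] that yu by simp
    note swap = ksubsets_remove[OF X yu(1)] ksubsets_remove[OF X yu(2)]
    \<comment> \<open>Either \<open>u\<close> behaves like the elements above it, or
      \<open>y\<close> like those below it, or the two agree. Each alternative leaves at most one
      change of status along the packet.\<close>
    have middle: "(X - {u} \<in> A \<longleftrightarrow> odd ?t) \<or> (X - {y} \<in> A \<longleftrightarrow> even ?t) \<or> (X - {u} \<in> A \<longleftrightarrow> X - {y} \<in> A)"
    proof (rule break_swap[OF fin br])
      assume "tail (X - {u}) = ?t - 1" "\<not> clique (X - {u})"
      then show ?thesis
        using break[OF swap(2)] t by auto
    next
      assume "tail (X - {y}) = ?t" "\<not> clique (X - {y})"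
      then show ?thesis
        using break[OF swap(1)] by simp
    next
      assume "tail (X - {u}) = tail (X - {y})" "clique (X - {u}) = clique (X - {y})"
      then show ?thesis
        using same[OF swap] by auto
    qed
    have position: "x < y \<or> x = y \<or> x = u \<or> u < x" if "x \<in> X" for x
      using cons that by force
    consider "q < y" | "q = y" | "q = u" | "u < q"
      using position[OF pqr(2)] by blast
    then show ?thesis
    proof cases
      case 1
      then show ?thesis
        using lower[OF pqr(1)] lower[OF pqr(2)] pqr(4) by simp
    next
      case 2
      then have "X - {p} \<in> A \<longleftrightarrow> even ?t"
        using lower[OF pqr(1)] pqr(4) by simp
      moreover have "r = u \<or> u < r"
        using position[OF pqr(3)] pqr(5) 2 by auto
      ultimately show ?thesis
        using 2 middle upper[OF pqr(3)] pqr(6) by blast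
    next
      case 3
      then have "X - {r} \<in> A \<longleftrightarrow> odd ?t"
        using upper[OF pqr(3)] pqr(5) by simp
      moreover have "p = y \<or> p < y"
        using position[OF pqr(1)] pqr(4) 3 by auto
      ultimately show ?thesis
        using 3 middle lower[OF pqr(1)] pqr(6) by blast
    next
      case 4
      then show ?thesis
        using upper[OF pqr(2)] upper[OF pqr(3)] pqr(5,6) by simp
    qed
  qed
qed

lemma realizable_Lset: "realizable n i (Lset n i)"
  by (rule realizable_by_break) (auto simp: Lset_def ksubsets_remove intro: clique_subset)

lemma realizable_Mset: "realizable n i (Mset n i)"
proof (rule realizable_by_break)
  fix X a b
  assume X: "X \<in> ksubsets n (Suc i)" "clique X" "a \<in> X" "b \<in> X"
  then have "clique (X - {a})" "clique (X - {b})"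
    by (auto intro: clique_subset)
  then show "X - {a} \<in> Mset n i \<longleftrightarrow> X - {b} \<in> Mset n i"
    using X by (simp add: Mset_def ksubsets_remove)
qed (auto simp: Mset_def)

text \<open>As \<open>X\<close> has at least three elements, each of its pairs survives the removal
  of some third element.\<close>

lemma full_part_cliques:
  assumes "2 \<le> i"
  shows "full_part n i (cliques n i) = cliques n (Suc i)"
proof (intro equalityI subsetI)
  fix X assume full: "X \<in> full_part n i (cliques n i)"
  then have "X \<in> ksubsets n (Suc i)"
    using parts_subset(3) by blast
  then have X: "X \<in> ksubsets n (Suc i)" "\<forall>x\<in>X. clique (X - {x})"
    using full by (auto simp: full_part_iff cliques_def)
  have "{a, b} \<in> J" if ab: "a \<in> X" "b \<in> X" "a < b" for a b
  proof -
    have "\<not> X \<subseteq> {a, b}"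
      using card_mono[of "{a, b}" X] ksubsetsD(2)[OF X(1)] ab assms by auto
    then obtain c where "c \<in> X" "c \<noteq> a" "c \<noteq> b"
      by blast
    then show ?thesis
      using X(2) ab cliqueD[of "X - {c}" a b] by simp
  qed
  then show "X \<in> cliques n (Suc i)"
    using X(1) by (simp add: cliques_def clique_def)
next
  fix X assume "X \<in> cliques n (Suc i)"
  then show "X \<in> full_part n i (cliques n i)"
    by (auto simp: cliques_def full_part_iff ksubsets_remove intro: clique_subset)
qed

lemma Mset_remove:
  assumes X: "X \<in> ksubsets n (Suc i)" and br: "break_at X y u" and x: "x \<in> X"
  shows "u < x \<Longrightarrow> X - {x} \<in> Mset n i \<longleftrightarrow> odd (card {z \<in> X. u \<le> z})"
    and "x < y \<Longrightarrow> X - {x} \<in> Mset n i \<longleftrightarrow> even (card {z \<in> X. u \<le> z})"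
proof -
  have fin: "finite X"
    using X by (rule ksubsetsD)
  have yu: "y < u"
    using br by (simp add: break_at_def)
  show "u < x \<Longrightarrow> X - {x} \<in> Mset n i \<longleftrightarrow> odd (card {z \<in> X. u \<le> z})"
    using tail_break_remove(1)[OF fin br x] break_not_clique[OF break_remove[OF br]] yu
      tail_pos_break[OF fin br] by (simp add: Mset_def ksubsets_remove[OF X x])
  show "x < y \<Longrightarrow> X - {x} \<in> Mset n i \<longleftrightarrow> even (card {z \<in> X. u \<le> z})"
    using tail_break_remove(2)[OF fin br x] break_not_clique[OF break_remove[OF br]] yu
    by (simp add: Mset_def ksubsets_remove[OF X x])
qed

lemma above_break:
  assumes "finite X" "break_at X y u" "even (card {z \<in> X. u \<le> z})"
  obtains x where "x \<in> X" "u < x" "\<forall>z\<in>X. z \<le> x"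
proof -
  have u: "u \<in> X"
    using assms(2) by (simp add: break_at_def)
  then obtain m where m: "m \<in> X" "\<forall>z\<in>X. z \<le> m"
    using ex_greatest assms(1) by blast
  have "u \<noteq> m"
  proof
    assume "u = m"
    then have "{z \<in> X. u \<le> z} = {u}"
      using m by force
    then show False
      using assms(3) by simp
  qed
  then show thesis
    using that m u by force
qed

text \<open>Because \<open>Mset n i\<close> is realizable, \<open>X\<close> belongs to its suffix
  part if and only if removing the least element gives a member and removing the greatest does not.
  Both are read off from the parity of the final clique, with extra care if the break is at an end
  of \<open>X\<close>.\<close>

lemma suffix_part_Mset:
  assumes "2 \<le> i"
  shows "suffix_part n i (Mset n i) = Lset n (Suc i)"
proof -
  have "X \<in> suffix_part n i (Mset n i) \<longleftrightarrow> even (tail X) \<and> \<not> clique X"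
    if X: "X \<in> ksubsets n (Suc i)" for X
  proof (cases "clique X")
    case True
    then have "\<forall>x\<in>X. X - {x} \<in> Mset n i"
      using X by (auto simp: Mset_def ksubsets_remove intro: clique_subset)
    then show ?thesis
      using True by (auto simp: suffix_part_iff[OF X])
  next
    case False
    have fin: "finite X"
      using X by (rule ksubsetsD)
    obtain y u where br: "break_at X y u"
      using ex_break[OF fin False] .
    have yu: "y \<in> X" "u \<in> X" "y < u" "\<forall>z\<in>X. z \<le> y \<or> u \<le> z"
      using br by (auto simp: break_at_def)
    obtain m where m: "m \<in> X" "\<forall>z\<in>X. m \<le> z"
      using ex_least[OF fin] yu by blast
    obtain l where l: "l \<in> X" "\<forall>z\<in>X. z \<le> l"
      using ex_greatest[OF fin] yu by blast
    let ?t = "card {z \<in> X. u \<le> z}"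
    have "X \<in> suffix_part n i (Mset n i) \<longleftrightarrow> even ?t"
    proof
      assume "X \<in> suffix_part n i (Mset n i)"
      then have anti: "\<forall>x\<in>X. \<forall>y\<in>X. x < y \<longrightarrow> X - {y} \<in> Mset n i \<longrightarrow> X - {x} \<in> Mset n i"
        and ex: "\<exists>x\<in>X. X - {x} \<in> Mset n i" "\<exists>x\<in>X. X - {x} \<notin> Mset n i"
        by (auto simp: suffix_part_iff[OF X])
      have ml: "X - {m} \<in> Mset n i" "X - {l} \<notin> Mset n i"
        using anti ex m l by (metis le_neq_implies_less)+
      show "even ?t"
      proof (cases "u < l")
        case True
        then show ?thesis
          using Mset_remove(1)[OF X br l(1)] ml by simp
      next
        case False
        \<comment> \<open>Here \<open>u\<close> is the greatest element. Since \<open>X\<close> has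
          a third element, something lies below \<open>y\<close>, and the parity is seen there
          instead.\<close>
        have "X \<noteq> {y, u}"
          using ksubsetsD(2)[OF X] assms yu(3) by auto
        then obtain x where x: "x \<in> X" "x \<noteq> y" "x \<noteq> u"
          using yu by blast
        then have "x < y"
          using yu l False by (metis le_neq_implies_less le_less_trans not_le)
        then have "m < y"
          using m x by (meson le_less_trans)
        then show ?thesis
          using Mset_remove(2)[OF X br m(1)] ml by simp
      qed
    next
      assume even: "even ?t"
      have l': "u < l"
        using above_break[OF fin br even] l by (metis less_le_trans)
      have ml: "X - {l} \<notin> Mset n i"
        using Mset_remove(1)[OF X br l(1) l'] even by simp
      have mm: "X - {m} \<in> Mset n i"
      proof (cases "m < y")
        case True
        then show ?thesis
          using Mset_remove(2)[OF X br m(1)] even by simp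
      next
        case False
        \<comment> \<open>Parity says nothing about the removal of \<open>y\<close>, but here it
          leaves precisely the final clique.\<close>
        then have "m = y"
          using m yu by force
        then have "X - {m} = {z \<in> X. u \<le> z}"
          using yu m by force
        then have "clique (X - {m})"
          using br by (simp add: break_at_def)
        then show ?thesis
          using ksubsets_remove[OF X m(1)] by (simp add: Mset_def)
      qed
      have "X - {a} \<in> Mset n i" if ab: "a \<in> X" "b \<in> X" "a < b" "X - {b} \<in> Mset n i" for a b
      proof -
        have "b < l"
          using ab l ml by (metis le_neq_implies_less)
        then show ?thesis
          using realizable_between[OF realizable_Mset X ab(1,2) l(1) ab(3)] ab(4) ml by auto
      qed
      then show "X \<in> suffix_part n i (Mset n i)"
        using m l ml mm by (auto simp: suffix_part_iff[OF X])
    qed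
    then show ?thesis
      using False tail_break[OF br] by simp
  qed
  then show ?thesis
    using parts_subset(1)[of n i "Mset n i"] by (auto simp: Lset_def)
qed

text \<open>A break of \<open>X - {m}\<close> would be one of \<open>X\<close>, with the same even
  final clique. That clique has an element above \<open>u\<close>, whose removal would make it odd
  and thus lead out of \<open>Mset n i\<close>.\<close>

lemma least_remove_notin_Lset:
  assumes X: "X \<in> ksubsets n (Suc i)" and full: "\<forall>x\<in>X. X - {x} \<in> Mset n i"
    and m: "m \<in> X" "\<forall>z\<in>X. m \<le> z"
  shows "X - {m} \<notin> Lset n i"
proof
  assume L: "X - {m} \<in> Lset n i"
  have fin: "finite (X - {m})"
    using X by (auto dest: ksubsetsD)
  obtain y u where br: "break_at (X - {m}) y u"
    using ex_break[OF fin] L by (auto simp: Lset_def)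
  have yu: "m < y" "y < u" "y \<in> X" "u \<in> X"
    using br m by (auto simp: break_at_def le_less)
  have eq: "{z \<in> X - {m}. u \<le> z} = {z \<in> X. u \<le> z}"
    using yu by auto
  have br': "break_at X y u"
    using br yu(1) unfolding break_at_def eq by auto
  have even: "even (card {z \<in> X. u \<le> z})"
    using L tail_break[OF br] eq by (simp add: Lset_def)
  obtain x where "x \<in> X" "u < x"
    using above_break[OF ksubsetsD(1)[OF X] br' even] by blast
  then show False
    using Mset_remove(1)[OF X br'] full even by simp
qed

text \<open>In a packet inside \<open>Mset n i\<close> the last member is not in
  \<open>Lset n i\<close>, so by realizability \<open>Lset n i\<close> meets it in a lexicographic
  prefix. Hence a full packet in lexicographic order does not obstruct moving
  \<open>Lset n i\<close> to the front.\<close>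

lemma Lset_upward:
  assumes X: "X \<in> ksubsets n (Suc i)" and full: "\<forall>x\<in>X. X - {x} \<in> Mset n i"
    and xy: "x \<in> X" "y \<in> X" "x < y" "X - {x} \<in> Lset n i"
  shows "X - {y} \<in> Lset n i"
proof -
  obtain m where m: "m \<in> X" "\<forall>z\<in>X. m \<le> z"
    using ex_least ksubsetsD(1)[OF X] xy(1) by blast
  have "X - {m} \<notin> Lset n i"
    using least_remove_notin_Lset[OF X full m] .
  moreover have "m < x"
    using calculation m xy by (metis le_neq_implies_less)
  ultimately show ?thesis
    using realizable_between[OF realizable_Lset X m(1) xy(1,2) _ xy(3)] xy(4) by auto
qed

text \<open>If \<open>p\<close> spoils the clique, it does so at the greatest element of
  \<open>C\<close>, by \<open>clique_insert_above\<close>. Then the final clique is \<open>p\<close>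
  alone, of odd length 1.\<close>

lemma insert_clique_notin_Lset:
  assumes "clique C" "finite C" "\<forall>c\<in>C. c < p"
  shows "insert p C \<notin> Lset n i"
proof (cases "clique (insert p C)")
  case True
  then show ?thesis
    by (simp add: Lset_def)
next
  case False
  then have "C \<noteq> {}"
    by (auto simp: clique_def)
  then obtain m where m: "m \<in> C" "\<forall>z\<in>C. z \<le> m"
    using ex_greatest[OF assms(2)] by blast
  have "{m, p} \<notin> J"
    using clique_insert_above[OF assms(1) m] assms(3) m(1) False by blast
  moreover have "{z \<in> insert p C. p \<le> z} = {p}"
    using assms(3) by auto
  ultimately have br: "break_at (insert p C) m p"
    using m assms(3) by (auto simp: break_at_def clique_def)
  show ?thesis
    using tail_break[OF br] \<open>{z \<in> insert p C. p \<le> z} = {p}\<close> by (simp add: Lset_def)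
qed

lemma insert_nonadjacent_notin_Mset:
  assumes "p \<in> C" "\<forall>c\<in>C. c \<le> p" "p < q" "{p, q} \<notin> J"
  shows "insert q C \<notin> Mset n i"
proof -
  have *: "{z \<in> insert q C. q \<le> z} = {q}"
    using assms by auto
  have br: "break_at (insert q C) p q"
    unfolding break_at_def * using assms by (auto simp: clique_def)
  show ?thesis
    using tail_break[OF br] break_not_clique[OF br] * by (simp add: Mset_def)
qed

end

text \<open>In the packet of \<open>{a, b, c}\<close> the pair \<open>{a, c}\<close> is in the
  middle, so its status follows the outer two whenever they agree.\<close>

lemma realizable_pair_set:
  assumes "realizable n 2 J"
  shows "pair_set J"
proof
  have sub: "x \<in> {1..n}" if "{x, y} \<in> J \<or> {y, x} \<in> J" for x y
    using realizable_subset[OF assms] that by (auto simp: ksubsets_def)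
  have *: "{b, c} \<in> J \<longleftrightarrow> {a, b} \<in> J \<Longrightarrow> {a, c} \<in> J \<longleftrightarrow> {b, c} \<in> J"
    if "a < b" "b < c" "a \<in> {1..n}" "c \<in> {1..n}" for a b c
  proof -
    assume "{b, c} \<in> J \<longleftrightarrow> {a, b} \<in> J"
    moreover have "{a, b, c} \<in> ksubsets n (Suc 2)"
      using that by (auto simp: ksubsets_def)
    moreover have "{a, b, c} - {a} = {b, c}" "{a, b, c} - {b} = {a, c}" "{a, b, c} - {c} = {a, b}"
      using that by auto
    ultimately show "{a, c} \<in> J \<longleftrightarrow> {b, c} \<in> J"
      using realizable_between[OF assms, of "{a, b, c}" a b c] that by auto
  qed
  show "{a, c} \<in> J" if "a < b" "b < c" "{a, b} \<in> J" "{b, c} \<in> J" for a b c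
    using *[of a b c] sub that by blast
  show "{a, b} \<in> J \<or> {b, c} \<in> J" if "a < b" "b < c" "{a, c} \<in> J" for a b c
    using *[of a b c] sub that by blast
qed

context pair_set
begin

text \<open>A pair in \<open>J\<close> is a clique with tail 2, any other pair has tail 1; this
  gives the start. The recursion is the content of \<open>suffix_part_Mset\<close> and
  \<open>full_part_cliques\<close>.\<close>

lemma levels:
  assumes J: "realizable n 2 J" and "2 \<le> i"
  shows "level_L n J i = Lset n i \<and> level_M n J i = Mset n i"
  using assms(2)
proof (induction i rule: dec_induct)
  case base
  have "clique X \<longleftrightarrow> X \<in> J" "even (tail X) \<longleftrightarrow> clique X" if X: "X \<in> ksubsets n 2" for X
  proof -
    obtain c d where cd: "X = {c, d}" "c \<noteq> d"
      using ksubsetsD(2)[OF X] by (auto simp: card_2_iff)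
    have "X = {min c d, max c d}" "min c d < max c d"
      using cd by (auto simp: min_def max_def)
    then obtain a b where ab: "X = {a, b}" "a < b"
      by blast
    show "clique X \<longleftrightarrow> X \<in> J"
      using ab by (auto simp: clique_def insert_commute)
    show "even (tail X) \<longleftrightarrow> clique X"
    proof (cases "clique X")
      case True
      then show ?thesis
        using ab tail_clique[of X] by simp
    next
      case False
      then have br: "break_at X a b"
        using ab by (auto simp: clique_def break_at_def)
      have "{z \<in> X. b \<le> z} = {b}"
        using ab by auto
      then show ?thesis
        using False tail_break[OF br] by simp
    qed
  qed
  then show ?case
    using realizable_subset[OF J] by (auto simp: level_L.simps level_M.simps Lset_def Mset_def)
next
  case (step i)
  then have "level_L n J (Suc i) = Lset n (Suc i)"
    by (simp add: level_L.simps[of n J "Suc i"] suffix_part_Mset)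
  moreover have "level_M n J (Suc i) = Lset n (Suc i) \<union> cliques n (Suc i)"
    using step by (simp add: level_M.simps[of n J "Suc i"] suffix_part_Mset Mset_Lset(2) full_part_cliques)
  ultimately show ?case
    by (simp add: Mset_Lset(3))
qed

end

section \<open>Adding and removing cliques\<close>

lemma thresholds:
  fixes q :: nat and c :: bool
  shows "antimono (\<lambda>w. w < q)" "mono (\<lambda>w. q < w)" "antimono (\<lambda>w. w \<le> q)" "mono (\<lambda>w. q \<le> w)"
    "mono (\<lambda>w :: nat. c)"
  by (auto simp: monotone_on_def)

text \<open>Changing the status of the single set \<open>X\<close> affects only the packets of the
  sets \<open>insert q X\<close>. There \<open>P\<close> describes the status through the removed
  element, so that an application has only to name a threshold or a constant.\<close>

lemma realizable_change:
  assumes U: "realizable n k U" and A: "A \<subseteq> ksubsets n k"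
    and same: "\<And>Y. Y \<noteq> X \<Longrightarrow> Y \<in> A \<longleftrightarrow> Y \<in> U"
    and X: "X \<in> ksubsets n k"
    and mono: "\<And>q. q \<notin> X \<Longrightarrow> insert q X \<in> ksubsets n (Suc k) \<Longrightarrow>
      \<exists>P. (mono P \<or> antimono P) \<and> (\<forall>w\<in>insert q X. insert q X - {w} \<in> A \<longleftrightarrow> P w)"
  shows "realizable n k A"
proof (rule realizableI[OF A])
  fix W a b c
  assume W: "W \<in> ksubsets n (Suc k)" "a \<in> W" "b \<in> W" "c \<in> W" "a < b" "b < c"
    "W - {a} \<in> A \<longleftrightarrow> W - {c} \<in> A"
  show "W - {b} \<in> A \<longleftrightarrow> W - {a} \<in> A"
  proof (cases "X \<subseteq> W")
    case True
    then obtain q where q: "q \<notin> X" "W = insert q X"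
      using ksubsets_superset[OF W(1) X] by blast
    obtain P where P: "mono P \<or> antimono P" "\<forall>w\<in>W. W - {w} \<in> A \<longleftrightarrow> P w"
      using mono[of q] q W(1) by blast
    have "P a = P c \<Longrightarrow> P b = P a"
      using P(1) monoD[of P a b] monoD[of P b c] antimonoD[of P a b] antimonoD[of P b c] W(5,6)
      by auto
    then show ?thesis
      using P(2) W by simp
  next
    case False
    then have "W - {w} \<noteq> X" for w
      by blast
    then show ?thesis
      using realizable_between[OF U W(1-6)] W(7) same by simp
  qed
qed

lemma ksubsets_decompose:
  assumes "X \<in> ksubsets n (Suc k)"
  obtains m Z where "m < n" "Z \<in> ksubsets m k" "X = insert (Suc m) Z"
  using assms
proof (induction n arbitrary: thesis)
  case 0
  then show ?case
    by (simp add: ksubsets_0_Suc)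
next
  case (Suc n)
  then show ?case
    by (auto simp: ksubsets_Suc less_Suc_eq)
qed

lemma contraction_restrict:
  "contraction m k (U \<inter> ksubsets (Suc m) (Suc k)) = contraction m k U"
  by (auto simp: contraction_def ksubsets_Suc)

lemma contraction_closed:
  assumes U: "realizable n (Suc k) U" and m: "m < n" and Y: "Y \<in> ksubsets m (Suc k)"
    and xy: "x \<in> Y" "y \<in> Y" "x < y"
  shows "Y \<in> U \<Longrightarrow> Y - {x} \<in> contraction m k U \<Longrightarrow> Y - {y} \<in> contraction m k U"
    and "Y \<notin> U \<Longrightarrow> Y - {y} \<in> contraction m k U \<Longrightarrow> Y - {x} \<in> contraction m k U"
proof -
  have "realizable (Suc m) (Suc k) (U \<inter> ksubsets (Suc m) (Suc k))"
    using realizable_delete[OF U] m by simp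
  from contraction_upward[OF this Y xy, unfolded contraction_restrict]
  show "Y \<in> U \<Longrightarrow> Y - {x} \<in> contraction m k U \<Longrightarrow> Y - {y} \<in> contraction m k U"
    "Y \<notin> U \<Longrightarrow> Y - {y} \<in> contraction m k U \<Longrightarrow> Y - {x} \<in> contraction m k U"
    using Y by (auto simp: ksubsets_Suc)
qed

lemma full_order_precedes:
  assumes \<rho>: "\<rho> \<in> full_orders m k (U \<inter> ksubsets m (Suc k))" and Y: "Y \<in> ksubsets m (Suc k)"
    and xy: "x \<in> Y" "y \<in> Y" "x < y"
  shows "Y \<in> U \<Longrightarrow> \<not> precedes \<rho> (Y - {y}) (Y - {x})"
    and "Y \<notin> U \<Longrightarrow> \<not> precedes \<rho> (Y - {x}) (Y - {y})"
proof -
  have or: "oriented m k (ksubsets m k) U \<rho>" and dist: "distinct \<rho>"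
    using \<rho> by (auto simp: full_orders_def oriented_deletion permutations_of_set_def)
  note P = orientedD[OF or Y xy ksubsets_remove[OF Y xy(1)] ksubsets_remove[OF Y xy(2)]]
  show "Y \<in> U \<Longrightarrow> \<not> precedes \<rho> (Y - {y}) (Y - {x})"
    "Y \<notin> U \<Longrightarrow> \<not> precedes \<rho> (Y - {x}) (Y - {y})"
    using P precedes_asym[OF dist] by blast+
qed

text \<open>In this packet the set \<open>insert (Suc m) Z\<close> belongs to the removed element
  \<open>q\<close>. By \<open>status\<close>, membership is constant on either side of
  \<open>q\<close>, with opposite values; \<open>Suc m\<close> fits in, since its removal gives
  \<open>insert q Z\<close> itself. The change thus occurs at \<open>q\<close>, and
  \<open>insert (Suc m) Z\<close> may have either status.\<close>

lemma ex_threshold: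
  fixes q m :: nat
  assumes Y: "insert q Z \<in> ksubsets m (Suc i)" and q: "q \<notin> insert (Suc m) Z"
    and same: "\<And>B. B \<noteq> insert (Suc m) Z \<Longrightarrow> B \<in> A \<longleftrightarrow> B \<in> U"
    and status: "\<forall>x\<in>Z. insert q Z - {x} \<in> contraction m i U \<longleftrightarrow>
      (if insert q Z \<in> U then q < x else x < q)"
  shows "\<exists>P. (mono P \<or> antimono P) \<and>
    (\<forall>w\<in>insert q (insert (Suc m) Z). insert q (insert (Suc m) Z) - {w} \<in> A \<longleftrightarrow> P w)"
proof -
  let ?X = "insert (Suc m) Z" and ?Y = "insert q Z"
  let ?W = "insert q ?X"
  have le: "w \<le> m" if "w \<in> ?Y" for w
    using ksubsetsD(3)[OF Y] that by auto
  have Wq: "?W - {q} = ?X"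
    using q by auto
  have WN: "?W - {Suc m} = ?Y"
    using le q by force
  have other: "?W - {w} \<in> A \<longleftrightarrow> ?W - {w} \<in> U" if "w \<in> ?W" "w \<noteq> q" for w
    using q that by (intro same) blast
  have Z: "?W - {w} \<in> A \<longleftrightarrow> (if ?Y \<in> U then q < w else w < q)" if "w \<in> Z" for w
  proof -
    have "?W - {w} = insert (Suc m) (?Y - {w})"
      using that le by force
    moreover have "?Y - {w} \<in> ksubsets m i"
      using that by (intro ksubsets_remove[OF Y]) simp
    moreover have "w \<noteq> q"
      using that q by blast
    ultimately show ?thesis
      using other[of w] bspec[OF status that] that by (simp add: contraction_def)
  qed
  have N: "?W - {Suc m} \<in> A \<longleftrightarrow> ?Y \<in> U" "q < Suc m"
    using other[of "Suc m"] WN le[of q] q by auto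
  show ?thesis
  proof (cases "?Y \<in> U"; cases "?X \<in> A")
    assume *: "?Y \<in> U" "?X \<in> A"
    have "\<forall>w\<in>?W. ?W - {w} \<in> A \<longleftrightarrow> q \<le> w"
      using * Z Wq N q by (auto simp: le_less)
    then show ?thesis
      using thresholds(4)[of q] by blast
  next
    assume *: "?Y \<in> U" "?X \<notin> A"
    have "\<forall>w\<in>?W. ?W - {w} \<in> A \<longleftrightarrow> q < w"
      using * Z Wq N by auto
    then show ?thesis
      using thresholds(2)[of q] by blast
  next
    assume *: "?Y \<notin> U" "?X \<in> A"
    have "\<forall>w\<in>?W. ?W - {w} \<in> A \<longleftrightarrow> w \<le> q"
      using * Z Wq N q by (auto simp: le_less)
    then show ?thesis
      using thresholds(3)[of q] by blast
  next
    assume *: "?Y \<notin> U" "?X \<notin> A"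
    have "\<forall>w\<in>?W. ?W - {w} \<in> A \<longleftrightarrow> w < q"
      using * Z Wq N by auto
    then show ?thesis
      using thresholds(1)[of q] by blast
  qed
qed

section \<open>Choosing the clique to remove or to add\<close>

context pair_set
begin

text \<open>The relation is ``\<open>a\<close> occurs before \<open>b\<close>'' in the permutation whose inversion set is \<open>J\<close>.\<close>

lemma ex_first_letter:
  assumes "finite A" "A \<noteq> {}"
  shows "\<exists>p\<in>A. \<forall>q\<in>A. (p < q \<longrightarrow> {p, q} \<notin> J) \<and> (q < p \<longrightarrow> {q, p} \<in> J)"
  using assms
proof (induction A rule: finite_ne_induct)
  case (singleton x)
  then show ?case
    by simp
next
  case (insert x A)
  then obtain p where p: "p \<in> A" "\<forall>q\<in>A. (p < q \<longrightarrow> {p, q} \<notin> J) \<and> (q < p \<longrightarrow> {q, p} \<in> J)"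
    by blast
  show ?case
  proof (cases "(p < x \<longrightarrow> {p, x} \<notin> J) \<and> (x < p \<longrightarrow> {x, p} \<in> J)")
    case True
    then show ?thesis
      using p by blast
  next
    case False
    have "(x < q \<longrightarrow> {x, q} \<notin> J) \<and> (q < x \<longrightarrow> {q, x} \<in> J)" if "q \<in> A" for q
    proof -
      have q: "p < q \<Longrightarrow> {p, q} \<notin> J" "q < p \<Longrightarrow> {q, p} \<in> J"
        using p that by auto
      consider "p < x" "{p, x} \<in> J" | "x < p" "{x, p} \<notin> J"
        using False by blast
      then show ?thesis
      proof cases
        case 1
        then show ?thesis
          using q trans[of p x q] cotrans[of p q x] trans[of q p x]
          by (cases q p rule: linorder_cases) auto
      next
        case 2
        then show ?thesis
          using q cotrans[of x p q] cotrans[of q x p] trans[of x q p]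
          by (cases q p rule: linorder_cases) auto
      qed
    qed
    then show ?thesis
      by blast
  qed
qed

text \<open>The maximum \<open>Suc m\<close> of the removed clique is as large as possible, and the rest \<open>Z\<close> of the clique
  comes first in a total order for the restriction of \<open>U\<close> to \<open>{1..m}\<close>.\<close>

lemma ex_removable:
  assumes U: "realizable n (Suc i) U" and LU: "Lset n (Suc i) \<subseteq> U" and UM: "U \<subseteq> Mset n (Suc i)"
    and ne: "U \<noteq> Lset n (Suc i)"
  shows "\<exists>X\<in>U - Lset n (Suc i). realizable n (Suc i) (U - {X})"
proof -
  let ?L = "Lset n (Suc i)"
  let ?P = "{m. m < n \<and> (\<exists>Z\<in>ksubsets m i. insert (Suc m) Z \<in> U - ?L)}"
  obtain X0 where X0: "X0 \<in> U - ?L"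
    using ne LU by blast
  then have "X0 \<in> ksubsets n (Suc i)"
    using realizable_subset[OF U] by blast
  then obtain m0 Z0 where "m0 < n" "Z0 \<in> ksubsets m0 i" "X0 = insert (Suc m0) Z0"
    by (rule ksubsets_decompose)
  then have "m0 \<in> ?P"
    using X0 by blast
  moreover have "finite ?P"
    by simp
  ultimately obtain m where P: "m \<in> ?P" "\<forall>m'\<in>?P. m' \<le> m"
    using ex_greatest[of ?P] by blast
  then have m: "m < n" "\<exists>Z\<in>ksubsets m i. insert (Suc m) Z \<in> U - ?L"
    by simp_all
  let ?V = "contraction m i U" and ?VL = "contraction m i ?L"
  obtain \<rho> where \<rho>: "\<rho> \<in> full_orders m i (U \<inter> ksubsets m (Suc i))"
    using ex_full_order[OF realizable_delete[OF U]] m(1) by fastforce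
  have "?V - ?VL \<noteq> {}" "?V - ?VL \<subseteq> set \<rho>"
    using m(2) \<rho> by (auto simp: contraction_def full_orders_def permutations_of_set_def)
  then obtain Z where Z: "Z \<in> ?V - ?VL" "\<And>Z'. Z' \<in> ?V - ?VL \<Longrightarrow> Z' \<noteq> Z \<Longrightarrow> precedes \<rho> Z Z'"
    using ex_precedes_first[of "?V - ?VL" \<rho>] by blast
  let ?X = "insert (Suc m) Z"
  have Zm: "Z \<in> ksubsets m i" "Suc m \<notin> Z"
    using Z(1) Suc_notin_ksubsets by (auto simp: contraction_def)
  have X: "?X \<in> U - ?L"
    using Z(1) by (auto simp: contraction_def)
  then have clX: "clique ?X"
    using UM by (auto simp: Mset_def Lset_def)
  have Xn: "?X \<in> ksubsets n (Suc i)"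
    using X realizable_subset[OF U] by blast
  have "realizable n (Suc i) (U - {?X})"
  proof (rule realizable_change[OF U _ _ Xn])
    show "U - {?X} \<subseteq> ksubsets n (Suc i)"
      using realizable_subset[OF U] by blast
    fix q assume q: "q \<notin> ?X" and W: "insert q ?X \<in> ksubsets n (Suc (Suc i))"
    let ?W = "insert q ?X"
    have Wq: "?W - {q} = ?X"
      using q by auto
    have other: "?W - {w} \<in> U - {?X} \<longleftrightarrow> ?W - {w} \<in> U" if "w \<in> ?W" "w \<noteq> q" for w
      using q that by blast
    consider "Suc m < q" | "q \<le> m"
      using q by fastforce
    then show "\<exists>P. (mono P \<or> antimono P) \<and> (\<forall>w\<in>?W. ?W - {w} \<in> U - {?X} \<longleftrightarrow> P w)"
    proof cases
      case 1
      \<comment> \<open>These sets have maximum \<open>q\<close>. They are not in \<open>?L\<close>,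
        being cliques with one larger element added, and by the choice of \<open>m\<close> they are
        not in \<open>U - ?L\<close> either.\<close>
      have "?W - {w} \<notin> U" if w: "w \<in> ?W" "w \<noteq> q" for w
      proof
        assume wU: "?W - {w} \<in> U"
        have eq: "?W - {w} = insert q (?X - {w})"
          using w by auto
        have below: "c < q" if "c \<in> ?X" for c
          using that 1 Zm(1) by (auto simp: ksubsets_def)
        have "?W - {w} \<notin> ?L"
          unfolding eq using clique_subset[OF clX] below ksubsetsD(1)[OF Xn]
          by (intro insert_clique_notin_Lset) auto
        moreover have "?X - {w} \<in> ksubsets (q - 1) i"
          using ksubsets_remove[OF Xn, of w] w below by (fastforce simp: ksubsets_def)
        moreover have "q - 1 < n" "Suc (q - 1) = q"
          using W 1 by (auto simp: ksubsets_def)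
        ultimately have "q - 1 \<in> ?P"
          using wU eq by auto
        then show False
          using P(2) 1 by force
      qed
      then have "\<forall>w\<in>?W. ?W - {w} \<in> U - {?X} \<longleftrightarrow> False"
        using Wq other by (metis Diff_iff singletonI)
      then show ?thesis
        using thresholds(5)[of False] by blast
    next
      case 2
      let ?Y = "insert q Z"
      have Y: "?Y \<in> ksubsets m (Suc i)"
        using 2 q W ksubsets_insert[OF Zm(1)] by (auto simp: ksubsets_def)
      have qZ: "q \<notin> Z"
        using q by simp
      have YZ: "?Y - {q} = Z"
        using qZ by auto
      have RL: "realizable n (Suc i) ?L"
        by (rule realizable_Lset)
      have not_q: "?Y - {x} \<noteq> Z" if "x \<in> ?Y" "x \<noteq> q" for x
        using that qZ by blast
      show ?thesis
      proof (cases "?Y \<in> U")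
        case False
        then have YL: "?Y \<notin> ?L"
          using LU by blast
        \<comment> \<open>If this set were in \<open>?VL\<close>, so would be \<open>Z\<close>; if
          it were in \<open>?V\<close> only, it would come after \<open>Z\<close> by the choice of
          \<open>Z\<close>, against the order of the packet of \<open>?Y\<close> in
          \<open>\<rho>\<close>.\<close>
        have above: "?Y - {x} \<notin> ?V" if x: "x \<in> ?Y" "q < x" for x
        proof
          assume V: "?Y - {x} \<in> ?V"
          show False
          proof (cases "?Y - {x} \<in> ?VL")
            case True
            then show False
              using contraction_closed(2)[OF RL m(1) Y _ x(1) x(2) YL] Z(1) YZ by simp
          next
            case False
            then have "precedes \<rho> Z (?Y - {x})"
              using Z(2) V not_q x by auto
            then show False
              using full_order_precedes(2)[OF \<rho> Y _ x(1) x(2)] \<open>?Y \<notin> U\<close> YZ by simp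
          qed
        qed
        have below: "?Y - {x} \<in> ?V" if x: "x \<in> ?Y" "x < q" for x
          using contraction_closed(2)[OF U m(1) Y x(1) _ x(2) False] Z(1) YZ by simp
        show ?thesis
          using above below False qZ by (intro ex_threshold[OF Y q]) (auto, metis linorder_neqE_nat)
      next
        case True
        have below: "?Y - {x} \<notin> ?V" if x: "x \<in> ?Y" "x < q" for x
        proof
          assume V: "?Y - {x} \<in> ?V"
          show False
          proof (cases "?Y - {x} \<in> ?VL")
            case VL: True
            \<comment> \<open>This makes \<open>contraction_closed\<close> applicable to
              \<open>?L\<close>: were \<open>?Y\<close> a clique instead, no
              \<open>insert (Suc m) (?Y - {x})\<close> could lie in \<open>?L\<close>.\<close>
            have "?Y \<in> ?L"
            proof (rule ccontr)
              assume "?Y \<notin> ?L"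
              then have "clique ?Y"
                using True UM by (auto simp: Mset_def Lset_def)
              then have "insert (Suc m) (?Y - {x}) \<notin> ?L"
                using ksubsetsD(1,3)[OF Y] clique_subset
                by (intro insert_clique_notin_Lset) (auto simp: less_Suc_eq_le)
              then show False
                using VL by (simp add: contraction_def)
            qed
            then show False
              using contraction_closed(1)[OF RL m(1) Y x(1) _ x(2) _ VL] Z(1) YZ by simp
          next
            case False
            then have "precedes \<rho> Z (?Y - {x})"
              using Z(2) V not_q x by auto
            then show False
              using full_order_precedes(1)[OF \<rho> Y x(1) _ x(2) True] YZ by simp
          qed
        qed
        have above: "?Y - {x} \<in> ?V" if x: "x \<in> ?Y" "q < x" for x
          using contraction_closed(1)[OF U m(1) Y _ x(1) x(2) True] Z(1) YZ by simp
        show ?thesis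
          using above below True qZ by (intro ex_threshold[OF Y q]) (auto, metis linorder_neqE_nat)
      qed
    qed
  qed blast
  then show ?thesis
    using X by blast
qed

text \<open>Here the maximum \<open>p\<close> of the added clique comes first in the permutation instead of being the largest
  number: cliques of \<open>Mset n (Suc i)\<close> whose maximum comes earlier are already in \<open>U\<close>, and numbers larger
  than \<open>p\<close> that come later do not form a clique with \<open>p\<close>.\<close>

lemma ex_addable:
  assumes i: "1 \<le> i" and U: "realizable n (Suc i) U"
    and LU: "Lset n (Suc i) \<subseteq> U" and UM: "U \<subseteq> Mset n (Suc i)" and ne: "U \<noteq> Mset n (Suc i)"
  shows "\<exists>X\<in>Mset n (Suc i) - U. realizable n (Suc i) (insert X U)"
proof -
  let ?M = "Mset n (Suc i)"
  let ?P = "{p. \<exists>m Z. p = Suc m \<and> m < n \<and> Z \<in> ksubsets m i \<and> insert (Suc m) Z \<in> ?M - U}"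
  have P_I: "p \<in> ?P" if "0 < p" "p \<le> n" "Z \<in> ksubsets (p - 1) i" "insert p Z \<in> ?M - U" for p Z
    using that by (intro CollectI exI[of _ "p - 1"] exI[of _ Z]) auto
  obtain X0 where X0: "X0 \<in> ?M - U"
    using ne UM by blast
  then have "X0 \<in> ksubsets n (Suc i)"
    using Mset_Lset(5) by blast
  then obtain m0 Z0 where "m0 < n" "Z0 \<in> ksubsets m0 i" "X0 = insert (Suc m0) Z0"
    by (rule ksubsets_decompose)
  then have "Suc m0 \<in> ?P"
    using X0 by blast
  moreover have "finite ?P"
    by (rule finite_subset[of _ "{..n}"]) auto
  ultimately obtain p where p: "p \<in> ?P" "\<forall>q\<in>?P. (p < q \<longrightarrow> {p, q} \<notin> J) \<and> (q < p \<longrightarrow> {q, p} \<in> J)"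
    using ex_first_letter[of ?P] by blast
  then obtain m where m: "m < n" "\<exists>Z\<in>ksubsets m i. insert (Suc m) Z \<in> ?M - U" "p = Suc m"
    by blast
  let ?V = "contraction m i U" and ?VM = "contraction m i ?M"
  obtain \<rho> where \<rho>: "\<rho> \<in> full_orders m i (U \<inter> ksubsets m (Suc i))"
    using ex_full_order[OF realizable_delete[OF U]] m(1) by fastforce
  have "?VM - ?V \<noteq> {}" "?VM - ?V \<subseteq> set \<rho>"
    using m(2) \<rho> by (auto simp: contraction_def full_orders_def permutations_of_set_def)
  then obtain Z where Z: "Z \<in> ?VM - ?V" "\<And>Z'. Z' \<in> ?VM - ?V \<Longrightarrow> Z' \<noteq> Z \<Longrightarrow> precedes \<rho> Z' Z"
    using ex_precedes_last[of "?VM - ?V" \<rho>] by blast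
  let ?X = "insert (Suc m) Z"
  have Zm: "Z \<in> ksubsets m i" "Suc m \<notin> Z"
    using Z(1) Suc_notin_ksubsets by (auto simp: contraction_def)
  have X: "?X \<in> ?M - U"
    using Z(1) by (auto simp: contraction_def)
  then have clX: "clique ?X"
    using LU by (auto simp: Mset_def Lset_def)
  have Xn: "?X \<in> ksubsets n (Suc i)"
    using X Mset_Lset(5) by blast
  have X_le: "c \<le> Suc m" if "c \<in> ?X" for c
    using that Zm(1) by (auto simp: ksubsets_def)
  have "realizable n (Suc i) (insert ?X U)"
  proof (rule realizable_change[OF U _ _ Xn])
    show "insert ?X U \<subseteq> ksubsets n (Suc i)"
      using realizable_subset[OF U] Xn by blast
    fix q assume q: "q \<notin> ?X" and W: "insert q ?X \<in> ksubsets n (Suc (Suc i))"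
    let ?W = "insert q ?X"
    have Wq: "?W - {q} = ?X"
      using q by auto
    have other: "?W - {w} \<in> insert ?X U \<longleftrightarrow> ?W - {w} \<in> U" if "w \<in> ?W" "w \<noteq> q" for w
      using q that by blast
    have qn: "0 < q" "q \<le> n"
      using W by (auto simp: ksubsets_def)
    consider "Suc m < q" "{Suc m, q} \<in> J" | "Suc m < q" "{Suc m, q} \<notin> J" | "q \<le> m"
      using q by fastforce
    then show "\<exists>P. (mono P \<or> antimono P) \<and> (\<forall>w\<in>?W. ?W - {w} \<in> insert ?X U \<longleftrightarrow> P w)"
    proof cases
      case 1
      have clW: "clique ?W"
        using clX X_le 1 by (intro clique_insert_above[of ?X "Suc m"]) auto
      \<comment> \<open>A missing one would put \<open>q\<close> into \<open>?P\<close>; but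
        \<open>{p, q}\<close> in \<open>J\<close> with \<open>p < q\<close> means that
        \<open>q\<close> comes before \<open>p\<close> in the permutation.\<close>
      have "?W - {w} \<in> U" if w: "w \<in> ?W" "w \<noteq> q" for w
      proof (rule ccontr)
        assume wU: "?W - {w} \<notin> U"
        have eq: "?W - {w} = insert q (?X - {w})"
          using w by auto
        have "?W - {w} \<in> ?M"
          using clique_subset[OF clW] ksubsets_remove[OF W w(1)] by (auto simp: Mset_def)
        moreover have "?X - {w} \<in> ksubsets (q - 1) i"
          using ksubsets_remove[OF Xn, of w] w X_le 1 by (fastforce simp: ksubsets_def)
        ultimately have "q \<in> ?P"
          using wU eq qn by (intro P_I[of q "?X - {w}"]) auto
        then show False
          using p(2) m(3) 1 by blast
      qed
      then have "\<forall>w\<in>?W. ?W - {w} \<in> insert ?X U \<longleftrightarrow> True"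
        using Wq by (metis insertCI)
      then show ?thesis
        using thresholds(5)[of True] by blast
    next
      case 2
      have lower: "?W - {w} \<notin> U" if w: "w \<in> Z" for w
      proof -
        have eq: "?W - {w} = insert q (?X - {w})"
          using w q by auto
        have "?W - {w} \<notin> ?M"
          unfolding eq using w Zm(2) X_le 2
          by (intro insert_nonadjacent_notin_Mset[of "Suc m"]) auto
        then show ?thesis
          using UM by blast
      qed
      \<comment> \<open>\<open>Suc m\<close> lies between \<open>q\<close> and some \<open>z\<close>
        in \<open>Z\<close>, whose removals both give sets outside \<open>U\<close>; here
        \<open>1 \<le> i\<close> provides \<open>z\<close>.\<close>
      have middle: "?W - {Suc m} \<notin> U"
      proof -
        obtain z where z: "z \<in> Z"
          using ksubsetsD(2)[OF Zm(1)] i by fastforce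
        then have "z < Suc m"
          using X_le[of z] Zm(2) by (auto simp: le_less)
        then show ?thesis
          using realizable_between[OF U W _ _ _ _ 2(1), of z] z lower[OF z] Wq X by auto
      qed
      have "?W - {w} \<in> insert ?X U \<longleftrightarrow> q \<le> w" if "w \<in> ?W" for w
      proof -
        consider "w = q" | "w = Suc m" | "w \<in> Z"
          using \<open>w \<in> ?W\<close> by blast
        then show ?thesis
        proof cases
          case 1
          then show ?thesis
            using Wq by simp
        next
          case w: 2
          then show ?thesis
            using other[of w] middle 2(1) by simp
        next
          case 3
          then have "w < q" "w \<noteq> q"
            using X_le[of w] 2(1) by auto
          then show ?thesis
            using other[of w] lower 3 by simp
        qed
      qed
      then show ?thesis
        using thresholds(4)[of q] by blast
    next
      case 3
      let ?Y = "insert q Z"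
      have Y: "?Y \<in> ksubsets m (Suc i)"
        using 3 q W ksubsets_insert[OF Zm(1)] by (auto simp: ksubsets_def)
      have qZ: "q \<notin> Z"
        using q by simp
      have YZ: "?Y - {q} = Z"
        using qZ by auto
      have remove: "?W - {w} = insert (Suc m) (?Y - {w})" if "w \<in> ?Y" for w
        using that Zm(2) 3 by auto
      have RM: "realizable n (Suc i) ?M"
        by (rule realizable_Mset)
      have not_q: "?Y - {x} \<noteq> Z" if "x \<in> ?Y" "x \<noteq> q" for x
        using that qZ by blast
      show ?thesis
      proof (cases "?Y \<in> U")
        case False
        \<comment> \<open>If \<open>?Y\<close> is a clique missing from \<open>U\<close>, its
          maximum \<open>l\<close> lies in \<open>?P\<close>. As \<open>p\<close> comes first and
          \<open>l < p\<close>, the pair \<open>{l, p}\<close> is in \<open>J\<close>, so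
          \<open>Suc m\<close> extends the clique.\<close>
        have VM: "?Y - {x} \<in> ?VM" if x: "x \<in> ?Y" "x < q" for x
        proof (cases "?Y \<in> ?M")
          case True
          then have clY: "clique ?Y"
            using LU False by (auto simp: Mset_def Lset_def)
          obtain l where l: "l \<in> ?Y" "\<forall>z\<in>?Y. z \<le> l"
            using ex_greatest[OF ksubsetsD(1)[OF Y]] by blast
          have lm: "0 < l" "l \<le> m"
            using ksubsetsD(3)[OF Y] l(1) by auto
          have "?Y - {l} \<in> ksubsets (l - 1) i"
            using ksubsets_remove[OF Y l(1)] l(2) by (fastforce simp: ksubsets_def)
          moreover have "insert l (?Y - {l}) = ?Y"
            using l(1) by blast
          ultimately have lP: "l \<in> ?P"
            using lm m(1) True False by (intro P_I[of l "?Y - {l}"]) auto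
          then have "{l, Suc m} \<in> J"
            using bspec[OF p(2) lP] m(3) lm(2) by auto
          then have "clique (insert (Suc m) ?Y)"
            using clY l lm by (intro clique_insert_above[of ?Y l]) auto
          then have "clique (?W - {x})"
            by (rule clique_subset) auto
          then show ?thesis
            using remove[OF x(1)] ksubsets_remove[OF Y x(1)] ksubsets_remove[OF W, of x] x
            by (auto simp: contraction_def Mset_def)
        next
          case False
          then show ?thesis
            using contraction_closed(2)[OF RM m(1) Y x(1) _ x(2)] Z(1) YZ by simp
        qed
        have above: "?Y - {x} \<notin> ?V" if x: "x \<in> ?Y" "q < x" for x
          using contraction_closed(2)[OF U m(1) Y _ x(1) x(2) False] Z(1) YZ by auto
        have below: "?Y - {x} \<in> ?V" if x: "x \<in> ?Y" "x < q" for x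
        proof (rule ccontr)
          assume "?Y - {x} \<notin> ?V"
          then have "precedes \<rho> (?Y - {x}) Z"
            using Z(2) VM[OF x] not_q x by auto
          then show False
            using full_order_precedes(2)[OF \<rho> Y x(1) _ x(2) False] YZ by simp
        qed
        show ?thesis
          using above below False qZ by (intro ex_threshold[OF Y q]) (auto, metis linorder_neqE_nat)
      next
        case True
        then have YM: "?Y \<in> ?M"
          using UM by blast
        have below: "?Y - {x} \<notin> ?V" if x: "x \<in> ?Y" "x < q" for x
          using contraction_closed(1)[OF U m(1) Y x(1) _ x(2) True] Z(1) YZ by auto
        have above: "?Y - {x} \<in> ?V" if x: "x \<in> ?Y" "q < x" for x
        proof (rule ccontr)
          assume "?Y - {x} \<notin> ?V"
          moreover have "?Y - {x} \<in> ?VM"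
            using contraction_closed(1)[OF RM m(1) Y _ x(1) x(2) YM] Z(1) YZ by simp
          ultimately have "precedes \<rho> (?Y - {x}) Z"
            using Z(2) not_q x by auto
          then show False
            using full_order_precedes(1)[OF \<rho> Y _ x(1) x(2) True] YZ by simp
        qed
        show ?thesis
          using above below True qZ by (intro ex_threshold[OF Y q]) (auto, metis linorder_neqE_nat)
      qed
    qed
  qed blast
  then show ?thesis
    using X by blast
qed

end

section \<open>Admissible orders and their classes\<close>

lemma permutationsD:
  assumes "\<rho> \<in> permutations_of_set A"
  shows "set \<rho> = A" "distinct \<rho>"
  using assms by (auto simp: permutations_of_set_def)

lemma sorted_restr_iff:
  assumes \<rho>: "\<rho> \<in> permutations_of_set A" and X: "X \<in> ksubsets n (Suc k)"
  shows "sorted_wrt lex_less (restr_order n k X \<rho>) \<longleftrightarrow>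
      (\<forall>x\<in>X. \<forall>y\<in>X. x < y \<longrightarrow> X - {x} \<in> A \<longrightarrow> X - {y} \<in> A \<longrightarrow> precedes \<rho> (X - {y}) (X - {x}))"
    and "sorted_wrt antilex_less (restr_order n k X \<rho>) \<longleftrightarrow>
      (\<forall>x\<in>X. \<forall>y\<in>X. x < y \<longrightarrow> X - {x} \<in> A \<longrightarrow> X - {y} \<in> A \<longrightarrow> precedes \<rho> (X - {x}) (X - {y}))"
proof -
  note set = permutationsD[OF \<rho>]
  have sorted: "sorted_wrt R (restr_order n k X \<rho>) \<longleftrightarrow>
      (\<forall>x\<in>X. \<forall>y\<in>X. precedes \<rho> (X - {x}) (X - {y}) \<longrightarrow> R (X - {x}) (X - {y}))" for R
    unfolding restr_order_def sorted_wrt_iff_precedes precedes_filter packet_eq[OF X] by blast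
  have lex: "lex_less (X - {y}) (X - {x}) \<longleftrightarrow> x < y" if "x \<in> X" "y \<in> X" for x y
    using lex_less_remove_iff ksubsetsD(1)[OF X] that by blast
  have tot: "precedes \<rho> (X - {x}) (X - {y}) \<longleftrightarrow> X - {x} \<in> A \<and> X - {y} \<in> A \<and> \<not> precedes \<rho> (X - {y}) (X - {x})"
    if "x \<in> X" "y \<in> X" "x \<noteq> y" for x y
  proof -
    have "X - {x} \<noteq> X - {y}"
      using that by blast
    then show ?thesis
      using precedes_total[of "X - {x}" \<rho> "X - {y}"] precedes_in_set[of \<rho> "X - {x}" "X - {y}"]
        precedes_asym[OF set(2), of "X - {x}" "X - {y}"] unfolding set(1) by blast
  qed
  show "sorted_wrt lex_less (restr_order n k X \<rho>) \<longleftrightarrow>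
      (\<forall>x\<in>X. \<forall>y\<in>X. x < y \<longrightarrow> X - {x} \<in> A \<longrightarrow> X - {y} \<in> A \<longrightarrow> precedes \<rho> (X - {y}) (X - {x}))"
    unfolding sorted using tot lex precedes_irrefl[OF set(2)]
    by (metis linorder_neqE_nat order_less_imp_not_less)
  show "sorted_wrt antilex_less (restr_order n k X \<rho>) \<longleftrightarrow>
      (\<forall>x\<in>X. \<forall>y\<in>X. x < y \<longrightarrow> X - {x} \<in> A \<longrightarrow> X - {y} \<in> A \<longrightarrow> precedes \<rho> (X - {x}) (X - {y}))"
    unfolding sorted antilex_less_def using tot lex precedes_irrefl[OF set(2)]
    by (metis linorder_neqE_nat order_less_imp_not_less)
qed

lemma parts_cases:
  assumes A: "realizable n k A" and X: "X \<in> ksubsets n (Suc k)" and x: "x \<in> X" "X - {x} \<in> A"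
  obtains "X \<in> suffix_part n k A" | "X \<in> prefix_part n k A" | "X \<in> full_part n k A"
proof (cases "\<forall>x\<in>X. X - {x} \<in> A")
  case True
  then show ?thesis
    using that(3) full_part_iff[OF X] by blast
next
  case False
  then show ?thesis
    using A X x that(1,2) lex_prefix_iff[OF X] lex_suffix_iff[OF X]
    unfolding realizable_def suffix_part_iff[OF X] prefix_part_iff[OF X] by blast
qed

lemma parts_disjoint:
  "full_part n k A \<inter> prefix_part n k A = {}" "full_part n k A \<inter> suffix_part n k A = {}"
proof -
  have "X \<notin> prefix_part n k A \<and> X \<notin> suffix_part n k A" if "X \<in> full_part n k A" for X
  proof -
    have X: "X \<in> ksubsets n (Suc k)"
      using that parts_subset(3) by blast
    then show ?thesis
      using that by (simp add: full_part_iff prefix_part_iff suffix_part_iff)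
  qed
  then show "full_part n k A \<inter> prefix_part n k A = {}" "full_part n k A \<inter> suffix_part n k A = {}"
    by blast+
qed

lemma admissibleD:
  assumes "\<rho> \<in> admissible_orders n k A"
  shows "\<rho> \<in> permutations_of_set A" "set \<rho> = A" "distinct \<rho>"
  using assms by (auto simp: admissible_orders_def permutations_of_set_def)

text \<open>By realizability of \<open>A\<close>, a packet that meets \<open>A\<close> and is not
  inverted is met in a prefix or completely, and so is in lexicographic order.\<close>

lemma admissible_oriented:
  assumes A: "realizable n k A" and \<rho>: "\<rho> \<in> admissible_orders n k A"
  shows "oriented n k A (inv_set n k A \<rho>) \<rho>"
proof (rule orientedI)
  fix X x y
  assume X: "X \<in> ksubsets n (Suc k)" and xy: "x \<in> X" "y \<in> X" "x < y" "X - {x} \<in> A" "X - {y} \<in> A"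
  note sorted = sorted_restr_iff[OF admissibleD(1)[OF \<rho>] X]
  show "precedes \<rho> (X - {x}) (X - {y})" if "X \<in> inv_set n k A \<rho>"
  proof -
    have "sorted_wrt antilex_less (restr_order n k X \<rho>)"
      using that \<rho> by (auto simp: inv_set_def admissible_orders_def)
    then show ?thesis
      using sorted(2) xy by blast
  qed
  show "precedes \<rho> (X - {y}) (X - {x})" if "X \<notin> inv_set n k A \<rho>"
  proof -
    have "sorted_wrt lex_less (restr_order n k X \<rho>)"
      using parts_cases[OF A X xy(1,4)] that \<rho> by (auto simp: inv_set_def admissible_orders_def)
    then show ?thesis
      using sorted(1) xy by blast
  qed
qed

lemma ex_two_elements:
  assumes "X \<in> ksubsets n (Suc k)" "1 \<le> k"
  obtains x y where "x \<in> X" "y \<in> X" "x < y"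
proof -
  have "\<exists>x\<in>X. \<exists>y\<in>X. x \<noteq> y"
    using ksubsetsD(2)[OF assms(1)] assms(2) by (metis card_le_Suc0_iff_eq card.infinite
        less_Suc_eq_le not_less_eq_eq numeral_nat(7) zero_neq_one le_numeral_extra(3) nat.simps(3))
  then show thesis
    using that by (metis linorder_neqE_nat)
qed

lemma oriented_admissible:
  assumes \<rho>: "\<rho> \<in> permutations_of_set A" and or: "oriented n k A U \<rho>" and k: "1 \<le> k"
    and suf: "suffix_part n k A \<subseteq> U" and pre: "prefix_part n k A \<inter> U = {}"
  shows "\<rho> \<in> admissible_orders n k A" "inv_set n k A \<rho> = suffix_part n k A \<union> full_part n k A \<inter> U"
proof -
  have antilex: "sorted_wrt antilex_less (restr_order n k X \<rho>)" if "X \<in> ksubsets n (Suc k)" "X \<in> U" for X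
    unfolding sorted_restr_iff(2)[OF \<rho> that(1)] using orientedD(1)[OF or that(1)] that(2) by blast
  have lex: "sorted_wrt lex_less (restr_order n k X \<rho>)" if "X \<in> ksubsets n (Suc k)" "X \<notin> U" for X
    unfolding sorted_restr_iff(1)[OF \<rho> that(1)] using orientedD(2)[OF or that(1)] that(2) by blast
  show "\<rho> \<in> admissible_orders n k A"
    unfolding admissible_orders_def using \<rho> antilex lex suf pre parts_subset[of n k A] by blast
  have "X \<in> U" if X: "X \<in> full_part n k A" and sorted: "sorted_wrt antilex_less (restr_order n k X \<rho>)" for X
  proof (rule ccontr)
    assume U: "X \<notin> U"
    have Xk: "X \<in> ksubsets n (Suc k)"
      using X parts_subset(3) by blast
    \<comment> \<open>A one-element packet would be sorted both ways; \<open>1 \<le> k\<close>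
      supplies two members.\<close>
    obtain x y where xy: "x \<in> X" "y \<in> X" "x < y"
      using ex_two_elements[OF Xk k] .
    have "X - {x} \<in> A" "X - {y} \<in> A"
      using X xy full_part_iff[OF Xk] by auto
    then have "precedes \<rho> (X - {x}) (X - {y})" "precedes \<rho> (X - {y}) (X - {x})"
      using sorted xy orientedD(2)[OF or Xk xy _ _ U] unfolding sorted_restr_iff(2)[OF \<rho> Xk] by auto
    then show False
      using precedes_asym[OF permutationsD(2)[OF \<rho>]] by blast
  qed
  then show "inv_set n k A \<rho> = suffix_part n k A \<union> full_part n k A \<inter> U"
    unfolding inv_set_def using antilex parts_subset(3)[of n k A] by blast
qed

lemma restr_order_cong:
  assumes "\<And>X. X \<in> ksubsets n (Suc k) \<Longrightarrow> restr_order n k X \<rho> = restr_order n k X \<rho>'"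
    and "\<rho> \<in> admissible_orders n k A" "\<rho>' \<in> permutations_of_set A"
  shows "\<rho>' \<in> admissible_orders n k A" "inv_set n k A \<rho>' = inv_set n k A \<rho>"
proof -
  have "\<forall>X\<in>suffix_part n k A. restr_order n k X \<rho>' = restr_order n k X \<rho>"
    "\<forall>X\<in>prefix_part n k A. restr_order n k X \<rho>' = restr_order n k X \<rho>"
    "\<forall>X\<in>full_part n k A. restr_order n k X \<rho>' = restr_order n k X \<rho>"
    using assms(1) parts_subset[of n k A] by (metis subsetD)+
  then show "\<rho>' \<in> admissible_orders n k A" "inv_set n k A \<rho>' = inv_set n k A \<rho>"
    using assms(2,3) by (simp_all add: admissible_orders_def inv_set_def cong: conj_cong)
qed

section \<open>Equivalence classes as fibres of the inversion set\<close>

definition same_packet :: "nat \<Rightarrow> nat \<Rightarrow> nat set \<Rightarrow> nat set \<Rightarrow> bool" where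
  "same_packet n k Y Z \<longleftrightarrow> (\<exists>X\<in>ksubsets n (Suc k). Y \<in> packet n k X \<and> Z \<in> packet n k X)"

lemma elem_equiv_iff:
  "elem_equiv n k A \<rho> \<rho>' \<longleftrightarrow> \<rho> \<in> admissible_orders n k A \<and> \<rho>' \<in> admissible_orders n k A \<and>
     swap_step (same_packet n k) \<rho> \<rho>'"
  by (auto simp: elem_equiv_def swap_step_def same_packet_def)

lemma swap_step_admissible:
  assumes "swap_step (same_packet n k) \<rho> \<rho>'" "\<rho> \<in> admissible_orders n k A"
  shows "\<rho>' \<in> admissible_orders n k A" "inv_set n k A \<rho>' = inv_set n k A \<rho>"
proof -
  obtain us Y Z vs where eq: "\<rho> = us @ Y # Z # vs" "\<rho>' = us @ Z # Y # vs" "\<not> same_packet n k Y Z"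
    using assms(1) unfolding swap_step_def by blast
  have "restr_order n k X \<rho> = restr_order n k X \<rho>'" if "X \<in> ksubsets n (Suc k)" for X
    using that eq(3) by (auto simp: restr_order_def eq(1,2) same_packet_def)
  moreover have "\<rho>' \<in> permutations_of_set A"
    using admissibleD[OF assms(2)] by (auto simp: permutations_of_set_def eq)
  ultimately show "\<rho>' \<in> admissible_orders n k A" "inv_set n k A \<rho>' = inv_set n k A \<rho>"
    using restr_order_cong assms(2) by blast+
qed

lemma swap_steps_equiv:
  assumes "(swap_step (same_packet n k))\<^sup>*\<^sup>* \<rho> \<rho>'" "\<rho> \<in> admissible_orders n k A"
  shows "equivclp (elem_equiv n k A) \<rho> \<rho>' \<and> \<rho>' \<in> admissible_orders n k A"
  using assms(1)
proof (induction rule: rtranclp_induct)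
  case base
  then show ?case
    using assms(2) by simp
next
  case (step \<sigma> \<sigma>')
  then have "elem_equiv n k A \<sigma> \<sigma>'"
    unfolding elem_equiv_iff using swap_step_admissible(1) by blast
  then show ?case
    using step.IH elem_equiv_iff by (metis equivclp_trans r_into_equivclp)
qed

lemma equivclp_inv_set:
  "equivclp (elem_equiv n k A) \<rho> \<rho>' \<Longrightarrow> inv_set n k A \<rho> = inv_set n k A \<rho>'"
proof (induction rule: equivclp_induct)
  case (step \<sigma> \<sigma>')
  then show ?case
    unfolding elem_equiv_iff using swap_step_admissible(2) by metis
qed simp

text \<open>Two orders oriented by the same set agree on every pair in a common packet, so sorting
  one into the other never swaps such a pair.\<close>

lemma order_equiv_iff:
  assumes A: "realizable n k A"
  shows "(\<rho>, \<rho>') \<in> order_equiv n k A \<longleftrightarrow> \<rho> \<in> admissible_orders n k A \<and>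
    \<rho>' \<in> admissible_orders n k A \<and> inv_set n k A \<rho> = inv_set n k A \<rho>'"
proof
  assume "(\<rho>, \<rho>') \<in> order_equiv n k A"
  then show "\<rho> \<in> admissible_orders n k A \<and>
      \<rho>' \<in> admissible_orders n k A \<and> inv_set n k A \<rho> = inv_set n k A \<rho>'"
    unfolding order_equiv_def using equivclp_inv_set by blast
next
  assume *: "\<rho> \<in> admissible_orders n k A \<and>
    \<rho>' \<in> admissible_orders n k A \<and> inv_set n k A \<rho> = inv_set n k A \<rho>'"
  then have or: "oriented n k A (inv_set n k A \<rho>) \<rho>" "oriented n k A (inv_set n k A \<rho>) \<rho>'"
    using admissible_oriented[OF A] by metis+
  have dist: "distinct \<rho>" "distinct \<rho>'" "set \<rho> = set \<rho>'" "set \<rho> = A"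
    using * admissibleD(2,3)[of \<rho> n k A] admissibleD(2,3)[of \<rho>' n k A] by simp_all
  have "precedes \<rho>' a b" if ab: "same_packet n k a b" "precedes \<rho> a b" for a b
  proof -
    obtain X where X: "X \<in> ksubsets n (Suc k)" "a \<in> packet n k X" "b \<in> packet n k X"
      using ab(1) unfolding same_packet_def by blast
    then obtain x y where xy: "x \<in> X" "y \<in> X" "a = X - {x}" "b = X - {y}"
      by (auto simp: packet_eq)
    have "x \<noteq> y"
      using xy ab(2) precedes_irrefl[OF dist(1)] by blast
    moreover have A: "X - {x} \<in> A" "X - {y} \<in> A"
      using precedes_in_set[OF ab(2)] dist(4) xy by blast+
    moreover have "\<not> precedes \<rho> (X - {y}) (X - {x})"
      using ab(2) precedes_asym[OF dist(1)] xy by blast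
    ultimately show ?thesis
      unfolding xy(3,4)
      using orientedD[OF or(1) X(1) xy(1,2) _ A] orientedD[OF or(2) X(1) xy(1,2) _ A]
        orientedD[OF or(1) X(1) xy(2,1) _ A(2,1)] orientedD[OF or(2) X(1) xy(2,1) _ A(2,1)]
      by (cases x y rule: linorder_cases) blast+
  qed
  then have "(swap_step (same_packet n k))\<^sup>*\<^sup>* \<rho> \<rho>'"
    using swap_steps_if_precedes dist by metis
  then show "(\<rho>, \<rho>') \<in> order_equiv n k A"
    using * swap_steps_equiv unfolding order_equiv_def by blast
qed

definition inv_fibre :: "nat \<Rightarrow> nat \<Rightarrow> nat set set \<Rightarrow> nat set set \<Rightarrow> nat set list set" where
  "inv_fibre n k A U = {\<rho> \<in> admissible_orders n k A. inv_set n k A \<rho> = U}"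

lemma order_equiv_class:
  "realizable n k A \<Longrightarrow> \<rho> \<in> admissible_orders n k A \<Longrightarrow>
    order_equiv n k A `` {\<rho>} = inv_fibre n k A (inv_set n k A \<rho>)"
  by (auto simp: order_equiv_iff inv_fibre_def)

lemma order_classes_iff:
  "realizable n k A \<Longrightarrow>
    r \<in> order_classes n k A \<longleftrightarrow> (\<exists>\<rho>\<in>admissible_orders n k A. r = inv_fibre n k A (inv_set n k A \<rho>))"
  unfolding order_classes_def quotient_def by (auto simp: order_equiv_class)

lemma inv_class_fibre:
  "\<rho> \<in> inv_fibre n k A U \<Longrightarrow> inv_class n k A (inv_fibre n k A U) = U"
proof -
  assume "\<rho> \<in> inv_fibre n k A U"
  then have "inv_set n k A ` inv_fibre n k A U = {U}"
    by (auto simp: inv_fibre_def)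
  then show ?thesis
    by (simp add: inv_class_def)
qed

lemma order_classD:
  assumes "realizable n k A" "r \<in> order_classes n k A"
  shows "r = inv_fibre n k A (inv_class n k A r)" "r \<noteq> {}"
    and "\<rho> \<in> r \<Longrightarrow> \<rho> \<in> admissible_orders n k A \<and> inv_set n k A \<rho> = inv_class n k A r"
proof -
  obtain \<sigma> where \<sigma>: "\<sigma> \<in> admissible_orders n k A" "r = inv_fibre n k A (inv_set n k A \<sigma>)"
    using assms order_classes_iff by blast
  then have "\<sigma> \<in> r"
    by (simp add: inv_fibre_def)
  then have "inv_class n k A r = inv_set n k A \<sigma>"
    using inv_class_fibre \<sigma> by metis
  then show "r = inv_fibre n k A (inv_class n k A r)" "r \<noteq> {}"
    "\<rho> \<in> r \<Longrightarrow> \<rho> \<in> admissible_orders n k A \<and> inv_set n k A \<rho> = inv_class n k A r"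
    using \<sigma> \<open>\<sigma> \<in> r\<close> by (auto simp: inv_fibre_def)
qed

lemma fibre_order_class:
  "realizable n k A \<Longrightarrow> \<rho> \<in> inv_fibre n k A U \<Longrightarrow> inv_fibre n k A U \<in> order_classes n k A"
  by (auto simp: order_classes_iff inv_fibre_def)

section \<open>Packet flips\<close>

lemma packets_meet_once:
  assumes X: "X \<in> ksubsets n (Suc k)" and X': "X' \<in> ksubsets n (Suc k)" and "X \<noteq> X'"
    and Y: "Y \<in> packet n k X" "Y \<in> packet n k X'" and Z: "Z \<in> packet n k X" "Z \<in> packet n k X'"
  shows "Y = Z"
proof (rule ccontr)
  assume ne: "Y \<noteq> Z"
  have union: "W = Y \<union> Z" if "W \<in> ksubsets n (Suc k)" "Y \<in> packet n k W" "Z \<in> packet n k W" for W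
  proof -
    obtain y z where "y \<in> W" "z \<in> W" "Y = W - {y}" "Z = W - {z}"
      using \<open>Y \<in> packet n k W\<close> \<open>Z \<in> packet n k W\<close> packet_eq[OF \<open>W \<in> ksubsets n (Suc k)\<close>] by auto
    then show ?thesis
      using ne by auto
  qed
  show False
    using union[OF X Y(1) Z(1)] union[OF X' Y(2) Z(2)] assms(3) by simp
qed

lemma rev_eq_self:
  assumes "distinct xs" "\<And>x y. x \<in> set xs \<Longrightarrow> y \<in> set xs \<Longrightarrow> x = y"
  shows "rev xs = xs"
proof (cases xs)
  case (Cons x ys)
  then have "y = x" if "y \<in> set ys" for y
    using assms(2)[of y x] that by simp
  moreover have "x \<notin> set ys"
    using assms(1) Cons by simp
  ultimately have "set ys = {}"
    by (metis equals0I)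
  then show ?thesis
    using Cons by simp
qed simp

text \<open>Two different members of a packet have its set as their union, so any other packet has
  at most one member in the block and does not notice the reversal.\<close>

lemma flip_block:
  assumes \<rho>: "us @ ps @ vs \<in> admissible_orders n k A" and ps: "set ps = packet n k X"
    and X: "X \<in> full_part n k A" "X \<notin> inv_set n k A (us @ ps @ vs)" and k: "1 \<le> k"
  shows "us @ rev ps @ vs \<in> admissible_orders n k A"
    and "inv_set n k A (us @ rev ps @ vs) = insert X (inv_set n k A (us @ ps @ vs))"
proof -
  let ?\<rho> = "us @ ps @ vs" and ?\<rho>' = "us @ rev ps @ vs"
  have Xk: "X \<in> ksubsets n (Suc k)"
    using X(1) parts_subset(3) by blast
  have same: "restr_order n k X' ?\<rho>' = restr_order n k X' ?\<rho>" if X': "X' \<in> ksubsets n (Suc k)" "X' \<noteq> X" for X'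
  proof -
    let ?qs = "filter (\<lambda>Y. Y \<in> packet n k X') ps"
    have "Y = Z" if "Y \<in> set ?qs" "Z \<in> set ?qs" for Y Z
      using packets_meet_once[OF Xk X'(1) X'(2)[symmetric], of Y Z] that unfolding ps[symmetric] by simp
    moreover have "distinct ?qs"
      using admissibleD(3)[OF \<rho>] by simp
    ultimately have "rev ?qs = ?qs"
      by (intro rev_eq_self) blast+
    then show ?thesis
      by (simp add: restr_order_def rev_filter)
  qed
  have outside: "filter (\<lambda>Y. Y \<in> packet n k X) us = []" "filter (\<lambda>Y. Y \<in> packet n k X) vs = []"
    using admissibleD(3)[OF \<rho>] unfolding ps[symmetric] by (auto simp: filter_empty_conv)
  have inside: "filter (\<lambda>Y. Y \<in> packet n k X) ps = ps"
    unfolding ps[symmetric] by (auto simp: filter_id_conv)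
  have restr: "restr_order n k X ?\<rho> = ps" "restr_order n k X ?\<rho>' = rev ps"
    using inside outside by (auto simp: restr_order_def rev_filter[symmetric])
  have "sorted_wrt lex_less ps"
    using \<rho> X restr(1) by (auto simp: admissible_orders_def inv_set_def)
  then have sorted: "sorted_wrt antilex_less (restr_order n k X ?\<rho>')"
    unfolding restr(2) by (simp add: sorted_wrt_rev antilex_less_def[abs_def])
  have notin: "X \<notin> suffix_part n k A" "X \<notin> prefix_part n k A"
    using X(1) parts_disjoint[of n k A] by blast+
  have perm: "?\<rho>' \<in> permutations_of_set A"
    using admissibleD[OF \<rho>] by (auto simp: permutations_of_set_def)
  have same': "restr_order n k X' ?\<rho>' = restr_order n k X' ?\<rho>"
    if "X' \<in> suffix_part n k A \<or> X' \<in> prefix_part n k A \<or> X' \<in> full_part n k A" "X' \<noteq> X" for X'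
    using same that parts_subset[of n k A] by blast
  show "?\<rho>' \<in> admissible_orders n k A"
    unfolding admissible_orders_def
  proof (intro CollectI conjI ballI)
    fix X' assume "X' \<in> suffix_part n k A"
    then show "sorted_wrt antilex_less (restr_order n k X' ?\<rho>')"
      using same'[of X'] notin \<rho> unfolding admissible_orders_def by (cases "X' = X") auto
  next
    fix X' assume "X' \<in> prefix_part n k A"
    then show "sorted_wrt lex_less (restr_order n k X' ?\<rho>')"
      using same'[of X'] notin \<rho> unfolding admissible_orders_def by (cases "X' = X") auto
  next
    fix X' assume "X' \<in> full_part n k A"
    then show "sorted_wrt lex_less (restr_order n k X' ?\<rho>') \<or> sorted_wrt antilex_less (restr_order n k X' ?\<rho>')"
      using same'[of X'] sorted \<rho> unfolding admissible_orders_def by (cases "X' = X") auto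
  qed (rule perm)
  have "sorted_wrt antilex_less (restr_order n k X' ?\<rho>') \<longleftrightarrow>
      X' = X \<or> sorted_wrt antilex_less (restr_order n k X' ?\<rho>)" if "X' \<in> full_part n k A" for X'
    using same'[of X'] sorted that by (cases "X' = X") auto
  then show "inv_set n k A ?\<rho>' = insert X (inv_set n k A ?\<rho>)"
    using X(1) unfolding inv_set_def by blast
qed

lemma packet_flip_inv_class:
  assumes A: "realizable n k A" and "1 \<le> k" and flip: "packet_flip n k A X r r'" "X \<notin> inv_class n k A r"
  shows "inv_class n k A r' = insert X (inv_class n k A r)"
proof -
  obtain us ps vs where *: "X \<in> full_part n k A" "r \<in> order_classes n k A" "r' \<in> order_classes n k A"
    "us @ ps @ vs \<in> r" "set ps = packet n k X" "us @ rev ps @ vs \<in> r'"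
    using flip(1) unfolding packet_flip_def by blast
  have "us @ ps @ vs \<in> admissible_orders n k A" "inv_set n k A (us @ ps @ vs) = inv_class n k A r"
    "inv_set n k A (us @ rev ps @ vs) = inv_class n k A r'"
    using order_classD(3)[OF A] * by blast+
  then show ?thesis
    using flip_block(2)[OF _ *(5,1)] assms(2) flip(2) by metis
qed

section \<open>Orders of all sets and their restrictions\<close>

lemma full_orders_restrict:
  assumes "\<rho> \<in> full_orders n k U" "A \<subseteq> ksubsets n k"
  shows "filter (\<lambda>Y. Y \<in> A) \<rho> \<in> permutations_of_set A" "oriented n k A U (filter (\<lambda>Y. Y \<in> A) \<rho>)"
proof -
  show "filter (\<lambda>Y. Y \<in> A) \<rho> \<in> permutations_of_set A"
    using assms by (auto simp: full_orders_def permutations_of_set_def)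
  show "oriented n k A U (filter (\<lambda>Y. Y \<in> A) \<rho>)"
  proof (rule orientedI)
    fix X x y
    assume X: "X \<in> ksubsets n (Suc k)" "x \<in> X" "y \<in> X" "x < y" and A: "X - {x} \<in> A" "X - {y} \<in> A"
    have or: "oriented n k (ksubsets n k) U \<rho>"
      using assms(1) by (simp add: full_orders_def)
    note P = orientedD[OF or X ksubsets_remove[OF X(1,2)] ksubsets_remove[OF X(1,3)]]
    show "X \<in> U \<Longrightarrow> precedes (filter (\<lambda>Y. Y \<in> A) \<rho>) (X - {x}) (X - {y})"
      "X \<notin> U \<Longrightarrow> precedes (filter (\<lambda>Y. Y \<in> A) \<rho>) (X - {y}) (X - {x})"
      using P A by (simp_all add: precedes_filter)
  qed
qed

text \<open>Three packets \<open>P\<^bsub>X-a\<^esub>, P\<^bsub>X-b\<^esub>, P\<^bsub>X-c\<^esub>\<close> meet pairwise, and a non-monotone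
  pattern of orientations would be a cycle through the three common elements.\<close>

lemma realizable_inversions:
  assumes U: "U \<subseteq> ksubsets n (Suc k)" and \<rho>: "\<rho> \<in> full_orders n k U"
  shows "realizable n (Suc k) U"
proof (rule realizableI[OF U])
  have dist: "distinct \<rho>" and or: "oriented n k (ksubsets n k) U \<rho>"
    using \<rho> by (auto simp: full_orders_def permutations_of_set_def)
  fix X a b c
  assume X: "X \<in> ksubsets n (Suc (Suc k))" and abc: "a \<in> X" "b \<in> X" "c \<in> X" "a < b" "b < c"
    and eq: "X - {a} \<in> U \<longleftrightarrow> X - {c} \<in> U"
  have step: "(X - {x} \<in> U \<longrightarrow> precedes \<rho> (X - {x, y}) (X - {x, z})) \<and>
      (X - {x} \<notin> U \<longrightarrow> precedes \<rho> (X - {x, z}) (X - {x, y}))"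
    if "x \<in> X" "y \<in> X" "z \<in> X" "x \<noteq> y" "x \<noteq> z" "y < z" for x y z
  proof -
    have Xx: "X - {x} \<in> ksubsets n (Suc k)" and yz: "y \<in> X - {x}" "z \<in> X - {x}"
      using that X by (auto intro: ksubsets_remove)
    have "X - {x} - {y} = X - {x, y}" "X - {x} - {z} = X - {x, z}"
      by auto
    then show ?thesis
      using orientedD[OF or Xx yz that(6) ksubsets_remove[OF Xx yz(1)] ksubsets_remove[OF Xx yz(2)]]
      by simp
  qed
  have comm: "X - {b, a} = X - {a, b}" "X - {c, a} = X - {a, c}" "X - {c, b} = X - {b, c}"
    by auto
  have "a < c" "a \<noteq> b" "a \<noteq> c" "b \<noteq> c"
    using abc by auto
  note steps = step[of a b c, OF abc(1,2,3) \<open>a \<noteq> b\<close> \<open>a \<noteq> c\<close> abc(5)]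
    step[of b a c, OF abc(2,1,3) \<open>a \<noteq> b\<close>[symmetric] \<open>b \<noteq> c\<close> \<open>a < c\<close>, unfolded comm]
    step[of c a b, OF abc(3,1,2) \<open>a \<noteq> c\<close>[symmetric] \<open>b \<noteq> c\<close>[symmetric] abc(4), unfolded comm]
  have no_cycle: "\<not> (precedes \<rho> P Q \<and> precedes \<rho> Q R \<and> precedes \<rho> R P)" for P Q R
    using precedes_trans[OF dist] precedes_asym[OF dist] by blast
  show "X - {b} \<in> U \<longleftrightarrow> X - {a} \<in> U"
  proof (cases "X - {a} \<in> U")
    case True
    then show ?thesis
      using steps eq no_cycle[of "X - {a, b}" "X - {a, c}" "X - {b, c}"] by blast
  next
    case False
    then show ?thesis
      using steps eq no_cycle[of "X - {a, b}" "X - {b, c}" "X - {a, c}"] by blast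
  qed
qed

lemma filter_partition_if_precedes:
  assumes "distinct xs" "\<And>a b. a \<in> set xs \<Longrightarrow> b \<in> set xs \<Longrightarrow> P a \<Longrightarrow> \<not> P b \<Longrightarrow> precedes xs a b"
  shows "xs = filter P xs @ filter (\<lambda>x. \<not> P x) xs"
  using assms
proof (induction xs)
  case (Cons x xs)
  show ?case
  proof (cases "P x")
    case True
    have "precedes xs a b" if "a \<in> set xs" "b \<in> set xs" "P a" "\<not> P b" for a b
      using Cons.prems(2)[of a b] that Cons.prems(1) by auto
    then show ?thesis
      using True Cons.IH Cons.prems(1) by simp
  next
    case False
    have "\<not> P a" if "a \<in> set xs" for a
      using Cons.prems(2)[of a x] that False Cons.prems(1) precedes_in_set[of xs a x] by auto
    then show ?thesis
      using False by (simp add: filter_empty_conv filter_id_conv)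
  qed
qed simp

lemma prefix_suffix_disjoint: "prefix_part n k A \<inter> suffix_part n k A = {}"
proof -
  have "X \<notin> suffix_part n k A" if "X \<in> prefix_part n k A" for X
  proof -
    have X: "X \<in> ksubsets n (Suc k)"
      using that parts_subset(2) by blast
    show ?thesis
      using that unfolding prefix_part_iff[OF X] suffix_part_iff[OF X] by (metis linorder_neqE_nat)
  qed
  then show ?thesis
    by blast
qed

lemma greatest_notin_suffix:
  assumes "X \<in> suffix_part n k A" "l \<in> X" "\<forall>z\<in>X. z \<le> l"
  shows "X - {l} \<notin> A"
proof -
  have X: "X \<in> ksubsets n (Suc k)"
    using assms(1) parts_subset(1) by blast
  show ?thesis
    using assms unfolding suffix_part_iff[OF X] by (metis le_neq_implies_less)
qed

lemma least_notin_prefix: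
  assumes "X \<in> prefix_part n k A" "l \<in> X" "\<forall>z\<in>X. l \<le> z"
  shows "X - {l} \<notin> A"
proof -
  have X: "X \<in> ksubsets n (Suc k)"
    using assms(1) parts_subset(2) by blast
  show ?thesis
    using assms unfolding prefix_part_iff[OF X] by (metis le_neq_implies_less)
qed

lemma suffixD: "X \<in> suffix_part n k A \<Longrightarrow> x \<in> X \<Longrightarrow> y \<in> X \<Longrightarrow> x < y \<Longrightarrow> X - {y} \<in> A \<Longrightarrow> X - {x} \<in> A"
  using parts_subset(1)[of n k A] suffix_part_iff[of X n k A] by blast

lemma prefixD: "X \<in> prefix_part n k A \<Longrightarrow> x \<in> X \<Longrightarrow> y \<in> X \<Longrightarrow> x < y \<Longrightarrow> X - {x} \<in> A \<Longrightarrow> X - {y} \<in> A"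
  using parts_subset(2)[of n k A] prefix_part_iff[of X n k A] by blast

lemma fullD: "X \<in> full_part n k A \<Longrightarrow> x \<in> X \<Longrightarrow> X - {x} \<in> A"
  using parts_subset(3)[of n k A] full_part_iff[of X n k A] by blast

section \<open>The poset as an interval of realizable sets\<close>

context pair_set
begin

definition L_first :: "nat \<Rightarrow> nat \<Rightarrow> nat set list \<Rightarrow> bool" where
  "L_first n i \<rho> \<longleftrightarrow> (\<forall>a\<in>Lset n i. \<forall>b\<in>cliques n i. precedes \<rho> a b)"

definition intermediate :: "nat \<Rightarrow> nat \<Rightarrow> nat set set \<Rightarrow> bool" where
  "intermediate n k U \<longleftrightarrow> realizable n k U \<and> Lset n k \<subseteq> U \<and> U \<subseteq> Mset n k"

lemma intermediate_Lset: "intermediate n k (Lset n k)"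
  and intermediate_Mset: "intermediate n k (Mset n k)"
  using realizable_Lset realizable_Mset Mset_Lset(1) by (auto simp: intermediate_def)

lemma cliques_full: "2 \<le> i \<Longrightarrow> cliques n (Suc i) \<subseteq> full_part n i (Mset n i)"
  using full_part_cliques[of i n] by (auto simp: full_part_def Mset_Lset(3))

lemma intermediate_parts:
  assumes i: "2 \<le> i" and "Lset n (Suc i) \<subseteq> U" "U \<subseteq> Mset n (Suc i)"
  shows "suffix_part n i (Mset n i) \<subseteq> U" "prefix_part n i (Mset n i) \<inter> U = {}"
    and "suffix_part n i (Mset n i) \<union> full_part n i (Mset n i) \<inter> U = U"
proof -
  have U: "U \<subseteq> suffix_part n i (Mset n i) \<union> cliques n (Suc i)"
    using assms(3) unfolding suffix_part_Mset[OF i] Mset_Lset(3)[of n "Suc i"] .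
  show suf: "suffix_part n i (Mset n i) \<subseteq> U"
    using assms(2) suffix_part_Mset[OF i] by simp
  show "prefix_part n i (Mset n i) \<inter> U = {}"
    using U cliques_full[OF i, of n] parts_disjoint(1)[of n i "Mset n i"]
      prefix_suffix_disjoint[of n i "Mset n i"] by blast
  show "suffix_part n i (Mset n i) \<union> full_part n i (Mset n i) \<inter> U = U"
    using U suf cliques_full[OF i, of n] by blast
qed

lemma restrict_full_order:
  assumes i: "2 \<le> i" and U: "intermediate n (Suc i) U" and \<rho>: "\<rho> \<in> full_orders n i U"
  shows "filter (\<lambda>Y. Y \<in> Mset n i) \<rho> \<in> admissible_orders n i (Mset n i)"
    and "inv_set n i (Mset n i) (filter (\<lambda>Y. Y \<in> Mset n i) \<rho>) = U"
proof -
  have "Lset n (Suc i) \<subseteq> U" "U \<subseteq> Mset n (Suc i)"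
    using U by (auto simp: intermediate_def)
  note parts = intermediate_parts[OF i this]
  have "1 \<le> i"
    using i by simp
  from oriented_admissible[OF full_orders_restrict[OF \<rho> Mset_Lset(5)] this parts(1,2)]
  show "filter (\<lambda>Y. Y \<in> Mset n i) \<rho> \<in> admissible_orders n i (Mset n i)"
    "inv_set n i (Mset n i) (filter (\<lambda>Y. Y \<in> Mset n i) \<rho>) = U"
    unfolding parts(3) .
qed

lemma ex_admissible:
  assumes i: "2 \<le> i" and U: "intermediate n (Suc i) U"
  shows "\<exists>\<rho>. \<rho> \<in> inv_fibre n i (Mset n i) U"
proof -
  have "realizable n (Suc i) U"
    using U by (simp add: intermediate_def)
  then obtain \<rho> where "\<rho> \<in> full_orders n i U"
    using ex_full_order by blast
  then show ?thesis
    using restrict_full_order[OF i U] by (auto simp: inv_fibre_def)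
qed

text \<open>Moving \<open>Lset n i\<close> to the front reverses no pair of a packet. If
  \<open>Mset n i\<close> meets the packet only in part, the member that the order would list last
  is missing, so realizability puts \<open>Lset n i\<close> at the beginning. A full packet avoids
  \<open>Lset n i\<close> if inverted, being that of a clique, and obeys \<open>Lset_upward\<close>
  otherwise.\<close>

lemma move_L_first:
  assumes i: "2 \<le> i" and \<rho>: "\<rho> \<in> admissible_orders n i (Mset n i)"
    and inv: "inv_set n i (Mset n i) \<rho> \<subseteq> Mset n (Suc i)"
  shows "\<exists>\<sigma>\<in>inv_fibre n i (Mset n i) (inv_set n i (Mset n i) \<rho>). L_first n i \<sigma>"
proof -
  let ?L = "Lset n i" and ?M = "Mset n i" and ?U = "inv_set n i (Mset n i) \<rho>"
  let ?\<sigma> = "filter (\<lambda>Y. Y \<in> ?L) \<rho> @ filter (\<lambda>Y. Y \<notin> ?L) \<rho>"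
  have sub: "Lset n (Suc i) \<subseteq> ?U"
    using suffix_part_Mset[OF i, of n] by (auto simp: inv_set_def)
  note parts = intermediate_parts[OF i sub inv]
  have or: "oriented n i ?M ?U \<rho>"
    by (rule admissible_oriented[OF realizable_Mset \<rho>])
  have move: "precedes ?\<sigma> P Q" if "precedes \<rho> P Q" "Q \<in> ?L \<Longrightarrow> P \<in> ?L" for P Q
    using that precedes_in_set[OF that(1)] by (auto simp: precedes_append precedes_filter)
  have L_in_M: "Y \<in> ?L \<Longrightarrow> Y \<in> ?M" for Y
    using Mset_Lset(1) by blast
  have "oriented n i ?M ?U ?\<sigma>"
  proof (rule orientedI)
    fix X x y
    assume X: "X \<in> ksubsets n (Suc i)" and xy: "x \<in> X" "y \<in> X" "x < y" "X - {x} \<in> ?M" "X - {y} \<in> ?M"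
    obtain m where m: "m \<in> X" "\<forall>z\<in>X. m \<le> z"
      using ex_least ksubsetsD(1)[OF X] xy(1) by blast
    obtain l where l: "l \<in> X" "\<forall>z\<in>X. z \<le> l"
      using ex_greatest ksubsetsD(1)[OF X] xy(1) by blast
    show "precedes ?\<sigma> (X - {x}) (X - {y})" if "X \<in> ?U"
    proof (rule move)
      show "precedes \<rho> (X - {x}) (X - {y})"
        using orientedD(1)[OF or X xy that] .
      assume Ly: "X - {y} \<in> ?L"
      have "X \<in> suffix_part n i ?M"
      proof (rule ccontr)
        assume "X \<notin> suffix_part n i ?M"
        then have "clique X"
          using that inv unfolding Mset_Lset(3)[of n "Suc i"] suffix_part_Mset[OF i]
          by (auto simp: cliques_def)
        then have "clique (X - {y})"
          by (rule clique_subset) blast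
        then show False
          using Ly by (simp add: Lset_def)
      qed
      then have "X - {l} \<notin> ?M"
        by (rule greatest_notin_suffix[OF _ l])
      then have "X - {l} \<notin> ?L" "y \<noteq> l"
        using L_in_M xy(5) by blast+
      then show "X - {x} \<in> ?L"
        using realizable_between[OF realizable_Lset X xy(1,2) l(1) xy(3)] l(2) xy(2) Ly by force
    qed
    show "precedes ?\<sigma> (X - {y}) (X - {x})" if XU: "X \<notin> ?U"
    proof (rule move)
      show "precedes \<rho> (X - {y}) (X - {x})"
        using orientedD(2)[OF or X xy XU] .
      assume Lx: "X - {x} \<in> ?L"
      consider "X \<in> prefix_part n i ?M" | "X \<in> full_part n i ?M"
        using parts_cases[OF realizable_Mset X xy(1,4)] parts(1) XU by blast
      then show "X - {y} \<in> ?L"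
      proof cases
        case 1
        then have "X - {m} \<notin> ?M"
          by (rule least_notin_prefix[OF _ m])
        then have "X - {m} \<notin> ?L" "x \<noteq> m"
          using L_in_M xy(4) by blast+
        then show ?thesis
          using realizable_between[OF realizable_Lset X m(1) xy(1,2) _ xy(3)] m(2) xy(1) Lx by force
      next
        case 2
        then show ?thesis
          using Lset_upward[OF X _ xy(1-3) Lx] full_part_iff[OF X] by blast
      qed
    qed
  qed
  moreover have "?\<sigma> \<in> permutations_of_set ?M"
    using admissibleD[OF \<rho>] by (auto simp: permutations_of_set_def)
  moreover have "1 \<le> i"
    using i by simp
  ultimately have "?\<sigma> \<in> inv_fibre n i ?M ?U"
    using oriented_admissible[of ?\<sigma> ?M n i ?U] parts by (simp add: inv_fibre_def)
  moreover have "L_first n i ?\<sigma>"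
    using admissibleD(2)[OF \<rho>] Mset_Lset[of n i] by (auto simp: L_first_def precedes_append)
  ultimately show ?thesis
    by blast
qed

lemma L_first_inv_set:
  assumes i: "2 \<le> i" and \<rho>: "\<rho> \<in> admissible_orders n i (Mset n i)" and first: "L_first n i \<rho>"
  shows "intermediate n (Suc i) (inv_set n i (Mset n i) \<rho>)"
proof -
  let ?L = "Lset n i" and ?M = "Mset n i" and ?U = "inv_set n i (Mset n i) \<rho>"
  note set = admissibleD[OF \<rho>]
  have sub: "Lset n (Suc i) \<subseteq> ?U"
    using suffix_part_Mset[OF i, of n] by (auto simp: inv_set_def)
  have or: "oriented n i ?M ?U \<rho>"
    by (rule admissible_oriented[OF realizable_Mset \<rho>])
  have UM: "?U \<subseteq> Mset n (Suc i)"
  proof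
    fix X assume XU: "X \<in> ?U"
    then have X: "X \<in> ksubsets n (Suc i)"
      using parts_subset[of n i ?M] unfolding inv_set_def by blast
    show "X \<in> Mset n (Suc i)"
    proof (rule ccontr)
      assume M: "X \<notin> Mset n (Suc i)"
      then have "X \<notin> suffix_part n i ?M"
        using suffix_part_Mset[OF i, of n] Mset_Lset(1) by blast
      then have full: "X \<in> full_part n i ?M"
        using XU by (auto simp: inv_set_def)
      have "X \<notin> full_part n i (cliques n i)"
        using M Mset_Lset(3) unfolding full_part_cliques[OF i] by blast
      then obtain x where x: "x \<in> X" "X - {x} \<notin> cliques n i"
        unfolding full_part_iff[OF X] by blast
      obtain m where m: "m \<in> X" "\<forall>z\<in>X. m \<le> z"
        using ex_least ksubsetsD(1)[OF X] x(1) by blast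
      have all: "\<forall>x\<in>X. X - {x} \<in> ?M"
        using full full_part_iff[OF X] by blast
      then have "X - {m} \<notin> ?L" "X - {x} \<in> ?L"
        using least_remove_notin_Lset[OF X _ m] x Mset_Lset(3) by blast+
      \<comment> \<open>The antilexicographic order starts with this clique, but a later member of
        the packet is in \<open>?L\<close>.\<close>
      then have "X - {m} \<in> cliques n i" "m < x"
        using all m x Mset_Lset(3) by (auto simp: le_less)
      then have "precedes \<rho> (X - {m}) (X - {x})" "precedes \<rho> (X - {x}) (X - {m})"
        using orientedD(1)[OF or X m(1) x(1) _ _ _ XU] all m(1) x(1) first \<open>X - {x} \<in> ?L\<close>
        by (auto simp: L_first_def)
      then show False
        using precedes_asym[OF set(3)] by blast
    qed
  qed
  have "realizable n (Suc i) (Lset n (Suc i))"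
    by (rule realizable_Lset)
  then obtain \<rho>0 where \<rho>0: "\<rho>0 \<in> full_orders n i (Lset n (Suc i))"
    using ex_full_order by blast
  then have set0: "set \<rho>0 = ksubsets n i" "distinct \<rho>0"
    and or0: "oriented n i (ksubsets n i) (Lset n (Suc i)) \<rho>0"
    by (auto simp: full_orders_def permutations_of_set_def)
  \<comment> \<open>The sets outside \<open>?M\<close> can follow all others, since a packet met in
    part is traversed starting inside \<open>?M\<close>. Among them \<open>\<rho>0\<close> is
    correct: an inverted packet with a member outside \<open>?M\<close> belongs to
    \<open>Lset n (Suc i)\<close>.\<close>
  let ?\<tau> = "\<rho> @ filter (\<lambda>Y. Y \<notin> ?M) \<rho>0"
  have both: "precedes ?\<tau> P Q"
    if "P \<in> ?M \<Longrightarrow> Q \<in> ?M \<Longrightarrow> precedes \<rho> P Q" "P \<notin> ?M \<Longrightarrow> Q \<notin> ?M \<Longrightarrow> precedes \<rho>0 P Q"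
      "Q \<in> ?M \<Longrightarrow> P \<in> ?M" "P \<in> ksubsets n i" "Q \<in> ksubsets n i" for P Q
    using that set(2) set0(1) by (auto simp: precedes_append precedes_filter)
  have "oriented n i (ksubsets n i) ?U ?\<tau>"
  proof (rule orientedI)
    fix X x y
    assume X: "X \<in> ksubsets n (Suc i)" "x \<in> X" "y \<in> X" "x < y"
      and k: "X - {x} \<in> ksubsets n i" "X - {y} \<in> ksubsets n i"
    show "precedes ?\<tau> (X - {x}) (X - {y})" if "X \<in> ?U"
    proof (rule both)
      show "X - {x} \<in> ?M \<Longrightarrow> X - {y} \<in> ?M \<Longrightarrow> precedes \<rho> (X - {x}) (X - {y})"
        using orientedD(1)[OF or X] that by blast
      have *: "X \<in> suffix_part n i ?M \<or> X \<in> full_part n i ?M"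
        using that by (auto simp: inv_set_def)
      show "X - {y} \<in> ?M \<Longrightarrow> X - {x} \<in> ?M"
        using * suffixD[OF _ X(2-4)] fullD[OF _ X(2)] by blast
      assume "X - {x} \<notin> ?M"
      then have "X \<in> Lset n (Suc i)"
        using * fullD[OF _ X(2)] suffix_part_Mset[OF i, of n] by blast
      then show "precedes \<rho>0 (X - {x}) (X - {y})"
        using orientedD(1)[OF or0 X k] by blast
    qed (use k in auto)
    show "precedes ?\<tau> (X - {y}) (X - {x})" if "X \<notin> ?U"
    proof (rule both)
      show "X - {y} \<in> ?M \<Longrightarrow> X - {x} \<in> ?M \<Longrightarrow> precedes \<rho> (X - {y}) (X - {x})"
        using orientedD(2)[OF or X] that by blast
      have nL: "X \<notin> Lset n (Suc i)"
        using that sub by blast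
      then show "precedes \<rho>0 (X - {y}) (X - {x})"
        using orientedD(2)[OF or0 X k] by blast
      assume "X - {x} \<in> ?M"
      then have "X \<in> prefix_part n i ?M \<or> X \<in> full_part n i ?M"
        using parts_cases[OF realizable_Mset X(1,2)] nL suffix_part_Mset[OF i, of n] by blast
      then show "X - {y} \<in> ?M"
        using prefixD[OF _ X(2-4)] fullD[OF _ X(3)] \<open>X - {x} \<in> ?M\<close> by blast
    qed (use k in auto)
  qed
  moreover have "?\<tau> \<in> permutations_of_set (ksubsets n i)"
    using set set0 Mset_Lset(5)[of n i] by (auto simp: permutations_of_set_def)
  ultimately have "?\<tau> \<in> full_orders n i ?U"
    by (simp add: full_orders_def)
  moreover have "?U \<subseteq> ksubsets n (Suc i)"
    using UM Mset_Lset(5) by blast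
  ultimately have "realizable n (Suc i) ?U"
    by (intro realizable_inversions)
  then show ?thesis
    using sub UM by (simp add: intermediate_def)
qed

lemma L_first_orders_iff:
  assumes "realizable n 2 J" "2 \<le> i"
  shows "\<rho> \<in> L_first_orders n J i \<longleftrightarrow> \<rho> \<in> admissible_orders n i (Mset n i) \<and> L_first n i \<rho>"
proof -
  have levels: "level_L n J i = Lset n i" "level_M n J i = Mset n i"
    using levels[OF assms] by simp_all
  have "(\<forall>a<length \<rho>. \<forall>b<length \<rho>. \<rho> ! a \<in> Lset n i \<and> \<rho> ! b \<in> cliques n i \<longrightarrow> a < b) \<longleftrightarrow> L_first n i \<rho>"
    if \<rho>: "\<rho> \<in> admissible_orders n i (Mset n i)"
  proof
    assume *: "\<forall>a<length \<rho>. \<forall>b<length \<rho>. \<rho> ! a \<in> Lset n i \<and> \<rho> ! b \<in> cliques n i \<longrightarrow> a < b"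
    have "precedes \<rho> P Q" if PQ: "P \<in> Lset n i" "Q \<in> cliques n i" for P Q
    proof -
      have "P \<in> set \<rho>" "Q \<in> set \<rho>"
        using PQ admissibleD(2)[OF \<rho>] Mset_Lset(3) by blast+
      then obtain a b where "a < length \<rho>" "b < length \<rho>" "\<rho> ! a = P" "\<rho> ! b = Q"
        by (auto simp: in_set_conv_nth)
      then show ?thesis
        using * PQ unfolding precedes_iff_nth by blast
    qed
    then show "L_first n i \<rho>"
      by (simp add: L_first_def)
  next
    assume first: "L_first n i \<rho>"
    show "\<forall>a<length \<rho>. \<forall>b<length \<rho>. \<rho> ! a \<in> Lset n i \<and> \<rho> ! b \<in> cliques n i \<longrightarrow> a < b"
    proof (intro allI impI)
      fix a b assume ab: "a < length \<rho>" "b < length \<rho>" "\<rho> ! a \<in> Lset n i \<and> \<rho> ! b \<in> cliques n i"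
      then obtain p q where "p < q" "q < length \<rho>" "\<rho> ! p = \<rho> ! a" "\<rho> ! q = \<rho> ! b"
        using first unfolding L_first_def precedes_iff_nth by blast
      then show "a < b"
        using ab nth_eq_iff_index_eq[OF admissibleD(3)[OF \<rho>]] by (metis less_trans)
    qed
  qed
  then show ?thesis
    unfolding L_first_orders_def levels Mset_Lset(2) by auto
qed

text \<open>The second form asks only for an upper bound on the inversion set, because
  \<open>move_L_first\<close> then supplies a representative. As inversions grow along flips, it
  keeps flip paths that end in the poset inside the poset.\<close>

lemma B_set_iff:
  assumes J: "realizable n 2 J" and i: "2 \<le> i"
  shows "r \<in> B_set n J i \<longleftrightarrow> (\<exists>U. intermediate n (Suc i) U \<and> r = inv_fibre n i (Mset n i) U)"
    and "r \<in> B_set n J i \<longleftrightarrow> r \<in> order_classes n i (Mset n i) \<and> inv_class n i (Mset n i) r \<subseteq> Mset n (Suc i)"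
proof -
  let ?M = "Mset n i"
  have M: "realizable n i ?M"
    by (rule realizable_Mset)
  have B: "r \<in> B_set n J i \<longleftrightarrow> r \<in> order_classes n i ?M \<and> (\<exists>\<rho>\<in>r. \<rho> \<in> L_first_orders n J i)"
    using levels[OF J i] by (auto simp: B_set_def)
  have 1: "\<exists>U. intermediate n (Suc i) U \<and> r = inv_fibre n i ?M U" if r: "r \<in> B_set n J i"
  proof -
    obtain \<rho> where \<rho>: "r \<in> order_classes n i ?M" "\<rho> \<in> r" "\<rho> \<in> L_first_orders n J i"
      using r B by blast
    then have "intermediate n (Suc i) (inv_set n i ?M \<rho>)"
      using L_first_inv_set[OF i] L_first_orders_iff[OF J i] by blast
    then show ?thesis
      using order_classD[OF M \<rho>(1)] \<rho>(2) by metis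
  qed
  have 2: "r \<in> order_classes n i ?M \<and> inv_class n i ?M r \<subseteq> Mset n (Suc i)"
    if r: "\<exists>U. intermediate n (Suc i) U \<and> r = inv_fibre n i ?M U"
  proof -
    obtain U where U: "intermediate n (Suc i) U" "r = inv_fibre n i ?M U"
      using r by blast
    then obtain \<rho> where "\<rho> \<in> inv_fibre n i ?M U"
      using ex_admissible[OF i] by blast
    then show ?thesis
      using U inv_class_fibre fibre_order_class[OF M] by (metis intermediate_def)
  qed
  have 3: "r \<in> B_set n J i" if r: "r \<in> order_classes n i ?M \<and> inv_class n i ?M r \<subseteq> Mset n (Suc i)"
  proof -
    obtain \<rho> where "\<rho> \<in> r"
      using order_classD(2)[OF M] r by blast
    then have \<rho>: "\<rho> \<in> admissible_orders n i ?M" "inv_set n i ?M \<rho> = inv_class n i ?M r"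
      using order_classD(3)[OF M] r by blast+
    then obtain \<sigma> where "\<sigma> \<in> r" "L_first n i \<sigma>"
      using move_L_first[OF i \<rho>(1)] r order_classD(1)[OF M, of r] by auto
    then show ?thesis
      using r B L_first_orders_iff[OF J i] order_classD(3)[OF M] by blast
  qed
  show "r \<in> B_set n J i \<longleftrightarrow> (\<exists>U. intermediate n (Suc i) U \<and> r = inv_fibre n i ?M U)"
    "r \<in> B_set n J i \<longleftrightarrow> r \<in> order_classes n i ?M \<and> inv_class n i ?M r \<subseteq> Mset n (Suc i)"
    using 1 2 3 by blast+
qed

lemma inv_class_intermediate:
  assumes "2 \<le> i" "intermediate n (Suc i) U"
  shows "inv_class n i (Mset n i) (inv_fibre n i (Mset n i) U) = U"
  using ex_admissible[OF assms] inv_class_fibre by blast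

text \<open>The packet of a clique lies inside \<open>Mset n i\<close>, so a contiguous block in an
  order of all sets stays intact under restriction.\<close>

lemma packet_flip_intermediate:
  assumes i: "2 \<le> i" and U: "intermediate n (Suc i) U" and XU: "intermediate n (Suc i) (insert X U)"
    and X: "X \<notin> U"
  shows "packet_flip n i (Mset n i) X (inv_fibre n i (Mset n i) U) (inv_fibre n i (Mset n i) (insert X U))"
proof -
  let ?M = "Mset n i"
  have Xk: "X \<in> ksubsets n (Suc i)" "X \<in> cliques n (Suc i)"
    using U XU X Mset_Lset[of n "Suc i"] by (auto simp: intermediate_def)
  then have full: "X \<in> full_part n i ?M"
    using cliques_full[OF i] by blast
  obtain us ps vs where \<rho>: "us @ ps @ vs \<in> full_orders n i U" and ps: "set ps = packet n i X"
    using ex_full_order_block[OF _ Xk(1) X] U XU by (auto simp: intermediate_def)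
  let ?f = "filter (\<lambda>Y. Y \<in> ?M)"
  have "?f ps = ps"
    using ps full by (auto simp: filter_id_conv full_part_def)
  then have adm: "?f us @ ps @ ?f vs \<in> admissible_orders n i ?M" "inv_set n i ?M (?f us @ ps @ ?f vs) = U"
    using restrict_full_order[OF i U \<rho>] by auto
  have "1 \<le> i"
    using i by simp
  note flip = flip_block[OF adm(1) ps full _ this, unfolded adm(2), OF X]
  have "?f us @ ps @ ?f vs \<in> inv_fibre n i ?M U" "?f us @ rev ps @ ?f vs \<in> inv_fibre n i ?M (insert X U)"
    using adm flip by (auto simp: inv_fibre_def)
  then show ?thesis
    unfolding packet_flip_def using full ps fibre_order_class[OF realizable_Mset] by blast
qed

end

section \<open>Flip sequences\<close>

definition flip_step :: "nat \<Rightarrow> nat \<Rightarrow> nat set set \<Rightarrow> nat set list set \<Rightarrow> nat set list set \<Rightarrow> bool" where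
  "flip_step n k A r r' \<longleftrightarrow> (\<exists>X. packet_flip n k A X r r' \<and> X \<notin> inv_class n k A r)"

lemma flip_step_classes: "flip_step n k A r r' \<Longrightarrow> r \<in> order_classes n k A \<and> r' \<in> order_classes n k A"
  by (auto simp: flip_step_def packet_flip_def)

lemma hd_last_nth:
  assumes "length rs = Suc m"
  shows "hd rs = rs ! 0" "last rs = rs ! m"
proof -
  have "rs \<noteq> []"
    using assms by auto
  then show "hd rs = rs ! 0" "last rs = rs ! m"
    using assms by (simp_all add: hd_conv_nth last_conv_nth)
qed

lemma ms_order_iff:
  "(r, r') \<in> ms_order n k A \<longleftrightarrow> r \<in> order_classes n k A \<and> (flip_step n k A)\<^sup>*\<^sup>* r r'"
proof
  assume "(r, r') \<in> ms_order n k A"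
  then obtain rs Xs where fs: "flip_seq n k A rs Xs" and ends: "hd rs = r" "last rs = r'"
    unfolding ms_order_def by blast
  then have len: "length rs = Suc (length Xs)"
    by (simp add: flip_seq_def)
  have "(flip_step n k A)\<^sup>*\<^sup>* (rs ! 0) (rs ! j)" if "j \<le> length Xs" for j
    using that
  proof (induction j)
    case (Suc j)
    then have "flip_step n k A (rs ! j) (rs ! Suc j)"
      using fs Suc.prems unfolding flip_seq_def flip_step_def by (meson Suc_le_lessD)
    then show ?case
      using Suc by (auto intro: rtranclp.rtrancl_into_rtrancl)
  qed simp
  from this[of "length Xs"] have "(flip_step n k A)\<^sup>*\<^sup>* r r'"
    using ends hd_last_nth[OF len] by simp
  moreover have "r \<in> order_classes n k A"
    using fs len ends by (cases rs) (auto simp: flip_seq_def)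
  ultimately show "r \<in> order_classes n k A \<and> (flip_step n k A)\<^sup>*\<^sup>* r r'"
    by simp
next
  assume *: "r \<in> order_classes n k A \<and> (flip_step n k A)\<^sup>*\<^sup>* r r'"
  have "\<exists>rs Xs. flip_seq n k A rs Xs \<and> hd rs = r \<and> last rs = r'"
    using conjunct2[OF *]
  proof (induction rule: rtranclp_induct)
    case base
    have "flip_seq n k A [r] []"
      using * by (simp add: flip_seq_def)
    then show ?case
      by force
  next
    case (step s s')
    then obtain rs Xs where fs: "flip_seq n k A rs Xs" "hd rs = r" "last rs = s"
      by blast
    obtain X where X: "packet_flip n k A X s s'" "X \<notin> inv_class n k A s"
      using step(2) by (auto simp: flip_step_def)
    have len: "length rs = Suc (length Xs)"
      using fs by (simp add: flip_seq_def)
    then have s: "s = rs ! length Xs"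
      using fs(3) hd_last_nth(2)[OF len] by simp
    have "flip_seq n k A (rs @ [s']) (Xs @ [X])"
      unfolding flip_seq_def
    proof (intro conjI allI impI)
      show "set (rs @ [s']) \<subseteq> order_classes n k A"
        using fs(1) flip_step_classes[OF step(2)] by (auto simp: flip_seq_def)
      show "length (rs @ [s']) = Suc (length (Xs @ [X]))"
        using len by simp
      fix j assume j: "j < length (Xs @ [X])"
      show "packet_flip n k A ((Xs @ [X]) ! j) ((rs @ [s']) ! j) ((rs @ [s']) ! Suc j)"
        using fs(1) len s X(1) j by (cases "j = length Xs") (auto simp: flip_seq_def nth_append)
      show "(Xs @ [X]) ! j \<notin> inv_class n k A ((rs @ [s']) ! j)"
        using fs(1) len s X(2) j by (cases "j = length Xs") (auto simp: flip_seq_def nth_append)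
    qed
    moreover have "hd (rs @ [s']) = r" "last (rs @ [s']) = s'"
      using fs(2) len by (cases rs; auto)+
    ultimately show ?case
      by blast
  qed
  then show "(r, r') \<in> ms_order n k A"
    unfolding ms_order_def by blast
qed

lemma inv_class_subset:
  assumes "realizable n k A" "r \<in> order_classes n k A"
  shows "inv_class n k A r \<subseteq> ksubsets n (Suc k)" "finite (inv_class n k A r)"
    and "suffix_part n k A \<subseteq> inv_class n k A r"
proof -
  obtain \<rho> where "\<rho> \<in> r"
    using order_classD(2)[OF assms] by blast
  then have "inv_class n k A r = inv_set n k A \<rho>"
    using order_classD(3)[OF assms] by metis
  then show "inv_class n k A r \<subseteq> ksubsets n (Suc k)" "suffix_part n k A \<subseteq> inv_class n k A r"
    using parts_subset[of n k A] unfolding inv_set_def by blast+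
  then show "finite (inv_class n k A r)"
    using finite_subset finite_ksubsets by blast
qed

lemma flip_step_inv_class:
  assumes "realizable n k A" "1 \<le> k" "flip_step n k A r r'"
  obtains X where "X \<notin> inv_class n k A r" "inv_class n k A r' = insert X (inv_class n k A r)"
  using assms packet_flip_inv_class unfolding flip_step_def by blast

lemma flip_steps_inv_class:
  assumes "realizable n k A" "1 \<le> k" "(flip_step n k A)\<^sup>*\<^sup>* r r'"
  shows "inv_class n k A r \<subseteq> inv_class n k A r' \<and> (inv_class n k A r = inv_class n k A r' \<longrightarrow> r = r')"
  using assms(3)
proof (induction rule: rtranclp_induct)
  case (step s s')
  then show ?case
    by (auto elim!: flip_step_inv_class[OF assms(1,2)])
qed simp

lemma flip_seq_inv_class:
  assumes A: "realizable n k A" "1 \<le> k" and fs: "flip_seq n k A rs Xs" and "j \<le> length Xs"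
  shows "inv_class n k A (rs ! j) = inv_class n k A (rs ! 0) \<union> set (take j Xs) \<and>
    distinct (take j Xs) \<and> inv_class n k A (rs ! 0) \<inter> set (take j Xs) = {}"
  using assms(4)
proof (induction j)
  case (Suc j)
  have X: "packet_flip n k A (Xs ! j) (rs ! j) (rs ! Suc j)" "Xs ! j \<notin> inv_class n k A (rs ! j)"
    using fs Suc.prems by (auto simp: flip_seq_def)
  have "take (Suc j) Xs = take j Xs @ [Xs ! j]"
    using Suc.prems by (simp add: take_Suc_conv_app_nth)
  then show ?case
    using packet_flip_inv_class[OF A X] X(2) Suc by auto
qed simp

section \<open>Rank function and extreme elements\<close>

context pair_set
begin

lemma B_inv_fibre:
  assumes "realizable n 2 J" "2 \<le> i" "intermediate n (Suc i) U"
  shows "B_inv n J i (inv_fibre n i (Mset n i) U) = U"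
  using inv_class_intermediate[OF assms(2,3)] levels[OF assms(1,2)] by (simp add: B_inv_def)

lemma B_setD:
  assumes "realizable n 2 J" "2 \<le> i" "r \<in> B_set n J i"
  shows "intermediate n (Suc i) (B_inv n J i r)" "r = inv_fibre n i (Mset n i) (B_inv n J i r)"
    and "B_inv n J i r = inv_class n i (Mset n i) r" "r \<in> order_classes n i (Mset n i)"
proof -
  obtain U where U: "intermediate n (Suc i) U" "r = inv_fibre n i (Mset n i) U"
    using assms B_set_iff(1) by blast
  then show "intermediate n (Suc i) (B_inv n J i r)" "r = inv_fibre n i (Mset n i) (B_inv n J i r)"
    using B_inv_fibre[OF assms(1,2) U(1)] by simp_all
  show "B_inv n J i r = inv_class n i (Mset n i) r"
    using levels[OF assms(1,2)] by (simp add: B_inv_def)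
  show "r \<in> order_classes n i (Mset n i)"
    using assms B_set_iff(2) by blast
qed

lemma B_order_iff:
  assumes "realizable n 2 J" "2 \<le> i"
  shows "(r, r') \<in> B_order n J i \<longleftrightarrow>
    r \<in> B_set n J i \<and> r' \<in> B_set n J i \<and> (flip_step n i (Mset n i))\<^sup>*\<^sup>* r r'"
  using B_setD(4)[OF assms] levels[OF assms] by (auto simp: B_order_def ms_order_iff)

lemma B_order_inv:
  assumes "realizable n 2 J" "2 \<le> i" "(r, r') \<in> B_order n J i"
  shows "B_inv n J i r \<subseteq> B_inv n J i r'" "B_inv n J i r = B_inv n J i r' \<Longrightarrow> r = r'"
proof -
  have *: "r \<in> B_set n J i" "r' \<in> B_set n J i" "(flip_step n i (Mset n i))\<^sup>*\<^sup>* r r'"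
    using assms B_order_iff by blast+
  have "1 \<le> i"
    using assms(2) by simp
  from flip_steps_inv_class[OF realizable_Mset this *(3)]
  show "B_inv n J i r \<subseteq> B_inv n J i r'" "B_inv n J i r = B_inv n J i r' \<Longrightarrow> r = r'"
    using B_setD(3)[OF assms(1,2)] *(1,2) by auto
qed

lemma finite_B_inv:
  assumes "realizable n 2 J" "2 \<le> i" "r \<in> B_set n J i"
  shows "finite (B_inv n J i r)"
  using B_setD(3,4)[OF assms] inv_class_subset(2)[OF realizable_Mset] by simp

lemma ranked_poset_B:
  assumes J: "realizable n 2 J" and i: "2 \<le> i"
  shows "ranked_poset (B_set n J i) (B_order n J i) (\<lambda>r. card (B_inv n J i r))"
  unfolding ranked_poset_def
proof (intro conjI ballI allI impI)
  note iff = B_order_iff[OF J i]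
  show "partial_order_on (B_set n J i) (B_order n J i)"
    unfolding partial_order_on_def preorder_on_def
  proof (intro conjI)
    show "refl_on (B_set n J i) (B_order n J i)"
      by (auto simp: refl_on_def iff)
    show "Relation.trans (B_order n J i)"
      by (rule transI) (auto simp: iff)
    show "antisym (B_order n J i)"
      by (rule antisymI) (metis B_order_inv[OF J i] subset_antisym)
    show "B_order n J i \<subseteq> B_set n J i \<times> B_set n J i"
      by (auto simp: B_order_def)
  qed
next
  fix x y
  assume "x \<in> B_set n J i" "y \<in> B_set n J i" "(x, y) \<in> B_order n J i \<and> x \<noteq> y"
  then show "card (B_inv n J i x) < card (B_inv n J i y)"
    using B_order_inv[OF J i] finite_B_inv[OF J i] by (meson psubset_card_mono psubsetI)
next
  fix x y
  assume "covers (B_set n J i) (B_order n J i) y x"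
  then have xy: "x \<in> B_set n J i" "y \<in> B_set n J i" "(x, y) \<in> B_order n J i" "x \<noteq> y"
    and between: "\<And>z. z \<in> B_set n J i \<Longrightarrow> (x, z) \<in> B_order n J i \<Longrightarrow> (z, y) \<in> B_order n J i \<Longrightarrow> z = x \<or> z = y"
    by (auto simp: covers_def)
  have i1: "1 \<le> i"
    using i by simp
  have "(flip_step n i (Mset n i))\<^sup>*\<^sup>* x y"
    using xy(3) B_order_iff[OF J i] by blast
  \<comment> \<open>The first flip on a path from \<open>x\<close> to \<open>y\<close> stays in the
    poset, its inversions being among those of \<open>y\<close>; by covering it already reaches
    \<open>y\<close>.\<close>
  then obtain z where z: "flip_step n i (Mset n i) x z" "(flip_step n i (Mset n i))\<^sup>*\<^sup>* z y"
    using xy(4) by (metis converse_rtranclpE)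
  have "inv_class n i (Mset n i) z \<subseteq> inv_class n i (Mset n i) y"
    using flip_steps_inv_class[OF realizable_Mset i1 z(2)] by blast
  then have zB: "z \<in> B_set n J i"
    using B_set_iff(2)[OF J i] flip_step_classes[OF z(1)] xy(2) by blast
  obtain X where X: "X \<notin> inv_class n i (Mset n i) x"
    "inv_class n i (Mset n i) z = insert X (inv_class n i (Mset n i) x)"
    using flip_step_inv_class[OF realizable_Mset i1 z(1)] .
  have "z = x \<or> z = y"
    using between zB z xy B_order_iff[OF J i] by blast
  moreover have "z \<noteq> x"
    using X by blast
  ultimately show "card (B_inv n J i y) = Suc (card (B_inv n J i x))"
    using X B_setD(3)[OF J i] xy(1,2) finite_B_inv[OF J i xy(1)] by simp
qed

lemma fibre_in_B_set:
  "realizable n 2 J \<Longrightarrow> 2 \<le> i \<Longrightarrow> intermediate n (Suc i) U \<Longrightarrow> inv_fibre n i (Mset n i) U \<in> B_set n J i"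
  using B_set_iff(1) by blast

lemma B_order_insert:
  assumes "realizable n 2 J" "2 \<le> i" "intermediate n (Suc i) U" "intermediate n (Suc i) (insert X U)" "X \<notin> U"
  shows "(inv_fibre n i (Mset n i) U, inv_fibre n i (Mset n i) (insert X U)) \<in> B_order n J i"
  unfolding B_order_iff[OF assms(1,2)]
proof (intro conjI)
  show "(flip_step n i (Mset n i))\<^sup>*\<^sup>* (inv_fibre n i (Mset n i) U) (inv_fibre n i (Mset n i) (insert X U))"
    using packet_flip_intermediate[OF assms(2-5)] inv_class_intermediate[OF assms(2,3)] assms(5)
    by (intro r_into_rtranclp) (auto simp: flip_step_def)
qed (use assms fibre_in_B_set in auto)

lemma minimal_B_iff:
  assumes J: "realizable n 2 J" and i: "2 \<le> i"
  shows "minimal_in (B_set n J i) (B_order n J i) r \<longleftrightarrow> r = inv_fibre n i (Mset n i) (Lset n (Suc i))"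
    (is "_ \<longleftrightarrow> r = ?rmin")
proof
  assume min: "minimal_in (B_set n J i) (B_order n J i) r"
  then have r: "r \<in> B_set n J i"
    by (simp add: minimal_in_def)
  note U = B_setD[OF J i r]
  show "r = ?rmin"
  proof (rule ccontr)
    assume "r \<noteq> ?rmin"
    then have "B_inv n J i r \<noteq> Lset n (Suc i)"
      using U(2) by metis
    then obtain X where X: "X \<in> B_inv n J i r - Lset n (Suc i)" "realizable n (Suc i) (B_inv n J i r - {X})"
      using ex_removable[of n i] U(1) unfolding intermediate_def by blast
    let ?V = "B_inv n J i r - {X}"
    have V: "intermediate n (Suc i) ?V" "insert X ?V = B_inv n J i r" "X \<notin> ?V"
      using U(1) X by (auto simp: intermediate_def)
    then have "(inv_fibre n i (Mset n i) ?V, r) \<in> B_order n J i"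
      using B_order_insert[OF J i V(1) _ V(3)] U(1,2) by simp
    then have "inv_fibre n i (Mset n i) ?V = r"
      using min fibre_in_B_set[OF J i V(1)] by (auto simp: minimal_in_def)
    then show False
      using B_inv_fibre[OF J i V(1)] X(1) by auto
  qed
next
  assume r: "r = ?rmin"
  show "minimal_in (B_set n J i) (B_order n J i) r"
    unfolding minimal_in_def
  proof (intro conjI ballI impI)
    show "r \<in> B_set n J i"
      unfolding r by (rule fibre_in_B_set[OF J i intermediate_Lset])
    fix y assume y: "y \<in> B_set n J i" "(y, r) \<in> B_order n J i"
    have "B_inv n J i r = Lset n (Suc i)"
      unfolding r by (rule B_inv_fibre[OF J i intermediate_Lset])
    then show "y = r"
      using B_order_inv[OF J i y(2)] B_setD(1)[OF J i y(1)] by (auto simp: intermediate_def)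
  qed
qed

lemma maximal_B_iff:
  assumes J: "realizable n 2 J" and i: "2 \<le> i"
  shows "maximal_in (B_set n J i) (B_order n J i) r \<longleftrightarrow> r = inv_fibre n i (Mset n i) (Mset n (Suc i))"
    (is "_ \<longleftrightarrow> r = ?rmax")
proof
  assume max: "maximal_in (B_set n J i) (B_order n J i) r"
  then have r: "r \<in> B_set n J i"
    by (simp add: maximal_in_def)
  note U = B_setD[OF J i r]
  have i1: "1 \<le> i"
    using i by simp
  show "r = ?rmax"
  proof (rule ccontr)
    assume "r \<noteq> ?rmax"
    then have "B_inv n J i r \<noteq> Mset n (Suc i)"
      using U(2) by metis
    then obtain X where X: "X \<in> Mset n (Suc i) - B_inv n J i r" "realizable n (Suc i) (insert X (B_inv n J i r))"
      using ex_addable[OF i1, of n] U(1) unfolding intermediate_def by blast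
    let ?V = "insert X (B_inv n J i r)"
    have V: "intermediate n (Suc i) ?V" "X \<notin> B_inv n J i r"
      using U(1) X by (auto simp: intermediate_def)
    then have "(r, inv_fibre n i (Mset n i) ?V) \<in> B_order n J i"
      using B_order_insert[OF J i U(1) V] U(2) by simp
    then have "inv_fibre n i (Mset n i) ?V = r"
      using max fibre_in_B_set[OF J i V(1)] by (auto simp: maximal_in_def)
    then show False
      using B_inv_fibre[OF J i V(1)] V(2) by auto
  qed
next
  assume r: "r = ?rmax"
  show "maximal_in (B_set n J i) (B_order n J i) r"
    unfolding maximal_in_def
  proof (intro conjI ballI impI)
    show "r \<in> B_set n J i"
      unfolding r by (rule fibre_in_B_set[OF J i intermediate_Mset])
    fix y assume y: "y \<in> B_set n J i" "(r, y) \<in> B_order n J i"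
    have "B_inv n J i r = Mset n (Suc i)"
      unfolding r by (rule B_inv_fibre[OF J i intermediate_Mset])
    then show "y = r"
      using B_order_inv[OF J i y(2)] B_setD(1)[OF J i y(1)] by (auto simp: intermediate_def)
  qed
qed

section \<open>Maximal chains and the next level\<close>

definition chain_order :: "nat \<Rightarrow> nat \<Rightarrow> nat set list \<Rightarrow> bool" where
  "chain_order n k Xs \<longleftrightarrow> Xs \<in> permutations_of_set (cliques n k) \<and>
     (\<forall>j\<le>length Xs. realizable n k (Lset n k \<union> set (take j Xs)))"

definition chain_classes :: "nat \<Rightarrow> nat \<Rightarrow> nat set list \<Rightarrow> nat set list set list" where
  "chain_classes n i Xs =
     map (\<lambda>j. inv_fibre n i (Mset n i) (Lset n (Suc i) \<union> set (take j Xs))) [0..<Suc (length Xs)]"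

lemma chain_order_intermediate:
  assumes "chain_order n k Xs" "j \<le> length Xs"
  shows "intermediate n k (Lset n k \<union> set (take j Xs))"
proof -
  have "set (take j Xs) \<subseteq> cliques n k"
    using assms(1) set_take_subset[of j Xs] permutationsD(1) unfolding chain_order_def by blast
  then show ?thesis
    using assms by (auto simp: chain_order_def intermediate_def Mset_Lset(3))
qed

lemma chain_order_new:
  assumes "chain_order n k Xs" "j < length Xs"
  shows "Xs ! j \<notin> Lset n k \<union> set (take j Xs)"
    and "Lset n k \<union> set (take (Suc j) Xs) = insert (Xs ! j) (Lset n k \<union> set (take j Xs))"
proof -
  have Xs: "set Xs = cliques n k" "distinct Xs"
    using assms(1) permutationsD unfolding chain_order_def by blast+
  have "Xs ! j \<notin> set (take j Xs)"
    using Xs(2) assms(2) by (auto simp: in_set_conv_nth nth_eq_iff_index_eq)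
  moreover have "Xs ! j \<notin> Lset n k"
    using assms(2) Xs(1) Mset_Lset(4)[of n k] nth_mem by blast
  ultimately show "Xs ! j \<notin> Lset n k \<union> set (take j Xs)"
    by blast
  show "Lset n k \<union> set (take (Suc j) Xs) = insert (Xs ! j) (Lset n k \<union> set (take j Xs))"
    using assms(2) by (simp add: take_Suc_conv_app_nth)
qed

text \<open>Each flip adds its label to the inversion set, which determines the class, so the labels
  determine the chain. Conversely, realizable initial segments give intermediate sets, and
  consecutive ones are joined by a flip.\<close>

lemma max_chains_iff:
  assumes J: "realizable n 2 J" and i: "2 \<le> i"
  defines "rmin \<equiv> inv_fibre n i (Mset n i) (Lset n (Suc i))"
    and "rmax \<equiv> inv_fibre n i (Mset n i) (Mset n (Suc i))"
  shows "(rs, Xs) \<in> B_max_chains n J i rmin rmax \<longleftrightarrow>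
    chain_order n (Suc i) Xs \<and> rs = chain_classes n i Xs"
proof
  let ?L = "Lset n (Suc i)"
  have M: "level_M n J i = Mset n i"
    using levels[OF J i] by simp
  have i1: "1 \<le> i"
    using i by simp
  assume chain: "(rs, Xs) \<in> B_max_chains n J i rmin rmax"
  then have fs: "flip_seq n i (Mset n i) rs Xs" and B: "set rs \<subseteq> B_set n J i"
    and ends: "hd rs = rmin" "last rs = rmax"
    by (auto simp: B_max_chains_def M)
  have len: "length rs = Suc (length Xs)"
    using fs by (simp add: flip_seq_def)
  have ends': "rs ! 0 = rmin" "rs ! length Xs = rmax"
    using ends hd_last_nth[OF len] by simp_all
  have inv0: "inv_class n i (Mset n i) rmin = ?L"
    unfolding rmin_def by (rule inv_class_intermediate[OF i intermediate_Lset])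
  have inv: "inv_class n i (Mset n i) (rs ! j) = ?L \<union> set (take j Xs)"
    "distinct (take j Xs)" "?L \<inter> set (take j Xs) = {}" if "j \<le> length Xs" for j
    using flip_seq_inv_class[OF realizable_Mset i1 fs that] unfolding ends' inv0 by auto
  have rsB: "rs ! j \<in> B_set n J i" if "j \<le> length Xs" for j
    using B len that nth_mem[of j rs] by auto
  have fibre: "rs ! j = inv_fibre n i (Mset n i) (?L \<union> set (take j Xs))"
    "realizable n (Suc i) (?L \<union> set (take j Xs))" if "j \<le> length Xs" for j
    using B_setD(1-3)[OF J i rsB[OF that]] inv(1)[OF that] by (auto simp: intermediate_def)
  have "?L \<union> set Xs = Mset n (Suc i)"
    using inv(1)[of "length Xs"] inv_class_intermediate[OF i intermediate_Mset]
    unfolding ends' rmax_def by simp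
  then have "set Xs = cliques n (Suc i)"
    using inv(3)[of "length Xs"] Mset_Lset(2)[of n "Suc i"] by auto
  then have "Xs \<in> permutations_of_set (cliques n (Suc i))"
    using inv(2)[of "length Xs"] by (simp add: permutations_of_set_def)
  then have "chain_order n (Suc i) Xs"
    using fibre(2) by (simp add: chain_order_def)
  moreover have "rs = chain_classes n i Xs"
  proof (rule nth_equalityI)
    show "length rs = length (chain_classes n i Xs)"
      using len by (simp add: chain_classes_def)
    fix j assume "j < length rs"
    then show "rs ! j = chain_classes n i Xs ! j"
      using fibre(1)[of j] len by (simp add: chain_classes_def del: upt_Suc)
  qed
  ultimately show "chain_order n (Suc i) Xs \<and> rs = chain_classes n i Xs"
    by simp
next
  let ?L = "Lset n (Suc i)"
  assume *: "chain_order n (Suc i) Xs \<and> rs = chain_classes n i Xs"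
  have M: "level_M n J i = Mset n i"
    using levels[OF J i] by simp
  have len: "length rs = Suc (length Xs)"
    using * by (simp add: chain_classes_def)
  have nth: "rs ! j = inv_fibre n i (Mset n i) (?L \<union> set (take j Xs))" if "j \<le> length Xs" for j
    using * that by (simp add: chain_classes_def del: upt_Suc)
  have im: "intermediate n (Suc i) (?L \<union> set (take j Xs))" if "j \<le> length Xs" for j
    using chain_order_intermediate * that by blast
  have Xs: "set Xs = cliques n (Suc i)" "distinct Xs"
    using * permutationsD unfolding chain_order_def by blast+
  have B: "set rs \<subseteq> B_set n J i"
    using nth len fibre_in_B_set[OF J i im] by (auto simp: in_set_conv_nth less_Suc_eq_le)
  have "flip_seq n i (Mset n i) rs Xs"
    unfolding flip_seq_def
  proof (intro conjI allI impI)
    show "set rs \<subseteq> order_classes n i (Mset n i)"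
      using B B_setD(4)[OF J i] by blast
    fix j assume j: "j < length Xs"
    note new = chain_order_new[OF conjunct1[OF *] j]
    show "packet_flip n i (Mset n i) (Xs ! j) (rs ! j) (rs ! Suc j)"
      using packet_flip_intermediate[OF i im[of j] _ new(1)] im[of "Suc j"] nth[of j] nth[of "Suc j"] j
      unfolding new(2) by simp
    show "Xs ! j \<notin> inv_class n i (Mset n i) (rs ! j)"
      using inv_class_intermediate[OF i im[of j]] nth[of j] j new(1) by simp
  qed (rule len)
  moreover have "hd rs = rmin"
    using nth[of 0] hd_last_nth(1)[OF len] by (simp add: rmin_def)
  moreover have "last rs = rmax"
    using nth[of "length Xs"] hd_last_nth(2)[OF len] Xs(1) Mset_Lset(3)[of n "Suc i"]
    by (simp add: rmax_def)
  ultimately show "(rs, Xs) \<in> B_max_chains n J i rmin rmax"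
    using B by (simp add: B_max_chains_def M)
qed

text \<open>The labels are the differences of consecutive inversion sets.\<close>

lemma chain_classes_inj:
  assumes "2 \<le> i" "chain_order n (Suc i) Xs" "chain_order n (Suc i) Ys"
    and eq: "chain_classes n i Xs = chain_classes n i Ys"
  shows "Xs = Ys"
proof (rule nth_equalityI)
  let ?L = "Lset n (Suc i)"
  have "length (chain_classes n i Xs) = length (chain_classes n i Ys)"
    using eq by simp
  then show len: "length Xs = length Ys"
    by (simp add: chain_classes_def)
  have U: "?L \<union> set (take j Xs) = ?L \<union> set (take j Ys)" if "j \<le> length Xs" for j
  proof -
    have "chain_classes n i Xs ! j = chain_classes n i Ys ! j"
      using eq by simp
    then have "inv_fibre n i (Mset n i) (?L \<union> set (take j Xs)) = inv_fibre n i (Mset n i) (?L \<union> set (take j Ys))"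
      using that len by (simp add: chain_classes_def del: upt_Suc)
    moreover have "j \<le> length Ys"
      using that len by simp
    ultimately show ?thesis
      using inv_class_intermediate[OF assms(1) chain_order_intermediate[OF assms(2) that]]
        inv_class_intermediate[OF assms(1) chain_order_intermediate[OF assms(3)]] by metis
  qed
  fix j assume j: "j < length Xs"
  show "Xs ! j = Ys ! j"
    using chain_order_new[OF assms(2) j] chain_order_new[OF assms(3), of j] U[of j] U[of "Suc j"] j len
    by auto
qed

end

text \<open>A packet is traversed antilexicographically if \<open>A\<close> meets it in a suffix and
  lexicographically for a prefix, so the traversal starts at an end of the packet. An initial
  segment of \<open>\<rho>\<close> cuts off a beginning of it, again a suffix or a prefix.\<close>

lemma initial_segment_realizable:
  assumes A: "realizable n k A" and \<rho>: "\<rho> \<in> admissible_orders n k A" and S: "S \<subseteq> A"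
    and closed: "\<And>P Q. precedes \<rho> P Q \<Longrightarrow> Q \<in> S \<Longrightarrow> P \<in> S"
  shows "realizable n k S"
proof (rule realizableI)
  show "S \<subseteq> ksubsets n k"
    using S realizable_subset[OF A] by blast
  let ?U = "inv_set n k A \<rho>"
  have or: "oriented n k A ?U \<rho>"
    by (rule admissible_oriented[OF A \<rho>])
  fix X a b c
  assume X: "X \<in> ksubsets n (Suc k)" and abc: "a \<in> X" "b \<in> X" "c \<in> X" "a < b" "b < c"
    and eq: "X - {a} \<in> S \<longleftrightarrow> X - {c} \<in> S"
  show "X - {b} \<in> S \<longleftrightarrow> X - {a} \<in> S"
  proof (cases "X \<in> ?U")
    case True
    then have parts: "X \<in> suffix_part n k A \<or> X \<in> full_part n k A"
      by (auto simp: inv_set_def)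
    have "X - {x} \<in> S" if xy: "x \<in> X" "y \<in> X" "x < y" "X - {y} \<in> S" for x y
    proof -
      have "X - {y} \<in> A"
        using xy S by blast
      moreover have "X - {x} \<in> A"
        using parts suffixD[OF _ xy(1-3) calculation] fullD[OF _ xy(1)] by blast
      ultimately show ?thesis
        using closed[OF orientedD(1)[OF or X xy(1-3)]] True xy(4) by blast
    qed
    then show ?thesis
      using abc eq by blast
  next
    case False
    have "X - {y} \<in> S" if xy: "x \<in> X" "y \<in> X" "x < y" "X - {x} \<in> S" for x y
    proof -
      have Ax: "X - {x} \<in> A"
        using xy S by blast
      have "X \<in> prefix_part n k A \<or> X \<in> full_part n k A"
        using parts_cases[OF A X xy(1) Ax] False by (auto simp: inv_set_def)
      then have "X - {y} \<in> A"
        using prefixD[OF _ xy(1-3) Ax] fullD[OF _ xy(2)] by blast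
      then show ?thesis
        using closed[OF orientedD(2)[OF or X xy(1-3) Ax]] False xy(4) by blast
    qed
    then show ?thesis
      using abc eq by blast
  qed
qed

lemma segment_realizable:
  assumes A: "realizable n k A" and \<rho>: "\<rho> \<in> admissible_orders n k A"
  shows "realizable n k {P. precedes \<rho> P Q}"
proof (rule initial_segment_realizable[OF A \<rho>])
  show "{P. precedes \<rho> P Q} \<subseteq> A"
    using precedes_in_set[of \<rho> _ Q] admissibleD(2)[OF \<rho>] by auto
  show "P \<in> {P. precedes \<rho> P Q}" if "precedes \<rho> P R" "R \<in> {P. precedes \<rho> P Q}" for P R
    using precedes_trans[OF admissibleD(3)[OF \<rho>]] that by blast
qed

text \<open>Whenever two members of a packet come in the wrong order, the initial segment ending before
  the later one is not realizable; the third member needed to see this is the first or the last one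
  of the packet.\<close>

lemma admissible_if_segments:
  assumes perm: "\<rho> \<in> permutations_of_set A"
    and segment: "\<And>Q. Q \<in> A \<Longrightarrow> realizable n k {P. precedes \<rho> P Q}"
  shows "\<rho> \<in> admissible_orders n k A"
proof -
  note dist = permutationsD(2)[OF perm]
  have outside: "\<not> precedes \<rho> P Q" if "P \<notin> A" for P Q
    using precedes_in_set[of \<rho> P Q] that unfolding permutationsD(1)[OF perm] by blast
  have irrefl: "\<not> precedes \<rho> P P" for P
    by (rule precedes_irrefl[OF dist])
  have comparable: "precedes \<rho> (X - {a}) (X - {b}) \<or> precedes \<rho> (X - {b}) (X - {a})"
    if "X - {a} \<in> A" "X - {b} \<in> A" "a \<in> X" "b \<in> X" "a \<noteq> b" for X a b
  proof -
    have "X - {a} \<noteq> X - {b}"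
      using that by blast
    then show ?thesis
      using precedes_total[of "X - {a}" \<rho> "X - {b}"] that unfolding permutationsD(1)[OF perm] by blast
  qed
  have suf: "precedes \<rho> (X - {x}) (X - {y})"
    if X: "X \<in> suffix_part n k A" and xy: "x \<in> X" "y \<in> X" "x < y" "X - {x} \<in> A" "X - {y} \<in> A"
    for X x y
  proof (rule ccontr)
    assume "\<not> ?thesis"
    then have yx: "precedes \<rho> (X - {y}) (X - {x})"
      using comparable[OF xy(4,5,1,2)] xy(3) by blast
    have Xk: "X \<in> ksubsets n (Suc k)"
      using X parts_subset(1) by blast
    obtain l where l: "l \<in> X" "\<forall>z\<in>X. z \<le> l"
      using ex_greatest[OF ksubsetsD(1)[OF Xk]] xy(1) by blast
    have lA: "X - {l} \<notin> A"
      by (rule greatest_notin_suffix[OF X l])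
    \<comment> \<open>Of the removals of \<open>x < y < l\<close>, only the middle one lies in the
      segment before \<open>X - {x}\<close>, which realizability excludes.\<close>
    then have "y < l"
      using xy(2,5) l by (metis le_neq_implies_less)
    then show False
      using realizable_between[OF segment[OF xy(4)] Xk xy(1,2) l(1) xy(3)] outside[OF lA] irrefl yx
      by blast
  qed
  have pre: "precedes \<rho> (X - {y}) (X - {x})"
    if X: "X \<in> prefix_part n k A" and xy: "x \<in> X" "y \<in> X" "x < y" "X - {x} \<in> A" "X - {y} \<in> A"
    for X x y
  proof (rule ccontr)
    assume "\<not> ?thesis"
    then have yx: "precedes \<rho> (X - {x}) (X - {y})"
      using comparable[OF xy(4,5,1,2)] xy(3) by blast
    have Xk: "X \<in> ksubsets n (Suc k)"
      using X parts_subset(2) by blast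
    obtain l where l: "l \<in> X" "\<forall>z\<in>X. l \<le> z"
      using ex_least[OF ksubsetsD(1)[OF Xk]] xy(1) by blast
    have lA: "X - {l} \<notin> A"
      by (rule least_notin_prefix[OF X l])
    then have "l < x"
      using xy(1,4) l by (metis le_neq_implies_less)
    then show False
      using realizable_between[OF segment[OF xy(5)] Xk l(1) xy(1,2) _ xy(3)] outside[OF lA] irrefl yx
      by blast
  qed
  have full: "(\<forall>x\<in>X. \<forall>y\<in>X. x < y \<longrightarrow> precedes \<rho> (X - {y}) (X - {x})) \<or>
      (\<forall>x\<in>X. \<forall>y\<in>X. x < y \<longrightarrow> precedes \<rho> (X - {x}) (X - {y}))"
    if X: "X \<in> full_part n k A" for X
  proof -
    have Xk: "X \<in> ksubsets n (Suc k)"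
      using X parts_subset(3) by blast
    have all: "X - {x} \<in> A" if "x \<in> X" for x
      using fullD[OF X that] .
    obtain x0 where "x0 \<in> X"
      using ksubsetsD(2)[OF Xk] by fastforce
    then obtain m l where m: "m \<in> X" "\<forall>z\<in>X. m \<le> z" and l: "l \<in> X" "\<forall>z\<in>X. z \<le> l"
      using ex_least[OF ksubsetsD(1)[OF Xk]] ex_greatest[OF ksubsetsD(1)[OF Xk]] by blast
    have trans: "precedes \<rho> P R" if "precedes \<rho> P Q" "precedes \<rho> Q R" for P Q R
      using precedes_trans[OF dist that] .
    note comparable = comparable[OF all all]
    have bounds: "m < z \<or> z = m" "z < l \<or> z = l" if "z \<in> X" for z
      using m(2) l(2) that by (auto simp: le_less)
    have between: "X - {b} \<in> S \<longleftrightarrow> X - {a} \<in> S"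
      if "S = {P. precedes \<rho> P (X - {y})}" "y \<in> X" "a \<in> X" "b \<in> X" "c \<in> X" "a < b" "b < c"
        "X - {a} \<in> S \<longleftrightarrow> X - {c} \<in> S" for S y a b c
      using realizable_between[OF segment[OF all[OF that(2)]] Xk that(3-7)] that(1,8) by blast
    \<comment> \<open>The relative order of the two ends of the packet decides which of the two
      orders it must have.\<close>
    show ?thesis
    proof (cases "precedes \<rho> (X - {m}) (X - {l})")
      case False
      have "precedes \<rho> (X - {y}) (X - {x})" if xy: "x \<in> X" "y \<in> X" "x < y" for x y
      proof (rule ccontr)
        assume "\<not> ?thesis"
        then have yx: "precedes \<rho> (X - {x}) (X - {y})"
          using comparable[OF xy(1,2,1,2)] xy(3) by blast
        define S where "S = {P. precedes \<rho> P (X - {y})}"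
        have S: "X - {x} \<in> S" "X - {y} \<notin> S"
          using yx irrefl by (auto simp: S_def)
        \<comment> \<open>First \<open>l\<close> is excluded by comparison with \<open>x\<close> and
          \<open>y\<close>, then \<open>m\<close>, since otherwise the ends would be in the other
          order; finally \<open>m\<close>, \<open>x\<close>, \<open>l\<close> alternate.\<close>
        have lS: "X - {l} \<notin> S"
          using between[OF S_def xy(2,1,2) l(1) xy(3)] bounds(2)[OF xy(2)] S by blast
        then have "y = l \<or> precedes \<rho> (X - {y}) (X - {l})"
          using comparable[OF xy(2) l(1) xy(2) l(1)] by (auto simp: S_def)
        then have mS: "X - {m} \<notin> S"
          using False trans unfolding S_def by blast
        then have "m < x"
          using S(1) bounds(1)[OF xy(1)] by blast
        moreover have "x < l"
          using xy l(2) by (meson less_le_trans)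
        ultimately show False
          using between[OF S_def xy(2) m(1) xy(1) l(1)] S(1) mS lS by blast
      qed
      then show ?thesis
        by blast
    next
      case True
      have "precedes \<rho> (X - {x}) (X - {y})" if xy: "x \<in> X" "y \<in> X" "x < y" for x y
      proof (rule ccontr)
        assume "\<not> ?thesis"
        then have yx: "precedes \<rho> (X - {y}) (X - {x})"
          using comparable[OF xy(1,2,1,2)] xy(3) by blast
        define S where "S = {P. precedes \<rho> P (X - {x})}"
        have S: "X - {y} \<in> S" "X - {x} \<notin> S"
          using yx irrefl by (auto simp: S_def)
        have mS: "X - {m} \<notin> S"
          using between[OF S_def xy(1) m(1) xy(1,2) _ xy(3)] bounds(1)[OF xy(1)] S by blast
        then have "x = m \<or> precedes \<rho> (X - {x}) (X - {m})"
          using comparable[OF xy(1) m(1) xy(1) m(1)] by (auto simp: S_def)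
        then have lS: "X - {l} \<notin> S"
          using True trans irrefl unfolding S_def by blast
        then have "y < l"
          using S(1) bounds(2)[OF xy(2)] by blast
        moreover have "m < y"
          using xy m(2) by (meson le_less_trans)
        ultimately show False
          using between[OF S_def xy(1) m(1) xy(2) l(1)] S(1) mS lS by blast
      qed
      then show ?thesis
        by blast
    qed
  qed
  have "sorted_wrt antilex_less (restr_order n k X \<rho>)" if "X \<in> suffix_part n k A" for X
    using suf[OF that] sorted_restr_iff(2)[OF perm] that parts_subset(1) by blast
  moreover have "sorted_wrt lex_less (restr_order n k X \<rho>)" if "X \<in> prefix_part n k A" for X
    using pre[OF that] sorted_restr_iff(1)[OF perm] that parts_subset(2) by blast
  moreover have "sorted_wrt lex_less (restr_order n k X \<rho>) \<or> sorted_wrt antilex_less (restr_order n k X \<rho>)"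
    if X: "X \<in> full_part n k A" for X
  proof -
    have "X \<in> ksubsets n (Suc k)"
      using X parts_subset(3) by blast
    then show ?thesis
      using full[OF X] sorted_restr_iff[OF perm] by blast
  qed
  ultimately show ?thesis
    using perm unfolding admissible_orders_def by blast
qed

section \<open>Splitting an order with \<open>L\<close> first into an order of \<open>L\<close> and
  a chain\<close>

context pair_set
begin

text \<open>The prefix, suffix and full packets of \<open>Lset n k\<close> need not be those of
  \<open>Mset n k\<close>, so admissibility is not simply inherited packet by packet. But with
  \<open>Lset n k\<close> first, the segments of the restriction are segments of
  \<open>\<rho>\<close>, and \<open>admissible_if_segments\<close> applies.\<close>

lemma restrict_Lset_admissible:
  assumes \<rho>: "\<rho> \<in> admissible_orders n k (Mset n k)" and first: "L_first n k \<rho>"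
  shows "filter (\<lambda>Y. Y \<in> Lset n k) \<rho> \<in> admissible_orders n k (Lset n k)" (is "?\<tau> \<in> _")
proof (rule admissible_if_segments)
  note set = admissibleD(2,3)[OF \<rho>]
  show "?\<tau> \<in> permutations_of_set (Lset n k)"
    using set Mset_Lset(1)[of n k] by (auto simp: permutations_of_set_def)
  fix Q assume Q: "Q \<in> Lset n k"
  have "P \<in> Lset n k" if "precedes \<rho> P Q" for P
    using that Q first precedes_asym[OF set(2)] precedes_in_set[OF that] set(1) Mset_Lset(3)[of n k]
    unfolding L_first_def by blast
  then have "{P. precedes ?\<tau> P Q} = {P. precedes \<rho> P Q}"
    using Q by (auto simp: precedes_filter)
  moreover have "realizable n k {P. precedes \<rho> P Q}"
    by (rule segment_realizable[OF realizable_Mset \<rho>])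
  ultimately show "realizable n k {P. precedes ?\<tau> P Q}"
    by simp
qed

lemma L_first_split:
  assumes \<rho>: "\<rho> \<in> admissible_orders n k (Mset n k)" and first: "L_first n k \<rho>"
  shows "\<rho> = filter (\<lambda>Y. Y \<in> Lset n k) \<rho> @ filter (\<lambda>Y. Y \<notin> Lset n k) \<rho>"
    and "chain_order n k (filter (\<lambda>Y. Y \<notin> Lset n k) \<rho>)"
proof -
  let ?L = "Lset n k"
  let ?\<tau> = "filter (\<lambda>Y. Y \<in> ?L) \<rho>" and ?Xs = "filter (\<lambda>Y. Y \<notin> ?L) \<rho>"
  note set = admissibleD(2,3)[OF \<rho>]
  show split: "\<rho> = ?\<tau> @ ?Xs"
  proof (rule filter_partition_if_precedes[OF set(2)])
    fix a b assume "a \<in> set \<rho>" "b \<in> set \<rho>" "a \<in> ?L" "b \<notin> ?L"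
    then show "precedes \<rho> a b"
      using first set(1) Mset_Lset(3)[of n k] by (auto simp: L_first_def)
  qed
  have sets: "set ?\<tau> = ?L" "set ?Xs = cliques n k"
    using set(1) Mset_Lset[of n k] by auto
  have "realizable n k (?L \<union> set (take j ?Xs))" for j
  proof (rule initial_segment_realizable[OF realizable_Mset \<rho>])
    show "?L \<union> set (take j ?Xs) \<subseteq> Mset n k"
      using sets set_take_subset[of j ?Xs] Mset_Lset(3)[of n k] by auto
    have \<rho>': "\<rho> = (?\<tau> @ take j ?Xs) @ drop j ?Xs"
      using split by simp
    fix P Q assume PQ: "precedes \<rho> P Q" "Q \<in> ?L \<union> set (take j ?Xs)"
    have mem: "R \<in> ?L \<union> set (take j ?Xs) \<longleftrightarrow> R \<in> set (?\<tau> @ take j ?Xs)" for R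
      using sets(1) by auto
    have "distinct ((?\<tau> @ take j ?Xs) @ drop j ?Xs)"
      using set(2) \<rho>' by simp
    then have "Q \<notin> set (drop j ?Xs)"
      using PQ(2) unfolding mem distinct_append by blast
    moreover have "precedes ((?\<tau> @ take j ?Xs) @ drop j ?Xs) P Q"
      using PQ(1) \<rho>' by simp
    ultimately have "precedes (?\<tau> @ take j ?Xs) P Q"
      using precedes_in_set[of "drop j ?Xs" P Q] unfolding precedes_append[of "?\<tau> @ take j ?Xs"] by blast
    then show "P \<in> ?L \<union> set (take j ?Xs)"
      unfolding mem by (rule precedes_in_set[THEN conjunct1])
  qed
  moreover have "?Xs \<in> permutations_of_set (cliques n k)"
    using sets set(2) by (simp add: permutations_of_set_def)
  ultimately show "chain_order n k ?Xs"
    by (simp add: chain_order_def)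
qed

lemma chain_segment:
  assumes chain: "chain_order n k Xs" and \<tau>: "\<tau> \<in> admissible_orders n k (Lset n k)"
    and Q: "Q \<in> Mset n k"
  shows "realizable n k {P. precedes (\<tau> @ Xs) P Q}"
proof -
  have Xs: "set Xs = cliques n k" "distinct Xs"
    using chain permutationsD unfolding chain_order_def by blast+
  note \<tau>set = admissibleD(2,3)[OF \<tau>]
  consider "Q \<in> Lset n k" "Q \<notin> cliques n k" | "Q \<in> cliques n k" "Q \<notin> Lset n k"
    using Q Mset_Lset(3,4)[of n k] by blast
  then show ?thesis
  proof cases
    case 1
    then have "{P. precedes (\<tau> @ Xs) P Q} = {P. precedes \<tau> P Q}"
      using Xs(1) by (auto simp: precedes_append dest: precedes_in_set)
    moreover have "realizable n k {P. precedes \<tau> P Q}"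
      by (rule segment_realizable[OF realizable_Lset \<tau>])
    ultimately show ?thesis
      by simp
  next
    case 2
    then obtain us vs where split: "Xs = us @ Q # vs"
      using Xs(1) by (metis split_list)
    have "Q \<notin> set us" "Q \<notin> set vs" "Q \<notin> set \<tau>"
      using Xs(2) 2 \<tau>set(1) by (auto simp: split)
    then have "{P. precedes (\<tau> @ Xs) P Q} = Lset n k \<union> set (take (length us) Xs)"
      using \<tau>set(1) by (auto simp: split precedes_append dest: precedes_in_set)
    moreover have "length us \<le> length Xs"
      by (simp add: split)
    ultimately show ?thesis
      using chain unfolding chain_order_def by simp
  qed
qed

lemma chain_order_append:
  assumes chain: "chain_order n k Xs" and \<tau>: "\<tau> \<in> admissible_orders n k (Lset n k)"
  shows "\<tau> @ Xs \<in> admissible_orders n k (Mset n k)" "L_first n k (\<tau> @ Xs)"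
proof -
  have Xs: "set Xs = cliques n k" "distinct Xs"
    using chain permutationsD unfolding chain_order_def by blast+
  note \<tau>set = admissibleD[OF \<tau>]
  have "\<tau> @ Xs \<in> permutations_of_set (Mset n k)"
    using Xs \<tau>set Mset_Lset[of n k] by (auto simp: permutations_of_set_def)
  then show "\<tau> @ Xs \<in> admissible_orders n k (Mset n k)"
    by (rule admissible_if_segments) (rule chain_segment[OF chain \<tau>])
  show "L_first n k (\<tau> @ Xs)"
    using Xs(1) \<tau>set(2) by (auto simp: L_first_def precedes_append)
qed

text \<open>The packets of cliques consist of cliques and do not see \<open>\<tau>\<close>. Hence
  the class of \<open>\<tau> @ Xs\<close> depends on \<open>Xs\<close> alone, which makes the map on
  maximal chains well defined.\<close>

lemma inv_set_append:
  assumes k: "2 \<le> k" and chain: "chain_order n k Xs" and \<tau>: "\<tau> \<in> admissible_orders n k (Lset n k)"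
  shows "inv_set n k (Mset n k) (\<tau> @ Xs) =
    Lset n (Suc k) \<union> {X \<in> cliques n (Suc k). sorted_wrt antilex_less (restr_order n k X Xs)}"
proof -
  let ?\<rho> = "\<tau> @ Xs" and ?M = "Mset n k"
  have sub: "inv_set n k ?M ?\<rho> \<subseteq> Lset n (Suc k) \<union> cliques n (Suc k)"
    using L_first_inv_set[OF k chain_order_append[OF chain \<tau>]]
    unfolding intermediate_def Mset_Lset(3)[of n "Suc k"] by blast
  have "restr_order n k X ?\<rho> = restr_order n k X Xs" if X: "X \<in> cliques n (Suc k)" for X
  proof -
    have "packet n k X \<subseteq> cliques n k"
      using X full_part_cliques[OF k, of n] by (auto simp: full_part_def)
    then have "filter (\<lambda>Y. Y \<in> packet n k X) \<tau> = []"
      using admissibleD(2)[OF \<tau>] Mset_Lset(4)[of n k] by (auto simp: filter_empty_conv)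
    then show ?thesis
      by (simp add: restr_order_def)
  qed
  then show ?thesis
    using sub cliques_full[OF k, of n] Mset_Lset(4)[of n "Suc k"] suffix_part_Mset[OF k, of n]
    unfolding inv_set_def by auto
qed

end

theorem theorem4p10:
  fixes n i :: nat and J :: "nat set set"
  assumes "n \<ge> 2" and "realizable n 2 J" and "i \<ge> 2"
  shows "level_L n J i \<subseteq> level_M n J i \<and> level_M n J i \<subseteq> ksubsets n i \<and>
    ranked_poset (B_set n J i) (B_order n J i) (\<lambda>r. card (B_inv n J i r)) \<and>
    (\<exists>rmin rmax.
      (\<forall>r. minimal_in (B_set n J i) (B_order n J i) r \<longleftrightarrow> r = rmin) \<and>
      (\<forall>r. maximal_in (B_set n J i) (B_order n J i) r \<longleftrightarrow> r = rmax) \<and>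
      B_inv n J i rmin = level_L n J (i + 1) \<and>
      B_inv n J i rmax = level_M n J (i + 1) \<and>
      (\<forall>(rs, Xs) \<in> B_max_chains n J i rmin rmax.
         Xs \<in> permutations_of_set (level_M n J (i + 1) - level_L n J (i + 1))) \<and>
      inj_on fst (B_max_chains n J i rmin rmax) \<and>
      inj_on snd (B_max_chains n J i rmin rmax) \<and>
      (\<forall>(rs, Xs) \<in> B_max_chains n J i rmin rmax.
         \<forall>\<tau> \<in> admissible_orders n (i + 1) (level_L n J (i + 1)).
           \<tau> @ Xs \<in> L_first_orders n J (i + 1)) \<and>
      (\<forall>\<rho> \<in> L_first_orders n J (i + 1).
         \<exists>(rs, Xs) \<in> B_max_chains n J i rmin rmax.
         \<exists>\<tau> \<in> admissible_orders n (i + 1) (level_L n J (i + 1)).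
           (\<tau> @ Xs, \<rho>) \<in> order_equiv n (i + 1) (level_M n J (i + 1))) \<and>
      (\<exists>\<Phi>. \<Phi> ` B_max_chains n J i rmin rmax = B_set n J (i + 1) \<and>
         (\<forall>(rs, Xs) \<in> B_max_chains n J i rmin rmax.
            \<forall>\<tau> \<in> admissible_orders n (i + 1) (level_L n J (i + 1)).
              \<Phi> (rs, Xs) = order_equiv n (i + 1) (level_M n J (i + 1)) `` {\<tau> @ Xs}))) \<and>
    inj_on (B_inv n J i) (B_set n J i)"
proof -
  interpret pair_set J
    by (rule realizable_pair_set[OF assms(2)])
  note J = assms(2) and i = assms(3)
  have i': "2 \<le> Suc i"
    using i by simp
  define k L M where "k = Suc i" and "L = Lset n k" and "M = Mset n k"
  have k: "2 \<le> k" "i + 1 = k"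
    using i by (simp_all add: k_def)
  have levels_k: "level_L n J k = L" "level_M n J k = M" and cliques_k: "M - L = cliques n k"
    using levels[OF J k(1)] Mset_Lset(2) by (simp_all add: L_def M_def)
  define rmin rmax where "rmin = inv_fibre n i (Mset n i) L" and "rmax = inv_fibre n i (Mset n i) M"
  define chains where "chains = B_max_chains n J i rmin rmax"
  have chains: "(rs, Xs) \<in> chains \<longleftrightarrow> chain_order n k Xs \<and> rs = chain_classes n i Xs" for rs Xs
    unfolding chains_def rmin_def rmax_def L_def M_def k_def by (rule max_chains_iff[OF J i])
  define eqclass where "eqclass \<rho> = order_equiv n k M `` {\<rho>}" for \<rho>
  have first_iff: "\<rho> \<in> L_first_orders n J k \<longleftrightarrow> \<rho> \<in> admissible_orders n k M \<and> L_first n k \<rho>" for \<rho>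
    unfolding M_def by (rule L_first_orders_iff[OF J k(1)])
  have append: "\<tau> @ Xs \<in> L_first_orders n J k" if "chain_order n k Xs" "\<tau> \<in> admissible_orders n k L" for \<tau> Xs
    using chain_order_append that unfolding first_iff L_def M_def by blast
  have split: "\<exists>\<tau> Xs. \<rho> = \<tau> @ Xs \<and> chain_order n k Xs \<and> \<tau> \<in> admissible_orders n k L"
    if "\<rho> \<in> L_first_orders n J k" for \<rho>
  proof -
    have \<rho>: "\<rho> \<in> admissible_orders n k (Mset n k)" "L_first n k \<rho>"
      using that unfolding first_iff M_def by blast+
    show ?thesis
      unfolding L_def using L_first_split[OF \<rho>] restrict_Lset_admissible[OF \<rho>] by metis
  qed
  have eqclass_eq: "eqclass (\<tau> @ Xs) = eqclass (\<tau>' @ Xs)"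
    if "chain_order n k Xs" "\<tau> \<in> admissible_orders n k L" "\<tau>' \<in> admissible_orders n k L" for \<tau> \<tau>' Xs
    using chain_order_append(1)[of n k Xs] inv_set_append[OF k(1) that(1)] that realizable_Mset
    unfolding eqclass_def L_def M_def by (simp add: order_equiv_class)
  have B_k: "r \<in> B_set n J k \<longleftrightarrow> (\<exists>\<rho>\<in>L_first_orders n J k. r = eqclass \<rho>)" for r
  proof
    assume "r \<in> B_set n J k"
    then obtain \<rho> where \<rho>: "r \<in> order_classes n k M" "\<rho> \<in> r" "\<rho> \<in> L_first_orders n J k"
      unfolding B_set_def levels_k by blast
    then have "r = eqclass \<rho>"
      using order_classD(1)[OF realizable_Mset, of r n k] order_classD(3)[OF realizable_Mset, of r n k]
        order_equiv_class[OF realizable_Mset, of \<rho> n k]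
      unfolding eqclass_def M_def by metis
    then show "\<exists>\<rho>\<in>L_first_orders n J k. r = eqclass \<rho>"
      using \<rho>(3) by blast
  next
    assume "\<exists>\<rho>\<in>L_first_orders n J k. r = eqclass \<rho>"
    then obtain \<rho> where \<rho>: "\<rho> \<in> L_first_orders n J k" "r = eqclass \<rho>"
      by blast
    then have "\<rho> \<in> admissible_orders n k M"
      using first_iff by blast
    then have "r \<in> order_classes n k M" "\<rho> \<in> r"
      using order_equiv_iff[OF realizable_Mset, of \<rho> \<rho> n k]
      unfolding \<rho>(2) eqclass_def order_classes_def M_def by (auto intro: quotientI)
    then show "r \<in> B_set n J k"
      using \<rho>(1) unfolding B_set_def levels_k by blast
  qed
  \<comment> \<open>An admissible order of \<open>L\<close> exists, since the poset one level up is
    nonempty and a representative with \<open>L\<close> first begins with such an order.\<close>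
  obtain \<tau>0 where \<tau>0: "\<tau>0 \<in> admissible_orders n k L"
  proof -
    have "inv_fibre n k (Mset n k) (Lset n (Suc k)) \<in> B_set n J k"
      by (rule fibre_in_B_set[OF J k(1) intermediate_Lset])
    then obtain \<rho> where "\<rho> \<in> L_first_orders n J k"
      using B_k by blast
    then show thesis
      using split[of \<rho>] that by blast
  qed
  \<comment> \<open>Any fixed \<open>\<tau>0\<close> serves, as by \<open>eqclass_eq\<close> the
    class does not depend on it.\<close>
  define \<Phi> where "\<Phi> p = eqclass (\<tau>0 @ snd p)" for p :: "nat set list set list \<times> nat set list"
  have surj: "\<Phi> ` chains = B_set n J k"
  proof (intro equalityI subsetI)
    fix r assume "r \<in> \<Phi> ` chains"
    then show "r \<in> B_set n J k"
      using append[OF _ \<tau>0] unfolding B_k by (auto simp: chains \<Phi>_def)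
  next
    fix r assume "r \<in> B_set n J k"
    then obtain \<tau> Xs where *: "chain_order n k Xs" "\<tau> \<in> admissible_orders n k L" "r = eqclass (\<tau> @ Xs)"
      using B_k split by metis
    then have "r = \<Phi> (chain_classes n i Xs, Xs)"
      using eqclass_eq[OF *(1) \<tau>0] by (simp add: \<Phi>_def)
    then show "r \<in> \<Phi> ` chains"
      using chains *(1) by blast
  qed
  have refl: "(\<rho>, \<rho>) \<in> order_equiv n k M" if "\<rho> \<in> L_first_orders n J k" for \<rho>
    using order_equiv_iff[OF realizable_Mset, of \<rho> \<rho> n k] that first_iff by (simp add: M_def)
  have "inj_on fst chains"
    using chain_classes_inj[OF i] by (auto simp: inj_on_def chains k_def)
  moreover have "inj_on snd chains"
    by (auto simp: inj_on_def chains)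
  moreover have "\<forall>(rs, Xs)\<in>chains. Xs \<in> permutations_of_set (M - L)"
    by (auto simp: chains chain_order_def cliques_k)
  moreover have "\<forall>(rs, Xs)\<in>chains. \<forall>\<tau>\<in>admissible_orders n k L. \<tau> @ Xs \<in> L_first_orders n J k"
    using append by (auto simp: chains)
  moreover have "\<forall>\<rho>\<in>L_first_orders n J k. \<exists>(rs, Xs)\<in>chains. \<exists>\<tau>\<in>admissible_orders n k L.
      (\<tau> @ Xs, \<rho>) \<in> order_equiv n k M"
  proof
    fix \<rho> assume \<rho>: "\<rho> \<in> L_first_orders n J k"
    then obtain \<tau> Xs where *: "\<rho> = \<tau> @ Xs" "chain_order n k Xs" "\<tau> \<in> admissible_orders n k L"
      using split by blast
    then have "(chain_classes n i Xs, Xs) \<in> chains" "(\<tau> @ Xs, \<rho>) \<in> order_equiv n k M"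
      using refl[OF \<rho>] by (simp_all add: chains)
    then show "\<exists>(rs, Xs)\<in>chains. \<exists>\<tau>\<in>admissible_orders n k L. (\<tau> @ Xs, \<rho>) \<in> order_equiv n k M"
      using *(3) by blast
  qed
  moreover have "\<exists>\<Phi>. \<Phi> ` chains = B_set n J k \<and> (\<forall>(rs, Xs)\<in>chains. \<forall>\<tau>\<in>admissible_orders n k L.
      \<Phi> (rs, Xs) = order_equiv n k M `` {\<tau> @ Xs})"
  proof -
    have "\<Phi> (rs, Xs) = order_equiv n k M `` {\<tau> @ Xs}"
      if "(rs, Xs) \<in> chains" and \<tau>: "\<tau> \<in> admissible_orders n k L" for rs Xs \<tau>
    proof -
      have "chain_order n k Xs"
        using that(1) by (simp add: chains)
      from eqclass_eq[OF this \<tau>0 \<tau>] show ?thesis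
        by (simp add: \<Phi>_def eqclass_def)
    qed
    then show ?thesis
      using surj by blast
  qed
  moreover have "B_inv n J i rmin = L" "B_inv n J i rmax = M"
    unfolding rmin_def rmax_def L_def M_def k_def
    by (rule B_inv_fibre[OF J i intermediate_Lset], rule B_inv_fibre[OF J i intermediate_Mset])
  moreover have "\<forall>r. minimal_in (B_set n J i) (B_order n J i) r \<longleftrightarrow> r = rmin"
    "\<forall>r. maximal_in (B_set n J i) (B_order n J i) r \<longleftrightarrow> r = rmax"
    using minimal_B_iff[OF J i] maximal_B_iff[OF J i]
    unfolding rmin_def rmax_def L_def M_def k_def by blast+
  moreover have "inj_on (B_inv n J i) (B_set n J i)"
    by (rule inj_onI) (metis B_setD(2)[OF J i])
  moreover have "level_L n J i \<subseteq> level_M n J i" "level_M n J i \<subseteq> ksubsets n i"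
    using levels[OF J i] Mset_Lset(1,5) by simp_all
  ultimately show ?thesis
    using ranked_poset_B[OF J i] unfolding k(2) levels_k chains_def by blast
qed

end
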